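(* The set $\{M\in\mathbb{N}: S(R_M)<s(|R_M|)\}$ has positive lower asymptotic density, i.e. $\liminf_{N\to\infty}\frac{1}{N}\#\{M\le N: S(R_M)<s(|R_M|)\}>0$.
   Context: For a positive integer $n$ and a subset $U\subseteq\mathbb{Z}_n$ of size $k\ge 2$, write its elements as integers $0\le u_1<\dots<u_k<n$, put $s_i=u_{i+1}-u_i$ ($1\le i\le k-1$), $s_k=u_1+n-u_k$, and $S(U)=\sum_{i=1}^k s_i^2$. For $U\subseteq\mathbb{Z}_M$, $s(k)$ denotes the average of $S(U)$ over all $k$-element subsets $U$ of $\mathbb{Z}_M$. $R_M=\{a^2:a\in\mathbb{Z}_M\}$ is the set of quadratic residues modulo $M$ (including $0$). *)

theory Defs
  imports "HOL-Analysis.Analysis"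
begin

text \<open>
  Subsets of \<open>\<int>\<^sub>n\<close> are represented by their sets of least nonnegative representatives, i.e. by
  subsets of \<open>{0..<n}\<close>. Indices start at 0, so \<open>cyclic_gap n U i\<close> is the spacing \<open>s\<^sub>i\<^sub>+\<^sub>1\<close>.
\<close>

definition cyclic_gap :: "nat \<Rightarrow> nat set \<Rightarrow> nat \<Rightarrow> int" where
  "cyclic_gap n U i =
     (let u = (\<lambda>j. int (sorted_list_of_set U ! j)); k = card U
      in if i < k - 1 then u (i + 1) - u i else u 0 + int n - u (k - 1))"

definition gap_square_sum :: "nat \<Rightarrow> nat set \<Rightarrow> int" where
  "gap_square_sum n U = (\<Sum>i<card U. (cyclic_gap n U i)\<^sup>2)"

definition avg_gap_square_sum :: "nat \<Rightarrow> nat \<Rightarrow> real" where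
  "avg_gap_square_sum n k =
     (\<Sum>U\<in>{U. U \<subseteq> {0..<n} \<and> card U = k}. real_of_int (gap_square_sum n U)) /
     real (card {U. U \<subseteq> {0..<n} \<and> card U = k})"

definition quad_residues :: "nat \<Rightarrow> nat set" where
  "quad_residues M = (\<lambda>a. a\<^sup>2 mod M) ` {0..<M}"

text \<open>The value at \<open>N = 0\<close> is irrelevant to the lower limit.\<close>

definition lower_density :: "nat set \<Rightarrow> ereal" where
  "lower_density A = liminf (\<lambda>N. ereal (real (card {M \<in> A. 1 \<le> M \<and> M \<le> N}) / real N))"

end

theory Submission
  imports Defs "HOL-Number_Theory.Number_Theory" "HOL-Computational_Algebra.Squarefree"
    "HOL-Real_Asymp.Real_Asymp"
begin

hide_const (open) UnivPoly.coeff UnivPoly.monom Module.smult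

text \<open>
  Let \<open>Z(L)\<close> be the number of \<open>x\<close> modulo \<open>M\<close> such that \<open>x + 1, \<dots>, x + L\<close> are all non-squares. Then
  \<open>S(R\<^sub>M) = 2 \<Sum>\<^sub>L Z(L) - M\<close>, and a double count gives \<open>s(k) = 2 M (M + 1) / (k + 1) - M\<close>, so the claim for \<open>M\<close> is
  \<open>\<Sum>\<^sub>L Z(L) < M (M + 1) / (k + 1)\<close> with \<open>k = |R\<^sub>M|\<close>.

  Put \<open>\<Lambda> = ln N\<close> and take \<open>M = q t \<le> N\<close> with \<open>3 \<le> q \<le> \<Lambda>\<^bsup>1/20\<^esup>\<close> and \<open>t\<close> squarefree whose number of prime factors is of order \<open>ln \<Lambda>\<close>, all of
  them larger than a high power of \<open>\<Lambda>\<close>. Modulo the primes of \<open>t\<close> squares behave like independent coin tosses: the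
  correlations are controlled by Weil's bound, proved by Stepanov's method. So \<open>R\<^sub>M\<close> is a random thinning, with
  probability \<open>\<alpha> = 2\<^bsup>-\<omega>(t)\<^esup>\<close>, of the periodic set \<open>R\<^sub>q\<close> of density \<open>e / q\<close>. A periodic set is more regular than a random
  one: averaging over the period gives \<open>\<Sum>\<^sub>L Z(L) / M \<approx> q / (e \<alpha>) - (q - e) / (2 e)\<close>, whereas a random set would give
  \<open>q / (e \<alpha>)\<close>. This gain survives because all errors are negative powers of \<open>\<Lambda>\<close>.

  For long windows the correlation estimates are useless. If \<open>x + 1, \<dots>, x + H\<close> are non-squares and \<open>b\<close> is a prime, then
  dividing by \<open>b\<close> yields windows of length about \<open>H / b\<close> free of \<open>b\<^sup>-\<^sup>1 R\<^sub>M\<close> near all the points \<open>(x + k M) / b\<close>. For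
  different \<open>b\<close> these are almost independent by a large sieve argument, hence long empty windows are so rare that
  their contribution to \<open>\<Sum>\<^sub>L Z(L)\<close> is negligible.

  Finally the family has positive lower density: writing \<open>t = a P\<close> with \<open>P\<close> the largest prime factor, the number of \<open>M\<close> is
  of order \<open>N / \<Lambda>\<close> times \<open>\<Sum> 1 / (q a)\<close>; here \<open>\<Sum> 1 / q\<close> is of order \<open>ln \<Lambda>\<close>, while \<open>\<Sum> 1 / a\<close>, over squarefree \<open>a\<close> without prime
  factors up to a power of \<open>\<Lambda>\<close>, is of order \<open>\<Lambda> / ln \<Lambda>\<close>.
\<close>

section \<open>Gaps and empty windows\<close>

text \<open>The gain over a random set may be as small as order 1 / q, while the main term
  \<open>q / (e * \<alpha>)\<close> may be a power of \<Lambda>, so every relative error has to be a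
  negative power of \<Lambda>; this fixes the parameters. The size of \<open>2 ^ card T\<close> is
  kept between \<Lambda>^(1/4) and \<Lambda>^2: the lower bound makes \<open>q^3 * \<alpha>\<close>
  small, so that second-order terms do not eat the gain, and the upper bound keeps the window
  lengths and the number of twists polynomial in \<Lambda>. Inclusion-exclusion is truncated at K of
  order ln \<Lambda>; 2^K is then a power of \<Lambda>, which primes beyond \<Lambda>^220 outweigh,
  and the character sum bound may lose a constant. The obstacle is the range of L, which runs up to
  M and thus almost to e^\<Lambda>, whereas correlations control only windows of length polynomial
  in \<Lambda>. The dilation argument turns the estimate at one length J, known for all twists b,
  into a decay like 1 / L, whose sum costs just one factor \<Lambda>. Varying q is what makes the
  density positive: a fixed q would leave the factor 1 / ln \<Lambda> of the sieve
  uncompensated.\<close>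

definition free_windows :: "nat \<Rightarrow> nat set \<Rightarrow> nat \<Rightarrow> nat" where
  "free_windows n U L = card {x\<in>{0..<n}. \<forall>i\<in>{1..L}. (x + i) mod n \<notin> U}"

lemma card_filter_eq_sum:
  "finite A \<Longrightarrow> card {x\<in>A. P x} = (\<Sum>x\<in>A. if P x then 1 else 0)"
  by (simp add: sum.inter_filter[symmetric])

lemma sum_atLeastLessThan_concat_mono:
  fixes u :: "nat \<Rightarrow> nat"
  assumes "\<And>i. i < m \<Longrightarrow> u i \<le> u (Suc i)"
  shows "(\<Sum>i<m. \<Sum>x\<in>{u i..<u (Suc i)}. f x) = (\<Sum>x\<in>{u 0..<u m}. f x :: nat)"
  using assms
proof (induction m)
  case (Suc m)
  have "u 0 \<le> u i" if "i \<le> m" for i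
    using that
  proof (induction i)
    case (Suc i)
    then show ?case using \<open>\<And>i. i < Suc m \<Longrightarrow> u i \<le> u (Suc i)\<close>[of i] by simp
  qed simp
  then have "u 0 \<le> u m" by simp
  moreover have "u m \<le> u (Suc m)" using Suc.prems by simp
  ultimately show ?case using Suc by (simp add: sum.atLeastLessThan_concat)
qed simp

lemma two_times_sum_countdown:
  fixes a b :: nat
  assumes "a \<le> b"
  shows "2 * (\<Sum>x\<in>{a..<b}. b - x) = (b - a)^2 + (b - a)"
proof -
  obtain d where b: "b = a + d" using assms le_Suc_ex by blast
  have "(\<Sum>x\<in>{a..<b}. b - x) = (\<Sum>x\<in>{0..<d}. d - x)"
    using sum.shift_bounds_nat_ivl[of "\<lambda>x. b - x" 0 a d] by (simp add: b add.commute)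
  moreover have "2 * (\<Sum>x\<in>{0..<d}. d - x) = d^2 + d"
  proof (induction d)
    case (Suc d)
    have "(\<Sum>x\<in>{0..<Suc d}. Suc d - x) = (\<Sum>x\<in>{0..<d}. (d - x) + 1) + 1"
      by (simp add: Suc_diff_le less_imp_le cong: sum.cong_simp)
    then show ?case using Suc unfolding sum.distrib by (simp add: power2_eq_square)
  qed simp
  ultimately show ?thesis by (simp add: b)
qed

text \<open>Counting by x instead of L: from x in the gap [u_i, u_(i+1)) the window stays free
  exactly for L < u_(i+1) - x. A gap s therefore contributes s + ... + 1 = (s^2 + s) / 2, and the
  gaps add up to n.\<close>

lemma gap_square_sum_eq_free_windows:
  assumes U: "U \<subseteq> {0..<n}" "U \<noteq> {}"
  shows "gap_square_sum n U = 2 * int (\<Sum>L<n. free_windows n U L) - int n"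
proof -
  define xs where "xs = sorted_list_of_set U"
  define k where "k = card U"
  have fin: "finite U" using U finite_subset by blast
  have k0: "k > 0" using U fin by (simp add: k_def card_gt_0_iff)
  have len: "length xs = k" and set: "set xs = U" and sxs: "sorted_wrt (<) xs"
    using fin by (simp_all add: xs_def k_def)
  \<comment> \<open>Index k stands for the first element one turn later, which makes the last cyclic
    gap an ordinary difference.\<close>
  define u where "u i = (if i < k then xs ! i else xs ! 0 + n)" for i
  have umono: "u i < u (Suc i)" if "i < k - 1" for i
    using that sxs len by (auto simp: u_def sorted_wrt_nth_less)
  have uU: "u i \<in> U" if "i < k" for i using that len set by (auto simp: u_def)
  have Uu: "\<exists>i<k. v = u i" if "v \<in> U" for v
    using that len unfolding set[symmetric] in_set_conv_nth u_def by auto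
  have less: "u i < u j" if "i < j" "j < k" for i j
    using that sxs len by (auto simp: u_def sorted_wrt_nth_less)
  have u0n: "u 0 < n" "u (k - 1) < n" using uU[of 0] uU[of "k-1"] k0 U by auto
  have uk: "u k = u 0 + n" using k0 by (simp add: u_def)
  define c where "c x = card {L\<in>{..<n}. \<forall>i\<in>{1..L}. (x + i) mod n \<notin> U}" for x
  have c_eq: "c x = d"
    if d: "d \<le> n" "0 < d" "(x + d) mod n \<in> U" "\<And>i. 1 \<le> i \<Longrightarrow> i < d \<Longrightarrow> (x + i) mod n \<notin> U" for x d
  proof -
    have "{L\<in>{..<n}. \<forall>i\<in>{1..L}. (x + i) mod n \<notin> U} = {..<d}"
    proof (intro equalityI subsetI)
      fix L assume L: "L \<in> {L\<in>{..<n}. \<forall>i\<in>{1..L}. (x + i) mod n \<notin> U}"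
      show "L \<in> {..<d}"
      proof (rule ccontr)
        assume "L \<notin> {..<d}"
        then have "d \<in> {1..L}" using d by auto
        then show False using L d by blast
      qed
    qed (use d in auto)
    then show ?thesis by (simp add: c_def)
  qed
  have "(\<Sum>L<n. free_windows n U L) = (\<Sum>L<n. \<Sum>x\<in>{0..<n}. if \<forall>i\<in>{1..L}. (x + i) mod n \<notin> U then 1 else 0)"
    unfolding free_windows_def by (intro sum.cong refl card_filter_eq_sum) simp
  also have "\<dots> = (\<Sum>x\<in>{0..<n}. \<Sum>L<n. if \<forall>i\<in>{1..L}. (x + i) mod n \<notin> U then 1 else 0)"
    by (rule sum.swap)
  also have "\<dots> = (\<Sum>x\<in>{0..<n}. c x)"
    unfolding c_def by (intro sum.cong refl card_filter_eq_sum[symmetric]) simp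
  finally have S1: "(\<Sum>L<n. free_windows n U L) = (\<Sum>x\<in>{0..<n}. c x)" .
  have c_per: "c (x + n) = c x" for x
  proof -
    have "(x + n + i) mod n = (x + i) mod n" for i by (metis add.assoc add.commute mod_add_self2)
    then show ?thesis by (simp add: c_def)
  qed
  have "(\<Sum>x\<in>{u 0..<u k}. c x) = (\<Sum>x\<in>{u 0..<n}. c x) + (\<Sum>x\<in>{n..<u 0 + n}. c x)"
    using u0n by (simp add: uk sum.atLeastLessThan_concat)
  also have "(\<Sum>x\<in>{n..<u 0 + n}. c x) = (\<Sum>x\<in>{0..<u 0}. c x)"
    using sum.shift_bounds_nat_ivl[of c 0 n "u 0"] by (simp add: c_per)
  also have "(\<Sum>x\<in>{u 0..<n}. c x) + (\<Sum>x\<in>{0..<u 0}. c x) = (\<Sum>x\<in>{0..<n}. c x)"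
    using u0n sum.atLeastLessThan_concat[of 0 "u 0" n c] by simp
  finally have S2: "(\<Sum>x\<in>{0..<n}. c x) = (\<Sum>x\<in>{u 0..<u k}. c x)" ..
  have umono': "u i < u (Suc i)" if "i < k" for i
  proof (cases "i < k - 1")
    case False
    then have "i = k - 1" using that by simp
    then show ?thesis using u0n uk k0 by simp
  qed (rule umono)
  have S3: "(\<Sum>x\<in>{u 0..<u k}. c x) = (\<Sum>i<k. \<Sum>x\<in>{u i..<u (Suc i)}. c x)"
    using umono' by (intro sum_atLeastLessThan_concat_mono[symmetric] less_imp_le) auto
  have cx: "c x = u (Suc i) - x" if i: "i < k" and x: "x \<in> {u i..<u (Suc i)}" for i x
  proof (rule c_eq)
    show "0 < u (Suc i) - x" using x by simp
    show "u (Suc i) - x \<le> n"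
    proof (cases "Suc i < k")
      case True
      then show ?thesis using uU[of "Suc i"] U by fastforce
    next
      case False
      then have e: "Suc i = k" using i by simp
      have "u 0 \<le> u i" using less[of 0 i] i by (cases i) auto
      then show ?thesis using x unfolding e uk by auto
    qed
    show "(x + (u (Suc i) - x)) mod n \<in> U"
    proof (cases "Suc i < k")
      case True
      then have "u (Suc i) \<in> U" by (rule uU)
      moreover then have "u (Suc i) < n" using U by auto
      ultimately show ?thesis using x by simp
    next
      case False
      then have e: "Suc i = k" using i by simp
      show ?thesis using x u0n uU[of 0] k0 unfolding e uk by simp
    qed
    fix j assume j: "1 \<le> j" "j < u (Suc i) - x"
    show "(x + j) mod n \<notin> U"
    proof
      assume "(x + j) mod n \<in> U"
      then obtain v where v: "v < k" "(x + j) mod n = u v" using Uu by blast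
      have xj: "u i < x + j" "x + j < u (Suc i)" using x j by auto
      show False
      proof (cases "x + j < n")
        case True
        then have "x + j = u v" using v by simp
        then have "u i < u v" "u v < u (Suc i)" using xj by auto
        moreover have "v \<le> i \<or> Suc i \<le> v" by auto
        ultimately show False using less[of v i] less[of "Suc i" v] i v
          by (metis le_neq_implies_less less_asym less_irrefl)
      next
        case False
        have e: "Suc i = k"
        proof (rule ccontr)
          assume "Suc i \<noteq> k"
          then have "u (Suc i) < n" using i uU[of "Suc i"] U by auto
          then show False using False xj by simp
        qed
        then have "x + j - n < u 0" using xj uk False by simp
        moreover have "(x + j) mod n = x + j - n"
          using False xj(2) u0n unfolding e uk by (simp add: le_mod_geq)
        ultimately have "u v < u 0" using v by simp
        then show False using less[of 0 v] v by (cases v) auto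
      qed
    qed
  qed
  have g: "cyclic_gap n U i = int (u (Suc i) - u i)" if "i < k" for i
  proof (cases "i < k - 1")
    case True
    then have "int (u (Suc i) - u i) = int (xs ! Suc i) - int (xs ! i)"
      using umono[OF True] \<open>i < k\<close> less_diff_conv[of i k 1] True by (auto simp: u_def of_nat_diff)
    then show ?thesis using True by (simp add: cyclic_gap_def Let_def xs_def k_def)
  next
    case False
    then have e: "i = k - 1" using that by simp
    have "u k - u (k - 1) = xs ! 0 + n - xs ! (k - 1)" using k0 by (simp add: u_def)
    moreover have "xs ! (k - 1) \<le> n" using u0n k0 by (simp add: u_def)
    ultimately show ?thesis using k0 by (simp add: e cyclic_gap_def Let_def xs_def k_def of_nat_diff)
  qed
  have "2 * (\<Sum>L<n. free_windows n U L) = (\<Sum>i<k. 2 * (\<Sum>x\<in>{u i..<u (Suc i)}. c x))"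
    unfolding S1 S2 S3 by (simp add: sum_distrib_left)
  also have "\<dots> = (\<Sum>i<k. 2 * (\<Sum>x\<in>{u i..<u (Suc i)}. u (Suc i) - x))"
    using cx by simp
  also have "\<dots> = (\<Sum>i<k. (u (Suc i) - u i)^2 + (u (Suc i) - u i))"
    using umono' by (intro sum.cong refl two_times_sum_countdown less_imp_le) auto
  also have "\<dots> = (\<Sum>i<k. (u (Suc i) - u i)^2) + (\<Sum>i<k. u (Suc i) - u i)" by (rule sum.distrib)
  also have "(\<Sum>i<k. u (Suc i) - u i) = n"
  proof -
    have "int (\<Sum>i<k. u (Suc i) - u i) = (\<Sum>i<k. int (u (Suc i)) - int (u i))"
      using umono' by (simp add: of_nat_diff less_imp_le)
    also have "\<dots> = int (u k) - int (u 0)" by (rule sum_lessThan_telescope)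
    also have "\<dots> = int n" by (simp add: uk)
    finally show ?thesis by (simp only: of_nat_eq_iff)
  qed
  finally have "2 * (\<Sum>L<n. free_windows n U L) = (\<Sum>i<k. (u (Suc i) - u i)^2) + n" .
  then have "2 * int (\<Sum>L<n. free_windows n U L) = int (\<Sum>i<k. (u (Suc i) - u i)^2) + int n"
    by (metis of_nat_add of_nat_mult of_nat_numeral)
  moreover have "gap_square_sum n U = int (\<Sum>i<k. (u (Suc i) - u i)^2)"
    unfolding gap_square_sum_def k_def[symmetric] using g by simp
  ultimately show ?thesis by simp
qed

text \<open>\<open>L \<le> n\<close> makes the L residues after x distinct, so the sets U counted at
  x are the k-subsets of a set of n - L elements.\<close>

lemma sum_free_windows_over_subsets:
  assumes "L \<le> n"
  shows "(\<Sum>U\<in>{U. U \<subseteq> {0..<n} \<and> card U = k}. free_windows n U L) = n * ((n - L) choose k)"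
proof -
  let ?C = "{U. U \<subseteq> {0..<n} \<and> card U = k}"
  have finC: "finite ?C" by (rule finite_subset[of _ "Pow {0..<n}"]) auto
  have "(\<Sum>U\<in>?C. free_windows n U L) = (\<Sum>U\<in>?C. \<Sum>x\<in>{0..<n}. if \<forall>i\<in>{1..L}. (x + i) mod n \<notin> U then 1 else 0)"
    unfolding free_windows_def by (intro sum.cong refl card_filter_eq_sum) simp
  also have "\<dots> = (\<Sum>x\<in>{0..<n}. \<Sum>U\<in>?C. if \<forall>i\<in>{1..L}. (x + i) mod n \<notin> U then 1 else 0)"
    by (rule sum.swap)
  also have "\<dots> = (\<Sum>x\<in>{0..<n}. (n - L) choose k)"
  proof (intro sum.cong refl)
    fix x assume x: "x \<in> {0..<n}"
    define W where "W = (\<lambda>i. (x + i) mod n) ` {1..L}"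
    have "inj_on (\<lambda>i. (x + i) mod n) {1..L}"
    proof (rule inj_onI)
      fix i j assume ij: "i \<in> {1..L}" "j \<in> {1..L}" "(x + i) mod n = (x + j) mod n"
      then have c: "[i = j] (mod n)" by (metis cong_def cong_add_lcancel_nat)
      have "int n dvd int i - int j" using c by (simp add: cong_int_iff[symmetric] cong_iff_dvd_diff)
      moreover have "\<bar>int i - int j\<bar> < int n" using ij assms by auto
      ultimately show "i = j" using dvd_imp_le_int[of "int i - int j" "int n"] by auto
    qed
    then have cW: "card W = L" by (simp add: W_def card_image)
    have Wn: "W \<subseteq> {0..<n}" using x by (auto simp: W_def)
    have "(\<Sum>U\<in>?C. if \<forall>i\<in>{1..L}. (x + i) mod n \<notin> U then 1 else 0) = card {U\<in>?C. \<forall>i\<in>{1..L}. (x + i) mod n \<notin> U}"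
      using finC by (rule card_filter_eq_sum[symmetric])
    also have "{U\<in>?C. \<forall>i\<in>{1..L}. (x + i) mod n \<notin> U} = {U. U \<subseteq> {0..<n} - W \<and> card U = k}"
      by (auto simp: W_def)
    also have "card \<dots> = card ({0..<n} - W) choose k" by (rule n_subsets) simp
    also have "card ({0..<n} - W) = n - L" using Wn cW by (simp add: card_Diff_subset finite_subset)
    finally show "(\<Sum>U\<in>?C. if \<forall>i\<in>{1..L}. (x + i) mod n \<notin> U then 1 else 0) = (n - L) choose k" .
  qed
  finally show ?thesis by simp
qed

text \<open>Summing the previous count over L is a hockey-stick sum,
  \<open>Suc n choose Suc k\<close>, and its quotient by \<open>n choose k\<close> is (n + 1) / (k +
  1).\<close>

lemma avg_gap_square_sum_eq:
  assumes "1 \<le> k" "k \<le> n"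
  shows "avg_gap_square_sum n k = 2 * real n * (real n + 1) / (real k + 1) - real n"
proof -
  let ?C = "{U. U \<subseteq> {0..<n} \<and> card U = k}"
  have cC: "card ?C = n choose k" using n_subsets[of "{0..<n}" k] by simp
  have pos: "n choose k > 0" using assms by simp
  have "(\<Sum>U\<in>?C. real_of_int (gap_square_sum n U)) = (\<Sum>U\<in>?C. 2 * real (\<Sum>L<n. free_windows n U L) - real n)"
  proof (intro sum.cong refl)
    fix U assume "U \<in> ?C"
    then have "U \<subseteq> {0..<n}" "U \<noteq> {}" using assms by auto
    from gap_square_sum_eq_free_windows[OF this]
    show "real_of_int (gap_square_sum n U) = 2 * real (\<Sum>L<n. free_windows n U L) - real n" by simp
  qed
  also have "\<dots> = 2 * real (\<Sum>U\<in>?C. \<Sum>L<n. free_windows n U L) - real n * (n choose k)"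
    by (simp add: sum_subtractf sum_distrib_left cC)
  also have "(\<Sum>U\<in>?C. \<Sum>L<n. free_windows n U L) = (\<Sum>L<n. n * ((n - L) choose k))"
    by (subst sum.swap) (simp add: sum_free_windows_over_subsets)
  also have "\<dots> = n * (\<Sum>L<n. (n - L) choose k)" by (simp add: sum_distrib_left)
  also have "(\<Sum>L<n. (n - L) choose k) = (\<Sum>j\<le>n. j choose k)"
  proof -
    have "(\<Sum>L<n. (n - L) choose k) = (\<Sum>j\<in>{1..n}. j choose k)"
      by (rule sum.reindex_bij_witness[of _ "\<lambda>j. n - j" "\<lambda>L. n - L"]) auto
    also have "\<dots> = (\<Sum>j\<le>n. j choose k)"
      using assms by (intro sum.mono_neutral_left) auto
    finally show ?thesis .
  qed
  also have "\<dots> = Suc n choose Suc k" by (rule sum_choose_upper)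
  finally have "(\<Sum>U\<in>?C. real_of_int (gap_square_sum n U)) = 2 * real n * real (Suc n choose Suc k) - real n * (n choose k)"
    by simp
  moreover have "real (Suc n choose Suc k) = (real n + 1) / (real k + 1) * real (n choose k)"
  proof -
    have "real (Suc k * (Suc n choose Suc k)) = real (Suc n * (n choose k))"
      using Suc_times_binomial_eq[of n k] by (simp only: mult.commute)
    then show ?thesis by (simp add: field_simps)
  qed
  ultimately have "avg_gap_square_sum n k = (2 * real n * ((real n + 1) / (real k + 1) * real (n choose k)) - real n * (n choose k)) / (n choose k)"
    unfolding avg_gap_square_sum_def cC by simp
  also have "\<dots> = 2 * real n * (real n + 1) / (real k + 1) - real n"
    using pos by (simp add: diff_divide_distrib)
  finally show ?thesis .
qed

lemma gap_square_sum_less_avg_iff: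
  assumes "U \<subseteq> {0..<n}" "U \<noteq> {}"
  shows "real_of_int (gap_square_sum n U) < avg_gap_square_sum n (card U) \<longleftrightarrow>
     real (\<Sum>L<n. free_windows n U L) < real n * (real n + 1) / (real (card U) + 1)"
proof -
  have "finite U" using assms finite_subset by blast
  then have k: "1 \<le> card U" "card U \<le> n"
    using assms card_mono[of "{0..<n}" U] by (auto simp: Suc_le_eq card_gt_0_iff)
  show ?thesis
    unfolding avg_gap_square_sum_eq[OF k] gap_square_sum_eq_free_windows[OF assms] by (simp add: mult.assoc flip: times_divide_eq_right)
qed

section \<open>A large sieve for dilates\<close>

definition addchar :: "int \<Rightarrow> int \<Rightarrow> complex" where
  "addchar M t = cis (2 * pi * of_int t / of_int M)"

lemma addchar_add: "addchar M (s + t) = addchar M s * addchar M t"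
  by (simp add: addchar_def cis_mult add_divide_distrib ring_distribs)

lemma addchar_0 [simp]: "addchar M 0 = 1"
  by (simp add: addchar_def)

lemma norm_addchar [simp]: "cmod (addchar M t) = 1"
  by (simp add: addchar_def)

lemma cnj_addchar: "cnj (addchar M t) = addchar M (-t)"
  by (simp add: addchar_def cis_cnj)

lemma addchar_eq_1_iff:
  assumes "M > 0" shows "addchar M t = 1 \<longleftrightarrow> M dvd t"
proof
  assume "addchar M t = 1"
  then have "cos (2 * pi * of_int t / of_int M) = 1"
    by (simp add: addchar_def complex_eq_iff)
  then obtain n :: int where "2 * pi * of_int t / of_int M = of_int n * 2 * pi"
    by (auto simp: cos_one_2pi_int)
  then have "real_of_int t = of_int (n * M)" using assms by (simp add: field_simps)
  then show "M dvd t" by (metis dvd_triv_right of_int_eq_iff)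
next
  assume "M dvd t"
  then obtain n where "t = M * n" by blast
  then have "addchar M t = cis (2 * pi * of_int n)" using assms by (simp add: addchar_def field_simps)
  then show "addchar M t = 1" by simp
qed

lemma addchar_cong:
  assumes "M > 0" "[s = t] (mod M)" shows "addchar M s = addchar M t"
proof -
  have "addchar M (s - t) = 1" using assms by (simp add: addchar_eq_1_iff cong_iff_dvd_diff)
  then show ?thesis using addchar_add[of M "s - t" t] by simp
qed

lemma addchar_mult_nat: "addchar M (t * int n) = addchar M t ^ n"
  by (induction n) (simp_all add: addchar_add ring_distribs)

lemma addchar_orthogonality:
  assumes "M > 0"
  shows "(\<Sum>\<xi>\<in>{0..<M}. addchar M (\<xi> * t)) = (if M dvd t then of_int M else 0)"
proof -
  obtain n where n: "M = int n" "n > 0" using assms by (metis pos_int_cases)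
  have "(\<Sum>\<xi>\<in>{0..<M}. addchar M (\<xi> * t)) = (\<Sum>k<n. addchar M t ^ k)"
    by (rule sum.reindex_bij_witness[of _ int nat])
      (auto simp: n addchar_mult_nat[symmetric] mult.commute)
  also have "\<dots> = (if M dvd t then of_int M else 0)"
  proof (cases "M dvd t")
    case True
    then have "addchar M t = 1" using assms by (simp add: addchar_eq_1_iff)
    then show ?thesis using True by (simp add: n)
  next
    case False
    then have "addchar M t \<noteq> 1" using assms by (simp add: addchar_eq_1_iff)
    moreover have "addchar M t ^ n = 1"
      using assms by (simp add: addchar_mult_nat[symmetric] addchar_eq_1_iff n)
    ultimately show ?thesis using False by (simp add: sum_gp_strict)
  qed
  finally show ?thesis .
qed

lemma addchar_parseval:
  assumes "M > 0" "X \<subseteq> {0..<M}"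
  shows "(\<Sum>\<xi>\<in>{0..<M}. (cmod (\<Sum>x\<in>X. addchar M (\<xi> * x)))\<^sup>2) = real_of_int M * real (card X)"
proof -
  have fin: "finite X" using assms finite_subset by blast
  have "complex_of_real (\<Sum>\<xi>\<in>{0..<M}. (cmod (\<Sum>x\<in>X. addchar M (\<xi> * x)))\<^sup>2)
      = (\<Sum>\<xi>\<in>{0..<M}. (\<Sum>x\<in>X. addchar M (\<xi> * x)) * cnj (\<Sum>y\<in>X. addchar M (\<xi> * y)))"
    by (simp only: of_real_sum complex_norm_square)
  also have "\<dots> = (\<Sum>\<xi>\<in>{0..<M}. \<Sum>x\<in>X. \<Sum>y\<in>X. addchar M (\<xi> * (x - y)))"
    by (simp add: sum_product cnj_addchar addchar_add[symmetric] right_diff_distrib)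
  also have "\<dots> = (\<Sum>x\<in>X. \<Sum>y\<in>X. \<Sum>\<xi>\<in>{0..<M}. addchar M (\<xi> * (x - y)))"
    by (subst sum.swap, rule sum.cong[OF refl], rule sum.swap)
  also have "\<dots> = (\<Sum>x\<in>X. \<Sum>y\<in>X. if x = y then of_int M else 0)"
  proof (intro sum.cong refl)
    fix x y assume xy: "x \<in> X" "y \<in> X"
    have "M dvd x - y \<longleftrightarrow> x = y"
    proof
      assume "M dvd x - y"
      then have "x mod M = y mod M" by (simp add: mod_eq_dvd_iff)
      moreover have "x mod M = x" "y mod M = y" using xy assms(2) by auto
      ultimately show "x = y" by simp
    qed auto
    then show "(\<Sum>\<xi>\<in>{0..<M}. addchar M (\<xi> * (x - y))) = (if x = y then of_int M else 0)"
      by (simp add: addchar_orthogonality[OF assms(1)])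
  qed
  also have "\<dots> = of_int M * of_nat (card X)" using fin by simp
  finally have "complex_of_real (\<Sum>\<xi>\<in>{0..<M}. (cmod (\<Sum>x\<in>X. addchar M (\<xi> * x)))\<^sup>2) = complex_of_real (real_of_int M * real (card X))"
    by simp
  then show ?thesis by (simp only: of_real_eq_iff)
qed

text \<open>Jordan's inequality: the concave sine lies above its chord on [0, pi/2].\<close>

lemma sin_ge_chord:
  assumes "0 \<le> x" "x \<le> pi / 2" shows "2 / pi * x \<le> sin x"
proof -
  have c: "concave_on {0..pi/2} sin"
  proof -
    have "convex_on {0..pi/2} (\<lambda>x. - sin x)"
      by (rule f''_ge0_imp_convex[where f' = "\<lambda>x. - cos x" and f'' = sin])
         (auto intro!: derivative_eq_intros sin_ge_zero)
    then show ?thesis by (simp add: concave_on_def)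
  qed
  define t where "t = 2 / pi * x"
  have t: "0 \<le> t" "t \<le> 1" using assms by (auto simp: t_def field_simps)
  have "(1 - t) * sin 0 + t * sin (pi/2) \<le> sin ((1 - t) *\<^sub>R 0 + t *\<^sub>R (pi/2))"
    using c t unfolding concave_on_def
    using convex_onD[of "{0..pi/2}" "\<lambda>x. - sin x" t 0 "pi/2"] by simp
  moreover have "t * (pi / 2) = x" by (simp add: t_def)
  ultimately show ?thesis by (simp add: t_def)
qed

lemma norm_one_minus_addchar:
  assumes "M > 0" "2 * \<bar>\<xi>\<bar> \<le> M"
  shows "cmod (1 - addchar M \<xi>) \<ge> 4 * \<bar>real_of_int \<xi>\<bar> / M"
proof -
  define x where "x = pi * \<bar>real_of_int \<xi>\<bar> / M"
  have x: "0 \<le> x" "x \<le> pi / 2"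
  proof -
    have "2 * \<bar>real_of_int \<xi>\<bar> \<le> real_of_int M" using assms(2) by linarith
    then have "pi * (2 * \<bar>real_of_int \<xi>\<bar>) \<le> pi * real_of_int M" by (intro mult_left_mono) auto
    then show "x \<le> pi / 2" using assms(1) by (simp add: x_def field_simps)
    show "0 \<le> x" using assms(1) by (simp add: x_def)
  qed
  define t where "t = 2 * pi * of_int \<xi> / of_int M"
  have tx: "\<bar>t\<bar> = 2 * x" using assms(1) by (simp add: t_def x_def abs_mult)
  have "(cmod (1 - addchar M \<xi>))\<^sup>2 = (1 - cos t)\<^sup>2 + (sin t)\<^sup>2"
    by (simp add: addchar_def t_def cmod_def cis.code power2_eq_square)
  also have "\<dots> = 2 - 2 * cos t" using sin_cos_squared_add[of t] by (simp add: power2_eq_square algebra_simps)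
  also have "cos t = cos (2 * x)" using tx by (metis cos_abs_real)
  also have "cos (2 * x) = 1 - 2 * (sin x)\<^sup>2" by (rule cos_double_sin)
  finally have sq: "(cmod (1 - addchar M \<xi>))\<^sup>2 = (2 * sin x)\<^sup>2" by (simp add: power2_eq_square)
  have "sin x \<ge> 0" using x by (intro sin_ge_zero) auto
  then have "cmod (1 - addchar M \<xi>) = 2 * sin x"
    using power2_eq_imp_eq[OF sq] by simp
  also have "\<dots> \<ge> 2 * (2 / pi * x)" using sin_ge_chord[OF x] by simp
  finally show ?thesis using assms(1) by (simp add: x_def)
qed

lemma norm_addchar_interval:
  assumes "M > 0" "2 * \<bar>\<xi>\<bar> \<le> M" "\<xi> \<noteq> 0"
  shows "cmod (\<Sum>s<h. addchar M (\<xi> * int s)) \<le> M / (2 * \<bar>real_of_int \<xi>\<bar>)"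
proof -
  let ?w = "addchar M \<xi>"
  have lb: "cmod (1 - ?w) \<ge> 4 * \<bar>real_of_int \<xi>\<bar> / M" by (rule norm_one_minus_addchar[OF assms(1,2)])
  have pos: "4 * \<bar>real_of_int \<xi>\<bar> / M > 0" using assms by simp
  then have ne: "?w \<noteq> 1" using lb by force
  have "(\<Sum>s<h. addchar M (\<xi> * int s)) = (1 - ?w ^ h) / (1 - ?w)"
    using ne by (simp add: addchar_mult_nat sum_gp_strict)
  then have "cmod (\<Sum>s<h. addchar M (\<xi> * int s)) = cmod (1 - ?w ^ h) / cmod (1 - ?w)"
    by (simp add: norm_divide)
  also have "\<dots> \<le> 2 / (4 * \<bar>real_of_int \<xi>\<bar> / M)"
  proof (rule frac_le)
    show "cmod (1 - ?w ^ h) \<le> 2"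
      using norm_triangle_ineq4[of 1 "?w ^ h"] by (simp add: norm_power)
  qed (use lb pos in auto)
  also have "\<dots> = M / (2 * \<bar>real_of_int \<xi>\<bar>)" using assms by (simp add: field_simps)
  finally show ?thesis .
qed

text \<open>The primes in A multiply to a divisor of n that is at least
  \<open>2 ^ card A\<close>.\<close>

lemma card_prime_divisors_le_log:
  assumes "finite A" "\<And>b. b \<in> A \<Longrightarrow> prime (b::nat) \<and> int b dvd n" "n \<noteq> 0"
  shows "real (card A) \<le> log 2 \<bar>real_of_int n\<bar>"
proof -
  have "[nat \<bar>n\<bar> = 0] (mod (\<Prod>a\<in>A. a))"
  proof (rule cong_cong_prod_coprime_nat)
    show "\<forall>a\<in>A. [nat \<bar>n\<bar> = 0] (mod a)"
      using assms(2) by (auto simp: cong_0_iff simp flip: int_dvd_int_iff)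
    show "\<forall>a\<in>A. \<forall>b\<in>A. a \<noteq> b \<longrightarrow> coprime a b"
      using assms(2) by (simp add: primes_coprime)
  qed
  then have "\<Prod>A dvd nat \<bar>n\<bar>" by (simp add: cong_0_iff)
  then have "\<Prod>A \<le> nat \<bar>n\<bar>" using assms(3) by (intro dvd_imp_le) auto
  moreover have "(\<Prod>b\<in>A. 2) \<le> \<Prod>A"
    using assms(2) by (intro prod_mono) (auto simp: prime_ge_2_nat)
  moreover have "(\<Prod>b\<in>A. 2) = (2::nat) ^ card A" by simp
  ultimately have "2 ^ card A \<le> nat \<bar>n\<bar>" by linarith
  then have "(2::real) ^ card A \<le> \<bar>real_of_int n\<bar>"
    by (metis of_int_abs of_nat_le_iff of_nat_numeral of_nat_power of_nat_nat abs_ge_zero)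
  then have "log 2 (2 ^ card A) \<le> log 2 \<bar>real_of_int n\<bar>" by (intro log_mono) auto
  then show ?thesis by simp
qed

lemma sum_inverse_squares_symmetric:
  "(\<Sum>l\<in>{-int B..int B}. if l = 0 then 1 else 1 / (real_of_int l)\<^sup>2) \<le> 5"
proof -
  define c where "c l = (if l = 0 then 1 else 1 / (real_of_int l)\<^sup>2)" for l :: int
  \<comment> \<open>The subtracted term lets the induction telescope: 2 / (B + 1)^2 is at most 4 /
    (B + 1) - 4 / (B + 2).\<close>
  have "(\<Sum>l\<in>{-int B..int B}. c l) \<le> 5 - 4 / (real B + 1)"
  proof (induction B)
    case 0
    then show ?case by (simp add: c_def)
  next
    case (Suc B)
    have "{-int (Suc B)..int (Suc B)} = insert (int (Suc B)) (insert (- int (Suc B)) {-int B..int B})" by auto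
    then have "(\<Sum>l\<in>{-int (Suc B)..int (Suc B)}. c l) = 2 / (real B + 1)\<^sup>2 + (\<Sum>l\<in>{-int B..int B}. c l)"
      by (simp add: c_def power2_eq_square algebra_simps)
    also have "2 / (real B + 1)\<^sup>2 \<le> 2 * (2 / (real B + 1) - 2 / (real B + 2))"
    proof -
      have "2 * (2 / (real B + 1) - 2 / (real B + 2)) = 4 / ((real B + 1) * (real B + 2))"
        by (simp add: divide_simps)
      moreover have "2 / (real B + 1)\<^sup>2 = 4 / ((real B + 1) * (2 * real B + 2))"
        by (simp add: divide_simps power2_eq_square)
      moreover have "4 / ((real B + 1) * (2 * real B + 2)) \<le> 4 / ((real B + 1) * (real B + 2))"
        by (intro divide_left_mono mult_left_mono) auto
      ultimately show ?thesis by simp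
    qed
    finally show ?case using Suc by (simp add: add.commute)
  qed
  also have "\<dots> \<le> 5" by simp
  finally show ?thesis by (simp add: c_def)
qed

lemma one_le_Suc_mult_pos: "(M::int) > 0 \<Longrightarrow> 1 \<le> (real B + 1) * M"
  using mult_mono[of 1 "real B + 1" 1 "real_of_int M"] by simp

lemma symmetric_representative:
  assumes "(M::int) > 0" "\<not> M dvd x"
  obtains x' where "[x' = x] (mod M)" "x' \<noteq> 0" "2 * \<bar>x'\<bar> \<le> M"
proof -
  define r where "r = x mod M"
  have r: "0 \<le> r" "r < M" "r \<noteq> 0" using assms by (auto simp: r_def dvd_eq_mod_eq_0)
  show ?thesis
  proof (cases "2 * r \<le> M")
    case True
    then show ?thesis using r by (intro that[of r]) (auto simp: r_def)
  next
    case False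
    have "[r - M = x] (mod M)" by (simp add: r_def cong_def)
    then show ?thesis using r False by (intro that[of "r - M"]) auto
  qed
qed

text \<open>Each integer \<open>\<nu> + l M\<close> has few prime divisors, so few primes \<open>b\<close> admit a small solution of \<open>b \<xi> \<equiv> \<nu>\<close>.\<close>

lemma dilated_kernel_sum_bound:
  fixes M \<nu> :: int and BB :: "nat set" and B h :: nat
  assumes M: "M > 0" and BB: "finite BB" "\<And>b. b \<in> BB \<Longrightarrow> prime b \<and> b \<le> B" and B: "0 < B" "B \<le> h"
    and \<nu>: "\<not> M dvd \<nu>" and \<xi>: "\<And>b. b \<in> BB \<Longrightarrow> [int b * \<xi> b = \<nu>] (mod M)"
  shows "(\<Sum>b\<in>BB. (cmod (\<Sum>s<h. addchar M (\<xi> b * int s)))\<^sup>2) \<le> (real h)\<^sup>2 * (5 * log 2 ((real B + 1) * M))"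
proof -
  obtain \<nu>' where \<nu>': "[\<nu>' = \<nu>] (mod M)" "\<nu>' \<noteq> 0" "2 * \<bar>\<nu>'\<bar> \<le> M"
    using symmetric_representative[OF M \<nu>] .
  have "\<exists>x. [x = \<xi> b] (mod M) \<and> x \<noteq> 0 \<and> 2 * \<bar>x\<bar> \<le> M" if "b \<in> BB" for b
  proof -
    have "\<not> M dvd \<xi> b"
    proof
      assume "M dvd \<xi> b"
      then have "M dvd int b * \<xi> b" by simp
      then show False using cong_dvd_iff[OF \<xi>[OF that]] \<nu> by blast
    qed
    then show ?thesis using symmetric_representative[OF M] by metis
  qed
  then obtain x where x: "\<And>b. b \<in> BB \<Longrightarrow> [x b = \<xi> b] (mod M) \<and> x b \<noteq> 0 \<and> 2 * \<bar>x b\<bar> \<le> M" by metis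
  \<comment> \<open>With symmetric representatives l is confined to absolute value at most B, and a
    large l forces a large \<open>x b\<close>, hence a small kernel.\<close>
  have "\<exists>l. int b * x b = \<nu>' + l * M" if "b \<in> BB" for b
  proof -
    have "[int b * x b = int b * \<xi> b] (mod M)" using x[OF that] by (intro cong_mult) auto
    then have "[int b * x b = \<nu>'] (mod M)" using \<xi>[OF that] \<nu>'(1) by (meson cong_sym cong_trans)
    then obtain k where "int b * x b - \<nu>' = M * k" by (auto simp: cong_iff_dvd_diff)
    then show ?thesis by (intro exI[of _ k]) (simp add: algebra_simps)
  qed
  then obtain l where l: "\<And>b. b \<in> BB \<Longrightarrow> int b * x b = \<nu>' + l b * M" by metis
  define c where "c l = (if l = 0 then 1 else 1 / (real_of_int l)\<^sup>2)" for l :: int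
  have lb: "l b \<in> {- int B..int B}" if "b \<in> BB" for b
  proof -
    have "\<bar>l b\<bar> * M = \<bar>int b * x b - \<nu>'\<bar>" using l[OF that] M by (simp add: abs_mult)
    also have "\<dots> \<le> int b * \<bar>x b\<bar> + \<bar>\<nu>'\<bar>" using abs_triangle_ineq4[of "int b * x b" \<nu>'] by (simp add: abs_mult)
    finally have "2 * (\<bar>l b\<bar> * M) \<le> int b * (2 * \<bar>x b\<bar>) + 2 * \<bar>\<nu>'\<bar>" by simp
    also have "int b * (2 * \<bar>x b\<bar>) \<le> int B * M" using BB(2)[OF that] x[OF that] by (intro mult_mono) auto
    also have "2 * \<bar>\<nu>'\<bar> \<le> M" by (rule \<nu>')
    finally have "(2 * \<bar>l b\<bar>) * M \<le> (int B + 1) * M" by (simp add: algebra_simps)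
    then have "2 * \<bar>l b\<bar> \<le> int B + 1" using M by simp
    then show ?thesis using B by auto
  qed
  have kb: "(cmod (\<Sum>s<h. addchar M (\<xi> b * int s)))\<^sup>2 \<le> (real h)\<^sup>2 * c (l b)" if b: "b \<in> BB" for b
  proof -
    have eq: "(\<Sum>s<h. addchar M (\<xi> b * int s)) = (\<Sum>s<h. addchar M (x b * int s))"
      using x[OF b] by (intro sum.cong refl addchar_cong[OF M] cong_mult) (auto simp: cong_sym)
    show ?thesis
    proof (cases "l b = 0")
      case True
      have "cmod (\<Sum>s<h. addchar M (x b * int s)) \<le> real h"
        by (rule order_trans[OF norm_sum]) simp
      then show ?thesis using True by (simp add: eq c_def power_mono)
    next
      case False
      have "\<bar>real_of_int (l b)\<bar> \<ge> 1" using False by linarith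
      have "\<bar>l b\<bar> * M - \<bar>\<nu>'\<bar> \<le> \<bar>int b * x b\<bar>"
        using l[OF b] M abs_triangle_ineq2[of "l b * M" "- \<nu>'"] by (simp add: abs_mult add.commute)
      moreover have "M \<le> \<bar>l b\<bar> * M" using False M by simp
      ultimately have "\<bar>l b\<bar> * M \<le> 2 * (int b * \<bar>x b\<bar>)" using \<nu>'(3) by (simp add: abs_mult)
      also have "\<dots> \<le> 2 * (int B * \<bar>x b\<bar>)" using BB(2)[OF b] by (intro mult_left_mono mult_right_mono) auto
      finally have "\<bar>l b\<bar> * M \<le> 2 * int B * \<bar>x b\<bar>" by simp
      then have "real_of_int (\<bar>l b\<bar> * M) \<le> real_of_int (2 * int B * \<bar>x b\<bar>)" by (simp only: of_int_le_iff)
      then have ineq: "\<bar>real_of_int (l b)\<bar> * M \<le> 2 * real B * \<bar>real_of_int (x b)\<bar>" by simp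
      have "cmod (\<Sum>s<h. addchar M (x b * int s)) \<le> M / (2 * \<bar>real_of_int (x b)\<bar>)"
        using x[OF b] by (intro norm_addchar_interval[OF M]) auto
      also have "\<dots> \<le> real B / \<bar>real_of_int (l b)\<bar>"
        using ineq x[OF b] False by (simp add: field_simps)
      also have "\<dots> \<le> real h / \<bar>real_of_int (l b)\<bar>" using B by (intro divide_right_mono) auto
      finally have "(cmod (\<Sum>s<h. addchar M (x b * int s)))\<^sup>2 \<le> (real h / \<bar>real_of_int (l b)\<bar>)\<^sup>2"
        by (intro power_mono) auto
      then show ?thesis using False by (simp add: eq c_def power_divide)
    qed
  qed
  \<comment> \<open>All b with \<open>l b = k\<close> are prime divisors of the single nonzero
    integer \<open>\<nu>' + k * M\<close>.\<close>
  have cnt: "real (card {b\<in>BB. l b = k}) \<le> log 2 ((real B + 1) * M)" if k: "k \<in> {- int B..int B}" for k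
  proof (cases "{b\<in>BB. l b = k} = {}")
    case True
    have "1 \<le> (real B + 1) * M" by (rule one_le_Suc_mult_pos[OF M])
    then have "0 \<le> log 2 ((real B + 1) * M)" by simp
    then show ?thesis using True by (simp only: card.empty)
  next
    case False
    then obtain b where b: "b \<in> BB" "l b = k" by blast
    have nz: "\<nu>' + k * M \<noteq> 0" using l[OF b(1)] b x[OF b(1)] BB(2)[OF b(1)] by (metis mult_eq_0_iff of_nat_0_eq_iff not_prime_0)
    have "real (card {b\<in>BB. l b = k}) \<le> log 2 \<bar>real_of_int (\<nu>' + k * M)\<bar>"
    proof (rule card_prime_divisors_le_log[OF _ _ nz])
      show "finite {b\<in>BB. l b = k}" using BB by simp
      show "prime c \<and> int c dvd \<nu>' + k * M" if "c \<in> {b\<in>BB. l b = k}" for c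
        using that BB l[of c] by (metis (mono_tags, lifting) dvd_triv_left mem_Collect_eq)
    qed
    also have "\<dots> \<le> log 2 ((real B + 1) * M)"
    proof (rule log_mono)
      have "\<bar>\<nu>' + k * M\<bar> \<le> M + int B * M"
      proof -
        have "\<bar>k\<bar> * M \<le> int B * M" using k M by (intro mult_right_mono) auto
        moreover have "\<bar>\<nu>' + k * M\<bar> \<le> \<bar>\<nu>'\<bar> + \<bar>k\<bar> * M"
          using abs_triangle_ineq[of \<nu>' "k * M"] M by (simp add: abs_mult)
        ultimately show ?thesis using \<nu>'(3) by linarith
      qed
      then have "\<bar>\<nu>' + k * M\<bar> \<le> (int B + 1) * M" by (simp add: algebra_simps)
      then have "real_of_int \<bar>\<nu>' + k * M\<bar> \<le> real_of_int ((int B + 1) * M)" by (simp only: of_int_le_iff)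
      then show "\<bar>real_of_int (\<nu>' + k * M)\<bar> \<le> (real B + 1) * M" by simp
      show "0 < \<bar>real_of_int (\<nu>' + k * M)\<bar>" using nz by linarith
    qed auto
    finally show ?thesis .
  qed
  have "(\<Sum>b\<in>BB. (cmod (\<Sum>s<h. addchar M (\<xi> b * int s)))\<^sup>2) \<le> (\<Sum>b\<in>BB. (real h)\<^sup>2 * c (l b))"
    by (intro sum_mono kb)
  also have "\<dots> = (real h)\<^sup>2 * (\<Sum>b\<in>BB. c (l b))" by (simp add: sum_distrib_left)
  finally have le: "(\<Sum>b\<in>BB. (cmod (\<Sum>s<h. addchar M (\<xi> b * int s)))\<^sup>2) \<le> (real h)\<^sup>2 * (\<Sum>b\<in>BB. c (l b))" .
  have "(\<Sum>b\<in>BB. c (l b)) = (\<Sum>k\<in>{- int B..int B}. \<Sum>b\<in>{b\<in>BB. l b = k}. c (l b))"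
    using BB lb by (intro sum.group[symmetric]) auto
  also have "\<dots> = (\<Sum>k\<in>{- int B..int B}. real (card {b\<in>BB. l b = k}) * c k)"
    by (intro sum.cong refl) simp
  also have "\<dots> \<le> (\<Sum>k\<in>{- int B..int B}. log 2 ((real B + 1) * M) * c k)"
    using cnt by (intro sum_mono mult_right_mono) (auto simp: c_def)
  also have "\<dots> = log 2 ((real B + 1) * M) * (\<Sum>k\<in>{- int B..int B}. c k)" by (simp add: sum_distrib_left)
  also have "\<dots> \<le> log 2 ((real B + 1) * M) * 5"
  proof (rule mult_left_mono)
    show "(\<Sum>k\<in>{- int B..int B}. c k) \<le> 5" unfolding c_def by (rule sum_inverse_squares_symmetric)
    have "1 \<le> (real B + 1) * M" by (rule one_le_Suc_mult_pos[OF M])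
    then show "0 \<le> log 2 ((real B + 1) * M)" by simp
  qed
  finally have "(\<Sum>b\<in>BB. c (l b)) \<le> 5 * log 2 ((real B + 1) * M)" by simp
  from order_trans[OF le mult_left_mono[OF this]] show ?thesis by simp
qed

text \<open>A large sieve inequality for the dilates \<open>y \<mapsto> b y\<close>: the points of \<open>E\<close> force, through every prime \<open>b\<close>,
  a whole interval of points of \<open>D\<close>, and for different primes these are nearly independent.\<close>

lemma large_sieve_dilates:
  fixes M :: int and BB :: "nat set" and B h :: nat and D E :: "int set"
  assumes M: "M > 0" and BB: "finite BB" "\<And>b. b \<in> BB \<Longrightarrow> prime b \<and> b \<le> B \<and> coprime (int b) M"
    and B: "0 < B" "B \<le> h" and DE: "D \<subseteq> {0..<M}" "E \<subseteq> {0..<M}"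
    and hit: "\<And>z b s y. z \<in> E \<Longrightarrow> b \<in> BB \<Longrightarrow> s < h \<Longrightarrow> y \<in> {0..<M} \<Longrightarrow> [int b * y = z + int s] (mod M) \<Longrightarrow> y \<in> D"
  shows "real (card E) * card BB * (real_of_int M - card D)\<^sup>2 \<le> 5 * log 2 ((real B + 1) * M) * M\<^sup>2 * card D"
proof -
  define \<kappa> where "\<kappa> = 5 * log 2 ((real B + 1) * M)"
  define n where "n = real (card BB)"
  define e where "e = addchar M"
  define D' where "D' = {0..<M} - D"
  have fin: "finite D" "finite E" "finite D'" using DE finite_subset by (auto simp: D'_def)
  define k where "k \<xi> = (\<Sum>s<h. e (\<xi> * int s))" for \<xi>
  define g where "g \<xi> = (\<Sum>z\<in>E. e (\<xi> * z))" for \<xi>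
  define f where "f \<nu> = (\<Sum>y\<in>D'. e (\<nu> * y))" for \<nu>
  have k0: "0 \<le> \<kappa>"
  proof -
    have "1 \<le> (real B + 1) * M" by (rule one_le_Suc_mult_pos[OF M])
    then show ?thesis by (simp add: \<kappa>_def)
  qed
  have cD': "real (card D') = real_of_int M - card D"
  proof -
    have "card D \<le> card {0..<M}" using DE by (intro card_mono) auto
    then have "card D' + card D = card {0..<M}" using DE fin unfolding D'_def by (simp only: card_Diff_subset)
    then show ?thesis using M by simp
  qed
  have nohit: "\<not> M dvd z + int s - int b * y" if "z \<in> E" "s < h" "b \<in> BB" "y \<in> D'" for z s b y
    using hit[of z b s y] that by (auto simp: D'_def cong_iff_dvd_diff dvd_diff_commute)
  \<comment> \<open>Summed over \<xi>, the right side is M times the number of solutions of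
    \<open>z + s = b * y\<close> modulo M with z in E and y outside D; \<open>hit\<close> says that
    there are none.\<close>
  have expand: "g \<xi> * k \<xi> * (\<Sum>b\<in>BB. f (- \<xi> * int b)) =
     (\<Sum>z\<in>E. \<Sum>s<h. \<Sum>b\<in>BB. \<Sum>y\<in>D'. e (\<xi> * (z + int s - int b * y)))" for \<xi>
  proof -
    have "e (\<xi> * (z + int s - int b * y)) = e (\<xi> * z) * (e (\<xi> * int s) * e (- \<xi> * int b * y))" for z s b y
      by (simp add: e_def addchar_add[symmetric] algebra_simps)
    then have "(\<Sum>z\<in>E. \<Sum>s<h. \<Sum>b\<in>BB. \<Sum>y\<in>D'. e (\<xi> * (z + int s - int b * y))) =
        (\<Sum>z\<in>E. e (\<xi> * z) * (\<Sum>s<h. e (\<xi> * int s) * (\<Sum>b\<in>BB. f (- \<xi> * int b))))"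
      by (simp only: sum_distrib_left f_def)
    also have "\<dots> = g \<xi> * k \<xi> * (\<Sum>b\<in>BB. f (- \<xi> * int b))"
      by (simp only: g_def k_def sum_distrib_right[symmetric] mult.assoc)
    finally show ?thesis ..
  qed
  have "(\<Sum>\<xi>\<in>{0..<M}. g \<xi> * k \<xi> * (\<Sum>b\<in>BB. f (- \<xi> * int b))) =
     (\<Sum>\<xi>\<in>{0..<M}. \<Sum>z\<in>E. \<Sum>s<h. \<Sum>b\<in>BB. \<Sum>y\<in>D'. e (\<xi> * (z + int s - int b * y)))"
    by (simp only: expand)
  also have "\<dots> = (\<Sum>z\<in>E. \<Sum>\<xi>\<in>{0..<M}. \<Sum>s<h. \<Sum>b\<in>BB. \<Sum>y\<in>D'. e (\<xi> * (z + int s - int b * y)))"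
    by (rule sum.swap)
  also have "\<dots> = (\<Sum>z\<in>E. \<Sum>s<h. \<Sum>\<xi>\<in>{0..<M}. \<Sum>b\<in>BB. \<Sum>y\<in>D'. e (\<xi> * (z + int s - int b * y)))"
    by (rule sum.cong[OF refl], rule sum.swap)
  also have "\<dots> = (\<Sum>z\<in>E. \<Sum>s<h. \<Sum>b\<in>BB. \<Sum>\<xi>\<in>{0..<M}. \<Sum>y\<in>D'. e (\<xi> * (z + int s - int b * y)))"
    by (rule sum.cong[OF refl], rule sum.cong[OF refl], rule sum.swap)
  also have "\<dots> = (\<Sum>z\<in>E. \<Sum>s<h. \<Sum>b\<in>BB. \<Sum>y\<in>D'. \<Sum>\<xi>\<in>{0..<M}. e (\<xi> * (z + int s - int b * y)))"
    by (rule sum.cong[OF refl], rule sum.cong[OF refl], rule sum.cong[OF refl], rule sum.swap)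
  also have "\<dots> = 0"
    using nohit unfolding e_def addchar_orthogonality[OF M] by simp
  finally have zero: "(\<Sum>\<xi>\<in>{0..<M}. g \<xi> * k \<xi> * (\<Sum>b\<in>BB. f (- \<xi> * int b))) = 0" .
  \<comment> \<open>Frequency 0 carries the main term \<open>card E * h * (n * card D')\<close>. As
    the total vanishes, the other frequencies must cancel it, and Cauchy-Schwarz limits how far they
    can.\<close>
  have split: "{0..<M} = insert 0 {1..<M}" using M by auto
  have "g 0 * k 0 * (\<Sum>b\<in>BB. f (- 0 * int b)) + (\<Sum>\<xi>\<in>{1..<M}. g \<xi> * k \<xi> * (\<Sum>b\<in>BB. f (- \<xi> * int b))) = 0"
    using zero unfolding split by (subst (asm) sum.insert) auto
  moreover have "g 0 * k 0 * (\<Sum>b\<in>BB. f (- 0 * int b)) = of_real (card E * h * (n * card D'))"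
    by (simp add: g_def k_def f_def e_def n_def)
  ultimately have "complex_of_real (card E * h * (n * card D')) = - (\<Sum>\<xi>\<in>{1..<M}. g \<xi> * k \<xi> * (\<Sum>b\<in>BB. f (- \<xi> * int b)))"
    by (simp only: eq_neg_iff_add_eq_0)
  then have "cmod (complex_of_real (card E * h * (n * card D'))) = cmod (\<Sum>\<xi>\<in>{1..<M}. g \<xi> * (k \<xi> * (\<Sum>b\<in>BB. f (- \<xi> * int b))))"
    by (simp only: norm_minus_cancel mult.assoc)
  then have "card E * h * (n * card D') = cmod (\<Sum>\<xi>\<in>{1..<M}. g \<xi> * (k \<xi> * (\<Sum>b\<in>BB. f (- \<xi> * int b))))"
    unfolding norm_of_real by (simp add: n_def)
  also have "\<dots> \<le> (\<Sum>\<xi>\<in>{1..<M}. cmod (g \<xi>) * cmod (k \<xi> * (\<Sum>b\<in>BB. f (- \<xi> * int b))))"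
    by (rule order_trans[OF norm_sum]) (simp add: norm_mult)
  finally have "(card E * h * (n * card D'))\<^sup>2 \<le> (\<Sum>\<xi>\<in>{1..<M}. cmod (g \<xi>) * cmod (k \<xi> * (\<Sum>b\<in>BB. f (- \<xi> * int b))))\<^sup>2"
    by (intro power_mono) (auto simp: n_def)
  also have "\<dots> \<le> (\<Sum>\<xi>\<in>{1..<M}. (cmod (g \<xi>))\<^sup>2) * (\<Sum>\<xi>\<in>{1..<M}. (cmod (k \<xi> * (\<Sum>b\<in>BB. f (- \<xi> * int b))))\<^sup>2)"
    by (rule Cauchy_Schwarz_ineq_sum)
  also have "\<dots> \<le> (real_of_int M * real (card E)) * (n * ((real h)\<^sup>2 * \<kappa>) * (real_of_int M * real (card D)))"
  proof (rule mult_mono)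
    have "(\<Sum>\<xi>\<in>{1..<M}. (cmod (g \<xi>))\<^sup>2) \<le> (\<Sum>\<xi>\<in>{0..<M}. (cmod (g \<xi>))\<^sup>2)"
      by (intro sum_mono2) auto
    also have "\<dots> = real_of_int M * real (card E)" unfolding g_def e_def by (rule addchar_parseval[OF M DE(2)])
    finally show "(\<Sum>\<xi>\<in>{1..<M}. (cmod (g \<xi>))\<^sup>2) \<le> real_of_int M * real (card E)" .
  next
    have "(\<Sum>\<xi>\<in>{1..<M}. (cmod (k \<xi> * (\<Sum>b\<in>BB. f (- \<xi> * int b))))\<^sup>2)
      \<le> (\<Sum>\<xi>\<in>{1..<M}. (cmod (k \<xi>))\<^sup>2 * (n * (\<Sum>b\<in>BB. (cmod (f (- \<xi> * int b)))\<^sup>2)))"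
    proof (intro sum_mono)
      fix \<xi>
      have "cmod (\<Sum>b\<in>BB. f (- \<xi> * int b)) \<le> (\<Sum>b\<in>BB. 1 * cmod (f (- \<xi> * int b)))"
        by (simp add: norm_sum)
      then have "(cmod (\<Sum>b\<in>BB. f (- \<xi> * int b)))\<^sup>2 \<le> (\<Sum>b\<in>BB. 1 * cmod (f (- \<xi> * int b)))\<^sup>2"
        by (intro power_mono) auto
      also have "\<dots> \<le> (\<Sum>b\<in>BB. 1\<^sup>2) * (\<Sum>b\<in>BB. (cmod (f (- \<xi> * int b)))\<^sup>2)"
        by (rule Cauchy_Schwarz_ineq_sum)
      finally have "(cmod (\<Sum>b\<in>BB. f (- \<xi> * int b)))\<^sup>2 \<le> n * (\<Sum>b\<in>BB. (cmod (f (- \<xi> * int b)))\<^sup>2)"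
        by (simp add: n_def)
      then show "(cmod (k \<xi> * (\<Sum>b\<in>BB. f (- \<xi> * int b))))\<^sup>2 \<le> (cmod (k \<xi>))\<^sup>2 * (n * (\<Sum>b\<in>BB. (cmod (f (- \<xi> * int b)))\<^sup>2))"
        by (simp add: norm_mult power_mult_distrib mult_left_mono)
    qed
    also have "\<dots> = n * (\<Sum>b\<in>BB. \<Sum>\<xi>\<in>{1..<M}. (cmod (k \<xi>))\<^sup>2 * (cmod (f (- \<xi> * int b)))\<^sup>2)"
      by (subst sum.swap) (simp add: sum_distrib_left algebra_simps)
    \<comment> \<open>The substitution \<open>\<nu> = b * \<xi>\<close> frees f of b: the dilations
      now sit in the kernels, which \<open>dilated_kernel_sum_bound\<close> sums over b for each
      fixed \<nu>.\<close>
    also have "(\<Sum>b\<in>BB. \<Sum>\<xi>\<in>{1..<M}. (cmod (k \<xi>))\<^sup>2 * (cmod (f (- \<xi> * int b)))\<^sup>2)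
      = (\<Sum>b\<in>BB. \<Sum>\<nu>\<in>{1..<M}. (cmod (k (inv_into {1..<M} (\<lambda>\<xi>. int b * \<xi> mod M) \<nu>)))\<^sup>2 * (cmod (f (- \<nu>)))\<^sup>2)"
    proof (rule sum.cong[OF refl])
      fix b assume b: "b \<in> BB"
      let ?m = "\<lambda>\<xi>. int b * \<xi> mod M"
      have inj: "inj_on ?m {1..<M}"
      proof (rule inj_onI)
        fix x y assume xy: "x \<in> {1..<M}" "y \<in> {1..<M}" "?m x = ?m y"
        then have "[int b * x = int b * y] (mod M)" by (simp add: cong_def)
        then have "[x = y] (mod M)" using BB(2)[OF b] by (simp add: cong_mult_lcancel)
        then show "x = y" using xy by (simp add: cong_def)
      qed
      have sub: "?m ` {1..<M} \<subseteq> {1..<M}"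
      proof
        fix w assume "w \<in> ?m ` {1..<M}"
        then obtain x where x: "x \<in> {1..<M}" "w = ?m x" by blast
        have "w \<noteq> 0"
        proof
          assume "w = 0"
          then have "M dvd int b * x" using x by (simp add: dvd_eq_mod_eq_0)
          then have "M dvd x" using BB(2)[OF b] by (simp add: coprime_dvd_mult_right_iff coprime_commute)
          then show False using x zdvd_imp_le by fastforce
        qed
        moreover have "0 \<le> w" "w < M" using x M by auto
        ultimately show "w \<in> {1..<M}" by simp
      qed
      have bij: "bij_betw ?m {1..<M} {1..<M}"
        using inj sub by (simp add: bij_betw_def endo_inj_surj)
      have "(\<Sum>\<xi>\<in>{1..<M}. (cmod (k \<xi>))\<^sup>2 * (cmod (f (- \<xi> * int b)))\<^sup>2)
         = (\<Sum>\<xi>\<in>{1..<M}. (cmod (k (inv_into {1..<M} ?m (?m \<xi>))))\<^sup>2 * (cmod (f (- ?m \<xi>)))\<^sup>2)"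
      proof (intro sum.cong refl)
        fix \<xi> assume \<xi>: "\<xi> \<in> {1..<M}"
        have "f (- \<xi> * int b) = f (- ?m \<xi>)"
          unfolding f_def e_def
        proof (intro sum.cong refl addchar_cong[OF M] cong_mult cong_refl)
          show "[- \<xi> * int b = - ?m \<xi>] (mod M)"
            by (simp add: cong_def mod_minus_eq mult.commute)
        qed
        then show "(cmod (k \<xi>))\<^sup>2 * (cmod (f (- \<xi> * int b)))\<^sup>2 = (cmod (k (inv_into {1..<M} ?m (?m \<xi>))))\<^sup>2 * (cmod (f (- ?m \<xi>)))\<^sup>2"
          by (simp only: inv_into_f_f[OF inj \<xi>])
      qed
      also have "\<dots> = (\<Sum>\<nu>\<in>{1..<M}. (cmod (k (inv_into {1..<M} ?m \<nu>)))\<^sup>2 * (cmod (f (- \<nu>)))\<^sup>2)"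
        by (rule sum.reindex_bij_betw[OF bij])
      finally show "(\<Sum>\<xi>\<in>{1..<M}. (cmod (k \<xi>))\<^sup>2 * (cmod (f (- \<xi> * int b)))\<^sup>2)
         = (\<Sum>\<nu>\<in>{1..<M}. (cmod (k (inv_into {1..<M} ?m \<nu>)))\<^sup>2 * (cmod (f (- \<nu>)))\<^sup>2)" .
    qed
    also have "\<dots> = (\<Sum>\<nu>\<in>{1..<M}. (\<Sum>b\<in>BB. (cmod (k (inv_into {1..<M} (\<lambda>\<xi>. int b * \<xi> mod M) \<nu>)))\<^sup>2) * (cmod (f (- \<nu>)))\<^sup>2)"
      by (subst sum.swap) (simp add: sum_distrib_right)
    also have "\<dots> \<le> (\<Sum>\<nu>\<in>{1..<M}. ((real h)\<^sup>2 * \<kappa>) * (cmod (f (- \<nu>)))\<^sup>2)"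
    proof (intro sum_mono mult_right_mono)
      fix \<nu> assume \<nu>: "\<nu> \<in> {1..<M}"
      show "(\<Sum>b\<in>BB. (cmod (k (inv_into {1..<M} (\<lambda>\<xi>. int b * \<xi> mod M) \<nu>)))\<^sup>2) \<le> (real h)\<^sup>2 * \<kappa>"
        unfolding k_def e_def \<kappa>_def
      proof (rule dilated_kernel_sum_bound[OF M BB(1)])
        show "\<not> M dvd \<nu>" using \<nu> zdvd_imp_le by fastforce
        fix b assume b: "b \<in> BB"
        show "prime b \<and> b \<le> B" using BB(2)[OF b] by simp
        let ?m = "\<lambda>\<xi>. int b * \<xi> mod M"
        obtain y where y: "[int b * y = \<nu>] (mod M)"
          using BB(2)[OF b] cong_solve_coprime_int[of "int b" M] by (metis cong_scalar_right mult.assoc mult_1)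
        define x where "x = y mod M"
        have mx: "?m x = \<nu>" using y \<nu> by (simp add: x_def cong_def mod_mult_right_eq)
        have "x \<noteq> 0" using mx \<nu> by auto
        moreover have "0 \<le> x" "x < M" using M by (simp_all add: x_def)
        ultimately have "x \<in> {1..<M}" by simp
        then have "\<nu> \<in> ?m ` {1..<M}" using mx by (intro image_eqI[of _ _ x]) auto
        then have "?m (inv_into {1..<M} ?m \<nu>) = \<nu>" by (rule f_inv_into_f)
        then show "[int b * inv_into {1..<M} ?m \<nu> = \<nu>] (mod M)" using \<nu> by (simp add: cong_def)
      qed (use B in auto)
    qed auto
    also have "\<dots> = ((real h)\<^sup>2 * \<kappa>) * (\<Sum>\<nu>\<in>{1..<M}. (cmod (f (- \<nu>)))\<^sup>2)" by (simp add: sum_distrib_left)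
    \<comment> \<open>At nonzero frequencies D and its complement have sums of equal modulus, so
      \<open>card D\<close> enters the bound instead of \<open>card D'\<close>.\<close>
    also have "(\<Sum>\<nu>\<in>{1..<M}. (cmod (f (- \<nu>)))\<^sup>2) = (\<Sum>\<nu>\<in>{1..<M}. (cmod (\<Sum>y\<in>D. e (\<nu> * y)))\<^sup>2)"
    proof (intro sum.cong refl)
      fix \<nu> assume \<nu>: "\<nu> \<in> {1..<M}"
      have nd: "\<not> M dvd \<nu>" using \<nu> zdvd_imp_le by fastforce
      have "cmod (f (- \<nu>)) = cmod (cnj (f (- \<nu>)))" by simp
      also have "cnj (f (- \<nu>)) = (\<Sum>y\<in>D'. e (\<nu> * y))" by (simp add: f_def e_def cnj_addchar)
      also have "\<dots> = (\<Sum>y\<in>{0..<M}. e (\<nu> * y)) - (\<Sum>y\<in>D. e (\<nu> * y))"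
        unfolding D'_def using DE by (subst sum_diff) auto
      also have "(\<Sum>y\<in>{0..<M}. e (\<nu> * y)) = 0"
        using addchar_orthogonality[OF M, of \<nu>] nd by (simp add: e_def mult.commute)
      finally show "(cmod (f (- \<nu>)))\<^sup>2 = (cmod (\<Sum>y\<in>D. e (\<nu> * y)))\<^sup>2" by (simp add: norm_minus_cancel)
    qed
    also have "\<dots> \<le> (\<Sum>\<nu>\<in>{0..<M}. (cmod (\<Sum>y\<in>D. e (\<nu> * y)))\<^sup>2)" by (intro sum_mono2) auto
    also have "\<dots> = real_of_int M * real (card D)" unfolding e_def by (rule addchar_parseval[OF M DE(1)])
    finally show "(\<Sum>\<xi>\<in>{1..<M}. (cmod (k \<xi> * (\<Sum>b\<in>BB. f (- \<xi> * int b))))\<^sup>2) \<le> n * ((real h)\<^sup>2 * \<kappa>) * (real_of_int M * real (card D))"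
      using k0 by (simp add: n_def mult_left_mono mult.assoc)
  qed (use M in \<open>auto intro!: sum_nonneg mult_nonneg_nonneg\<close>)
  finally have main: "(card E * h * (n * card D'))\<^sup>2 \<le> (real_of_int M * real (card E)) * (n * ((real h)\<^sup>2 * \<kappa>) * (real_of_int M * real (card D)))" .
  show ?thesis
  proof (cases "card E = 0 \<or> card BB = 0")
    case True
    then show ?thesis using k0 by (auto simp: \<kappa>_def[symmetric])
  next
    case False
    define w where "w = real (card E) * (real h)\<^sup>2 * n"
    have w: "w > 0" using False B by (simp add: w_def n_def)
    have "w * (real (card E) * n * (real (card D'))\<^sup>2) \<le> w * (\<kappa> * M\<^sup>2 * card D)"
      using main by (simp add: w_def power2_eq_square algebra_simps)
    then have "real (card E) * n * (real (card D'))\<^sup>2 \<le> \<kappa> * M\<^sup>2 * card D" using w by simp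
    then show ?thesis by (simp add: cD' n_def \<kappa>_def)
  qed
qed

section \<open>Prime number estimates\<close>

lemma finite_primes_atMost: "finite {p::nat. prime p \<and> p \<le> n}"
  by (rule finite_subset[of _ "{..n}"]) auto

text \<open>Legendre's formula in terms of the von Mangoldt function. The range N may exceed n, so
  that ln (2n)! and ln n! can be written over one range of d.\<close>

lemma ln_fact_eq_sum_mangoldt:
  assumes "n \<le> N"
  shows "ln (fact n) = (\<Sum>d\<in>{1..N}. (mangoldt d :: real) * real (n div d))"
proof -
  have "ln (fact n :: real) = (\<Sum>m\<in>{1..n}. ln (real m))"
    by (simp add: fact_prod) (subst ln_prod; auto)
  also have "\<dots> = (\<Sum>m\<in>{1..n}. \<Sum>d\<in>{1..N}. if d dvd m then mangoldt d else 0)"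
  proof (intro sum.cong refl)
    fix m assume m: "m \<in> {1..n}"
    then have "ln (real m) = (\<Sum>d | d dvd m. (mangoldt d :: real))" by (simp add: mangoldt_sum)
    also have "{d. d dvd m} = {d\<in>{1..N}. d dvd m}"
      using m assms by (auto dest: dvd_imp_le intro: Suc_leI dvd_pos_nat)
    also have "(\<Sum>d\<in>\<dots>. mangoldt d) = (\<Sum>d\<in>{1..N}. if d dvd m then mangoldt d else (0::real))"
      by (rule sum.inter_filter) simp
    finally show "ln (real m) = (\<Sum>d\<in>{1..N}. if d dvd m then mangoldt d else 0)" .
  qed
  also have "\<dots> = (\<Sum>d\<in>{1..N}. \<Sum>m\<in>{1..n}. if d dvd m then mangoldt d else 0)" by (rule sum.swap)
  also have "\<dots> = (\<Sum>d\<in>{1..N}. mangoldt d * real (n div d))"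
  proof (intro sum.cong refl)
    fix d assume d: "d \<in> {1..N}"
    have "(\<Sum>m\<in>{1..n}. if d dvd m then mangoldt d else (0::real)) = (\<Sum>m\<in>{m\<in>{1..n}. d dvd m}. mangoldt d)"
      by (rule sum.inter_filter[symmetric]) simp
    also have "{m\<in>{1..n}. d dvd m} = (\<lambda>k. d * k) ` {1..n div d}"
    proof (intro equalityI subsetI)
      fix m assume "m \<in> {m\<in>{1..n}. d dvd m}"
      then obtain k where k: "m = d * k" "1 \<le> d * k" "d * k \<le> n" by auto
      then have "k \<le> n div d" using d by (simp add: less_eq_div_iff_mult_less_eq mult.commute)
      then show "m \<in> (\<lambda>k. d * k) ` {1..n div d}" using k by (auto simp: Suc_le_eq)
    next
      fix m assume "m \<in> (\<lambda>k. d * k) ` {1..n div d}"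
      then obtain k where k: "m = d * k" "1 \<le> k" "k \<le> n div d" by fastforce
      have "d * k \<le> n" using k d by (simp add: less_eq_div_iff_mult_less_eq mult.commute)
      then show "m \<in> {m\<in>{1..n}. d dvd m}" using k d by (auto simp: Suc_le_eq)
    qed
    also have "(\<Sum>m\<in>(\<lambda>k. d * k) ` {1..n div d}. mangoldt d) = mangoldt d * real (n div d)"
      using d by (simp add: card_image inj_on_def)
    finally show "(\<Sum>m\<in>{1..n}. if d dvd m then mangoldt d else (0::real)) = mangoldt d * real (n div d)" .
  qed
  finally show ?thesis .
qed

lemma sum_mangoldt_mono:
  assumes "P \<subseteq> {1..n}" "\<And>d. 0 \<le> c d"
  shows "(\<Sum>p\<in>P. mangoldt p * c p) \<le> (\<Sum>d\<in>{1..n}. mangoldt d * (c d :: real))"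
  using assms by (intro sum_mono2 mult_nonneg_nonneg mangoldt_nonneg) auto

lemma two_times_div_le: "2 * (n div d) \<le> (2 * n) div (d::nat)" "(2 * n) div d \<le> 2 * (n div d) + 1"
proof -
  show "2 * (n div d) \<le> (2 * n) div d"
    by (cases "d = 0") (simp_all add: less_eq_div_iff_mult_less_eq algebra_simps div_times_less_eq_dividend)
  show "(2 * n) div d \<le> 2 * (n div d) + 1"
  proof (cases "d = 0")
    case False
    have "n < d * (n div d) + d" using False by (metis mod_less_divisor mult_div_mod_eq nat_add_left_cancel_less neq0_conv)
    then have "2 * n < (2 * (n div d) + 2) * d" by (simp add: algebra_simps)
    then have "(2 * n) div d < 2 * (n div d) + 2" using False by (simp add: div_less_iff_less_mult)
    then show ?thesis by simp
  qed simp
qed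

lemma ln_central_binomial_eq:
  "ln (real ((2 * n) choose n)) = (\<Sum>d\<in>{1..2 * n}. (mangoldt d :: real) * (real ((2 * n) div d) - 2 * real (n div d)))"
proof -
  have "real ((2 * n) choose n) = fact (2 * n) / (fact n * fact n)"
    using binomial_fact[of n "2 * n", where ?'a = real] by (simp add: mult_2)
  then have "ln (real ((2 * n) choose n)) = ln (fact (2 * n)) - 2 * ln (fact n :: real)"
    by (simp add: ln_div ln_mult)
  also have "\<dots> = (\<Sum>d\<in>{1..2 * n}. (mangoldt d :: real) * (real ((2 * n) div d) - 2 * real (n div d)))"
  proof -
    have "ln (fact (2 * n) :: real) = (\<Sum>d\<in>{1..2 * n}. mangoldt d * real ((2 * n) div d))"
      "ln (fact n :: real) = (\<Sum>d\<in>{1..2 * n}. mangoldt d * real (n div d))"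
      by (rule ln_fact_eq_sum_mangoldt; simp)+
    then show ?thesis
      by (simp only: sum_distrib_left sum_subtractf[symmetric]) (simp add: right_diff_distrib mult.left_commute)
  qed
  finally show ?thesis .
qed

lemma central_binomial_coeff_bounds:
  "0 \<le> real ((2 * n) div d) - 2 * real (n div d)" "real ((2 * n) div d) - 2 * real (n div d) \<le> 1"
  using two_times_div_le[of n d] by linarith+

section \<open>Chebyshev's upper bound and Mertens' estimates\<close>

definition theta :: "nat \<Rightarrow> real" where
  "theta n = (\<Sum>p | prime p \<and> p \<le> n. ln (real p))"

text \<open>Every prime in (n, 2n] enters \<open>ln_central_binomial_eq\<close> with coefficient 1,
  and the binomial coefficient is at most 4^n.\<close>

lemma theta_double: "theta (2 * n) \<le> theta n + 2 * n * ln 2"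
proof -
  have "{p. prime p \<and> p \<le> 2 * n} = {p. prime p \<and> p \<le> n} \<union> {p. prime p \<and> n < p \<and> p \<le> 2 * n}" by auto
  then have "theta (2 * n) = theta n + (\<Sum>p | prime p \<and> n < p \<and> p \<le> 2 * n. ln (real p))"
    unfolding theta_def
    by (simp only:) (rule sum.union_disjoint, auto intro: finite_subset[OF _ finite_primes_atMost[of "2 * n"]])
  also have "(\<Sum>p | prime p \<and> n < p \<and> p \<le> 2 * n. ln (real p)) =
      (\<Sum>p | prime p \<and> n < p \<and> p \<le> 2 * n. (mangoldt p :: real) * (real ((2 * n) div p) - 2 * real (n div p)))"
  proof (intro sum.cong refl)
    fix p assume p: "p \<in> {p. prime p \<and> n < p \<and> p \<le> 2 * n}"
    then have "(2 * n) div p = 1" by (intro div_nat_eqI) auto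
    then show "ln (real p) = (mangoldt p :: real) * (real ((2 * n) div p) - 2 * real (n div p))" using p by simp
  qed
  also have "\<dots> \<le> (\<Sum>d\<in>{1..2 * n}. (mangoldt d :: real) * (real ((2 * n) div d) - 2 * real (n div d)))"
  proof (rule sum_mangoldt_mono)
    show "{p. prime p \<and> n < p \<and> p \<le> 2 * n} \<subseteq> {1..2 * n}" by auto
  qed (rule central_binomial_coeff_bounds)
  also have "\<dots> = ln (real ((2 * n) choose n))" by (rule ln_central_binomial_eq[symmetric])
  also have "\<dots> \<le> ln (2 ^ (2 * n))"
  proof -
    have "(2 * n) choose n \<le> 2 ^ (2 * n)" by (rule binomial_le_pow2)
    then have "real ((2 * n) choose n) \<le> 2 ^ (2 * n)" by (metis of_nat_le_iff of_nat_numeral of_nat_power)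
    then show ?thesis by (subst ln_le_cancel_iff) auto
  qed
  also have "\<dots> = 2 * n * ln 2" by (simp add: ln_realpow)
  finally show ?thesis by simp
qed

lemma theta_mono: "m \<le> n \<Longrightarrow> theta m \<le> theta n"
  unfolding theta_def
proof (intro sum_mono2 finite_primes_atMost)
  fix p assume "p \<in> {p. prime p \<and> p \<le> n} - {p. prime p \<and> p \<le> m}"
  then show "0 \<le> ln (real p)" using prime_ge_1_nat[of p] by simp
qed auto

lemma theta_le: "theta n \<le> 3 * real n"
proof -
  have "theta n \<le> 4 * ln 2 * n"
  proof (induction n rule: less_induct)
    case (less n)
    show ?case
    proof (cases "n \<le> 1")
      case True
      then have "{p. prime p \<and> p \<le> n} = {}" by (auto dest: prime_ge_2_nat)
      then have "theta n = 0" unfolding theta_def by (simp only: sum.empty)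
      then show ?thesis by simp
    next
      case False
      define m where "m = (n + 1) div 2"
      have m: "m < n" "n \<le> 2 * m" "2 * m \<le> n + 1" using False by (auto simp: m_def)
      have "theta n \<le> theta (2 * m)" using m by (intro theta_mono)
      also have "\<dots> \<le> theta m + 2 * real m * ln 2" by (rule theta_double)
      also have "theta m \<le> 4 * ln 2 * m" using less m by blast
      finally have "theta n \<le> ln 2 * (6 * real m)" by (simp add: algebra_simps)
      also have "\<dots> \<le> ln 2 * (4 * real n)"
      proof (rule mult_left_mono)
        show "6 * real m \<le> 4 * real n"
        \<comment> \<open>From \<open>2 * m \<le> n + 1\<close> one gets only 6 m <= 3 n + 3, which
          is at most 4 n from n = 3 on.\<close>
        proof (cases "n = 2")
          case True then show ?thesis by (simp add: m_def)
        next
          case n2: False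
          have "6 * m \<le> 4 * n" using m False n2 by linarith
          then show ?thesis by linarith
        qed
      qed simp
      finally show ?thesis by simp
    qed
  qed
  also have "4 * ln 2 * real n \<le> 3 * real n" using ln2_le_25_over_36 by (intro mult_right_mono) auto
  finally show ?thesis .
qed

text \<open>Only the primes are kept in the formula for ln n!. Replacing each \<open>n div p\<close>
  by n / p costs \<open>theta n \<le> 3 * n\<close>, the origin of the 3.\<close>

lemma sum_ln_p_over_p_le:
  fixes n :: nat
  assumes "n \<ge> 1"
  shows "(\<Sum>p | prime p \<and> p \<le> n. ln (real p) / real p) \<le> ln n + 3"
proof -
  let ?P = "{p. prime p \<and> p \<le> n}"
  have "(\<Sum>p\<in>?P. ln (real p) * (real n / real p - 1)) \<le> (\<Sum>p\<in>?P. mangoldt p * real (n div p))"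
  proof (intro sum_mono)
    fix p assume p: "p \<in> ?P"
    have "real n / real p - 1 \<le> real (n div p)"
      using floor_divide_of_nat_eq[of n p, where ?'a = real] floor_correct[of "real n / real p"] by linarith
    moreover have "ln (real p) \<ge> 0" using p prime_ge_1_nat[of p] by simp
    ultimately show "ln (real p) * (real n / real p - 1) \<le> mangoldt p * real (n div p)"
      using p by (simp add: mult_left_mono)
  qed
  also have "\<dots> \<le> (\<Sum>d\<in>{1..n}. mangoldt d * real (n div d))"
  proof (rule sum_mangoldt_mono)
    show "?P \<subseteq> {1..n}" using prime_ge_1_nat by auto
  qed simp
  also have "\<dots> = ln (fact n)" by (rule ln_fact_eq_sum_mangoldt[symmetric]) simp
  also have "\<dots> \<le> ln (real n ^ n)"
    using assms fact_le_power[of n, where ?'a = real] by (subst ln_le_cancel_iff) auto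
  also have "\<dots> = n * ln n" using assms by (simp add: ln_realpow)
  finally have "(\<Sum>p\<in>?P. n * (ln (real p) / real p)) - theta n \<le> n * ln n"
    by (simp add: theta_def sum_subtractf algebra_simps)
  then have "n * (\<Sum>p\<in>?P. ln (real p) / real p) \<le> n * (ln n + 3)"
    using theta_le[of n] by (simp add: sum_distrib_left algebra_simps)
  then show ?thesis using assms by simp
qed

text \<open>\<open>mertens_const - 1\<close> makes the induction in
  \<open>sum_inverse_primes_le\<close> start at n = 2 with equality; the 1 is added back when
  \<open>A n / ln n\<close> is moved to the right.\<close>

definition mertens_const :: real where
  "mertens_const = 1 + 3 / ln 2 - ln (ln 2)"

lemma prime_set_Suc:
  "{p. prime p \<and> p \<le> Suc n} = (if prime (Suc n) then insert (Suc n) {p. prime p \<and> p \<le> n} else {p. prime p \<and> p \<le> n})"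
  by (auto simp: le_Suc_eq)

text \<open>Discrete partial summation. A prime n + 1 adds the same amount to T and to A / ln (n +
  1), so T - A / ln changes only through the weight 1 / ln, where A is at most ln n + 3; the
  increments telescope to ln (ln n).\<close>

theorem sum_inverse_primes_le:
  fixes n :: nat
  assumes "n \<ge> 2"
  shows "(\<Sum>p | prime p \<and> p \<le> n. 1 / real p) \<le> ln (ln n) + mertens_const"
proof -
  define T where "T n = (\<Sum>p | prime p \<and> p \<le> n. 1 / real p)" for n
  define A where "A n = (\<Sum>p | prime p \<and> p \<le> n. ln (real p) / real p)" for n
  have "T n - A n / ln n \<le> ln (ln n) - 3 / ln n + (mertens_const - 1)"
    using assms
  proof (induction n rule: dec_induct)
    case base
    have "{p::nat. prime p \<and> p \<le> 2} = {2}" by (auto dest: prime_ge_2_nat)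
    then show ?case by (simp add: T_def A_def mertens_const_def)
  next
    case (step n)
    have l: "ln (real n) > 0" "ln (real (Suc n)) > 0" using step by auto
    have step1: "T (Suc n) - A (Suc n) / ln (Suc n) = T n - A n / ln (Suc n)"
    proof (cases "prime (Suc n)")
      case True
      then have "T (Suc n) = T n + 1 / real (Suc n)" "A (Suc n) = A n + ln (real (Suc n)) / real (Suc n)"
        by (simp_all add: T_def A_def prime_set_Suc finite_primes_atMost)
      then show ?thesis using l by (simp add: add_divide_distrib del: of_nat_Suc)
    next
      case False
      then show ?thesis by (simp add: T_def A_def prime_set_Suc)
    qed
    have "ln (real n) \<le> ln (real (Suc n))" using step by simp
    then have "0 \<le> 1 / ln n - 1 / ln (Suc n)" using l by (simp add: frac_le)
    moreover have "A n \<le> ln n + 3" unfolding A_def using step by (intro sum_ln_p_over_p_le) auto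
    ultimately have "A n * (1 / ln n - 1 / ln (Suc n)) \<le> (ln n + 3) * (1 / ln n - 1 / ln (Suc n))"
      by (intro mult_right_mono) auto
    also have "\<dots> = (1 - ln n / ln (Suc n)) + 3 / ln n - 3 / ln (Suc n)"
      using l by (simp add: field_simps)
    also have "1 - ln n / ln (Suc n) \<le> ln (ln (Suc n)) - ln (ln n)"
    proof -
      have "ln (ln n / ln (Suc n)) \<le> ln n / ln (Suc n) - 1" using l by (intro ln_le_minus_one) simp
      then show ?thesis using l by (simp add: ln_div del: of_nat_Suc)
    qed
    finally have "A n / ln n - A n / ln (Suc n) \<le> ln (ln (Suc n)) - ln (ln n) + 3 / ln n - 3 / ln (Suc n)"
      by (simp add: algebra_simps del: of_nat_Suc)
    then show ?case using step1 step.IH by linarith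
  qed
  moreover have "A n / ln n \<le> 1 + 3 / ln n"
  proof -
    have l: "ln (real n) > 0" using assms by simp
    have "A n \<le> ln n + 3" unfolding A_def using assms by (intro sum_ln_p_over_p_le) auto
    then have "A n / ln n \<le> (ln n + 3) / ln n" using l by (intro divide_right_mono) auto
    then show ?thesis using l by (simp add: add_divide_distrib)
  qed
  ultimately show ?thesis unfolding T_def by linarith
qed

text \<open>A prime p contributes ln p for each of its powers up to n. There are at most ln n / ln p
  of these, so p contributes at most ln n.\<close>

lemma sum_mangoldt_le: "(\<Sum>d\<in>{1..n}. (mangoldt d :: real)) \<le> card {p. prime p \<and> p \<le> n} * ln n"
proof (cases "n = 0")
  case False
  let ?P = "{p. prime p \<and> p \<le> n}" and ?Q = "{d\<in>{1..n}. primepow d}"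
  have "(\<Sum>d\<in>{1..n}. (mangoldt d :: real)) = (\<Sum>d\<in>?Q. mangoldt d)"
    by (intro sum.mono_neutral_right) (auto simp: mangoldt_def)
  also have "\<dots> = (\<Sum>p\<in>?P. \<Sum>d\<in>{d\<in>?Q. aprimedivisor d = p}. mangoldt d)"
  proof (rule sum.group[symmetric])
    show "aprimedivisor ` ?Q \<subseteq> ?P"
    proof
      fix p assume "p \<in> aprimedivisor ` ?Q"
      then obtain d where d: "d \<in> ?Q" "p = aprimedivisor d" by blast
      then obtain k q where "prime q" "k > 0" "d = q ^ k" by (auto simp: primepow_def)
      then have "p = q" using d by (simp add: aprimedivisor_prime_power)
      moreover have "q \<le> d" using \<open>k > 0\<close> \<open>d = q ^ k\<close> \<open>prime q\<close> self_le_power[of q k] prime_ge_1_nat[of q] by simp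
      ultimately show "p \<in> ?P" using \<open>prime q\<close> d by auto
    qed
  qed (auto simp: finite_primes_atMost)
  also have "\<dots> \<le> (\<Sum>p\<in>?P. ln n)"
  proof (intro sum_mono)
    fix p assume p: "p \<in> ?P"
    define K where "K = {k. 1 \<le> k \<and> p ^ k \<le> n}"
    have lp: "ln (real p) > 0" using p prime_gt_1_nat[of p] by simp
    have K: "real k * ln p \<le> ln n" if "k \<in> K" for k
    proof -
      have "real (p ^ k) \<le> real n" using that unfolding K_def by (simp only: of_nat_le_iff) simp
      then have "ln (real (p ^ k)) \<le> ln n" using p False by (subst ln_le_cancel_iff) (auto simp: prime_gt_0_nat)
      then show ?thesis by (simp add: ln_realpow)
    qed
    have Kb: "K \<subseteq> {1..nat \<lfloor>ln n / ln p\<rfloor>}"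
    proof
      fix k assume k: "k \<in> K"
      then have "real k \<le> ln n / ln p" using K lp by (simp add: le_divide_eq)
      then have "k \<le> nat \<lfloor>ln n / ln p\<rfloor>" by (simp add: le_nat_floor)
      then show "k \<in> {1..nat \<lfloor>ln n / ln p\<rfloor>}" using k by (simp add: K_def)
    qed
    have finK: "finite K" using Kb by (rule finite_subset) simp
    have "{d\<in>?Q. aprimedivisor d = p} \<subseteq> (\<lambda>k. p ^ k) ` K"
    proof
      fix d assume d: "d \<in> {d\<in>?Q. aprimedivisor d = p}"
      then obtain k q where q: "prime q" "k > 0" "d = q ^ k" by (auto simp: primepow_def)
      then have "p = q" using d by (simp add: aprimedivisor_prime_power)
      then show "d \<in> (\<lambda>k. p ^ k) ` K" using q d by (auto simp: K_def Suc_le_eq)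
    qed
    then have "card {d\<in>?Q. aprimedivisor d = p} \<le> card ((\<lambda>k. p ^ k) ` K)"
      using finK by (intro card_mono) auto
    also have "\<dots> \<le> card K" using finK by (rule card_image_le)
    also have "\<dots> \<le> card {1..nat \<lfloor>ln n / ln p\<rfloor>}" using Kb by (intro card_mono) auto
    finally have "card {d\<in>?Q. aprimedivisor d = p} \<le> nat \<lfloor>ln n / ln p\<rfloor>" by simp
    then have "real (card {d\<in>?Q. aprimedivisor d = p}) \<le> ln n / ln p"
      using False lp by (smt (verit) of_nat_floor divide_nonneg_pos ln_ge_zero of_nat_0_less_iff of_nat_le_iff of_nat_1 of_nat_mono One_nat_def Suc_leI neq0_conv)
    then have "real (card {d\<in>?Q. aprimedivisor d = p}) * ln p \<le> ln n" using lp by (simp add: le_divide_eq)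
    moreover have "(\<Sum>d\<in>{d\<in>?Q. aprimedivisor d = p}. (mangoldt d :: real)) = (\<Sum>d\<in>{d\<in>?Q. aprimedivisor d = p}. ln p)"
      by (intro sum.cong refl) (auto simp: mangoldt_def)
    ultimately show "(\<Sum>d\<in>{d\<in>?Q. aprimedivisor d = p}. (mangoldt d :: real)) \<le> ln n" by simp
  qed
  finally show ?thesis by simp
qed simp

text \<open>Chebyshev's argument: the central binomial coefficient is at least 4^n / (2n), while no
  coefficient of its expansion in \<open>mangoldt\<close> exceeds 1.\<close>

theorem prime_counting_lower_bound:
  assumes "N \<ge> 2"
  shows "real N / 8 \<le> card {p. prime p \<and> p \<le> N} * ln N"
proof -
  define n where "n = N div 2"
  have n: "n \<ge> 1" "2 * n \<le> N" "N \<le> 2 * n + 1" using assms by (auto simp: n_def)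
  have "n * ln 4 - ln (2 * n) \<le> ln (real ((2 * n) choose n))"
  proof -
    have "4 ^ n / (2 * real n) \<le> real ((2 * n) choose n)"
      using central_binomial_lower_bound[of n] n by simp
    then have "ln (4 ^ n / (2 * real n)) \<le> ln (real ((2 * n) choose n))"
      using n by (subst ln_le_cancel_iff) auto
    then show ?thesis using n by (simp add: ln_div ln_realpow)
  qed
  also have "\<dots> = (\<Sum>d\<in>{1..2 * n}. (mangoldt d :: real) * (real ((2 * n) div d) - 2 * real (n div d)))"
    by (rule ln_central_binomial_eq)
  also have "\<dots> \<le> (\<Sum>d\<in>{1..2 * n}. mangoldt d * 1)"
    using central_binomial_coeff_bounds(2) by (intro sum_mono mult_left_mono) (auto simp: mangoldt_nonneg)
  also have "\<dots> \<le> (\<Sum>d\<in>{1..N}. mangoldt d)" using n by (simp, intro sum_mono2) (auto simp: mangoldt_nonneg)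
  also have "\<dots> \<le> card {p. prime p \<and> p \<le> N} * ln N" by (rule sum_mangoldt_le)
  finally have main: "n * ln 4 - ln (2 * n) \<le> card {p. prime p \<and> p \<le> N} * ln N" .
  have "ln (4::real) = 2 * ln 2" using ln_realpow[of 2 2] by simp
  then have l4: "ln (4::real) \<ge> 4 / 3" using ln2_ge_two_thirds by simp
  have "ln (2 * real n) = ln 2 + ln n" using n by (simp add: ln_mult)
  also have "\<dots> \<le> 25 / 36 + (real n - 1)" using ln2_le_25_over_36 ln_le_minus_one[of "real n"] n by simp
  finally have l2: "ln (2 * real n) \<le> 25 / 36 + (real n - 1)" .
  have "real n * (4 / 3) \<le> real n * ln 4" using l4 by (intro mult_left_mono) auto
  then have "real n / 3 + 11 / 36 \<le> n * ln 4 - ln (2 * n)" using l2 by simp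
  moreover have "real N / 8 \<le> real n / 3 + 11 / 36" using n by simp
  ultimately show ?thesis using main by linarith
qed

section \<open>Character sums by Stepanov's method\<close>

text \<open>Integer polynomials considered up to \<open>pzero\<close> play the part of polynomials
  over the field with p elements.\<close>

definition pzero :: "nat \<Rightarrow> int poly \<Rightarrow> bool" where
  "pzero p f \<longleftrightarrow> (\<forall>n. int p dvd coeff f n)"

lemma pzero_iff_dvd: "pzero p f \<longleftrightarrow> [:int p:] dvd f"
  by (simp add: pzero_def const_poly_dvd_iff)

lemma pzero_0 [simp]: "pzero p 0"
  by (simp add: pzero_def)

lemma pzero_add: "pzero p f \<Longrightarrow> pzero p g \<Longrightarrow> pzero p (f + g)"
  by (simp add: pzero_def)

lemma pzero_diff: "pzero p f \<Longrightarrow> pzero p g \<Longrightarrow> pzero p (f - g)"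
  by (simp add: pzero_def)

lemma pzero_mult_left: "pzero p f \<Longrightarrow> pzero p (g * f)"
  by (simp add: pzero_iff_dvd)

lemma pzero_mult_right: "pzero p f \<Longrightarrow> pzero p (f * g)"
  by (simp add: pzero_iff_dvd)

lemma pzero_sum: "(\<And>i. i \<in> A \<Longrightarrow> pzero p (f i)) \<Longrightarrow> pzero p (sum f A)"
  by (simp add: pzero_iff_dvd dvd_sum)

lemma pzero_smult: "pzero p (smult (int p) f)"
  by (simp add: pzero_def)

text \<open>Gauss's lemma: a prime number stays prime as a constant polynomial.\<close>

lemma pzero_mult_iff:
  assumes "prime p" shows "pzero p (f * g) \<longleftrightarrow> pzero p f \<or> pzero p g"
proof -
  have "prime_elem [:int p:]"
    using assms by (intro lift_prime_elem_poly) simp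
  then show ?thesis
    by (simp add: pzero_iff_dvd prime_elem_dvd_mult_iff)
qed

lemma pzero_pow:
  assumes "prime p" "pzero p (f ^ n)" shows "pzero p f"
  using assms(2)
proof (induction n)
  case 0
  then have "int p dvd coeff 1 0" unfolding pzero_def by (metis power_0)
  then show ?case using assms(1) by (auto simp: prime_nat_iff)
qed (use assms(1) in \<open>auto simp: pzero_mult_iff\<close>)

lemma pzero_pderiv: "pzero p f \<Longrightarrow> pzero p (pderiv f)"
  by (simp add: pzero_def coeff_pderiv)

lemma pzero_poly:
  assumes "pzero p f" shows "int p dvd poly f x"
proof -
  from assms obtain g where "f = [:int p:] * g" by (auto simp: pzero_iff_dvd dvd_def)
  then show ?thesis by simp
qed

lemma pzero_cong_mult:
  assumes "pzero p (f - f')" "pzero p (g - g')" shows "pzero p (f * g - f' * g')"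
proof -
  have "f * g - f' * g' = (f - f') * g + f' * (g - g')" by (simp add: algebra_simps)
  then show ?thesis using assms by (simp add: pzero_add pzero_mult_left pzero_mult_right)
qed

lemma not_pzero_monic: 
  assumes "prime p" "lead_coeff f = 1" shows "\<not> pzero p f"
proof
  assume "pzero p f"
  then have "int p dvd 1" using assms(2) unfolding pzero_def by metis
  then show False using assms(1) by (auto simp: prime_nat_iff)
qed

section \<open>Multiple roots modulo p\<close>

lemma dvd_mod_p_of_root:
  assumes "int p dvd poly g x"
  shows "\<exists>g'. pzero p (g - [:-x, 1:] * g')"
proof -
  have "g - [:-x,1:] * synthetic_div g x = [:poly g x:]"
    using synthetic_div_correct'[of x g] by (simp add: algebra_simps)
  moreover have "pzero p [:poly g x:]"
    using assms by (simp add: pzero_def coeff_pCons split: nat.split)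
  ultimately show ?thesis by metis
qed

lemma poly_iter_pderiv_linear_power:
  "poly ((pderiv ^^ i) ([:-x, 1:] ^ i * g)) x = fact i * poly g (x::int)"
proof (induction i arbitrary: g)
  case (Suc i)
  have "pderiv ([:-x, 1:] ^ Suc i * g) = [:-x,1:] ^ i * (smult (of_nat (Suc i)) g + [:-x,1:] * pderiv g)"
    by (subst pderiv_mult, subst pderiv_power_Suc) (simp add: pderiv_pCons algebra_simps smult_add_left)
  then have "poly ((pderiv ^^ Suc i) ([:-x, 1:] ^ Suc i * g)) x
      = fact i * poly (smult (of_nat (Suc i)) g + [:-x,1:] * pderiv g) x"
    by (simp only: funpow_Suc_right o_apply Suc.IH)
  then show ?case by (simp add: algebra_simps)
qed simp

lemma iter_pderiv_add: "(pderiv ^^ i) (f + g) = (pderiv ^^ i) f + (pderiv ^^ i) (g :: int poly)"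
  by (induction i) (simp_all add: pderiv_add)

lemma pzero_iter_pderiv: "pzero p f \<Longrightarrow> pzero p ((pderiv ^^ i) f)"
  by (induction i) (simp_all add: pzero_pderiv)

lemma iter_pderiv_sum: "(pderiv ^^ i) (sum f A) = (\<Sum>a\<in>A. (pderiv ^^ i) (f a :: int poly))"
proof (induction A rule: infinite_finite_induct)
  case (insert x F)
  then show ?case by (simp add: iter_pderiv_add)
qed (induction i; simp)+

text \<open>The i-th derivative of (X - x)^i g has the value i! g(x) at x. Since i! is a unit modulo
  p for i < p, vanishing derivatives detect multiplicity, but only up to p; hence
  \<open>l \<le> p\<close>.\<close>

lemma multiplicity_mod_p_of_derivs:
  assumes "prime p" "l \<le> p" "\<And>i. i < l \<Longrightarrow> int p dvd poly ((pderiv ^^ i) h) x"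
  shows "\<exists>g. pzero p (h - [:-x, 1:] ^ l * g)"
  using assms(2,3)
proof (induction l)
  case 0
  then show ?case by (intro exI[of _ h]) simp
next
  case (Suc l)
  then obtain g where g: "pzero p (h - [:-x, 1:] ^ l * g)" by force
  let ?u = "h - [:-x, 1:] ^ l * g"
  have "h = [:-x, 1:] ^ l * g + ?u" by simp
  then have "poly ((pderiv ^^ l) h) x = fact l * poly g x + poly ((pderiv ^^ l) ?u) x"
    by (metis iter_pderiv_add poly_add poly_iter_pderiv_linear_power)
  moreover have "int p dvd poly ((pderiv ^^ l) ?u) x"
    using g by (intro pzero_poly pzero_iter_pderiv)
  ultimately have "int p dvd fact l * poly g x"
    using Suc.prems(2)[of l] by (metis dvd_add_left_iff lessI)
  moreover have "\<not> int p dvd fact l"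
  proof
    assume "int p dvd fact l"
    then have "p dvd fact l" by (metis int_dvd_int_iff of_nat_fact)
    then show False using assms(1) Suc.prems(1) by (simp add: prime_dvd_fact_iff)
  qed
  ultimately have "int p dvd poly g x"
    using assms(1) by (simp add: prime_dvd_mult_iff)
  then obtain g' where g': "pzero p (g - [:-x, 1:] * g')" using dvd_mod_p_of_root by blast
  have "h - [:-x, 1:] ^ Suc l * g' = ?u + [:-x, 1:] ^ l * (g - [:-x, 1:] * g')"
    by (simp add: algebra_simps)
  then show ?case using g g' by (metis pzero_add pzero_mult_left)
qed

lemma factor_out_mod_p:
  assumes p: "prime p" and h: "pzero p (A * g - [:-y, 1:] ^ l * g2)" and A: "\<not> int p dvd poly A y"
  shows "\<exists>g'. pzero p (g - [:-y, 1:] ^ l * g')"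
proof -
  let ?Y = "[:-y, 1:]"
  have "\<exists>g'. pzero p (g - ?Y ^ j * g')" if "j \<le> l" for j
    using that
  proof (induction j)
    case 0 then show ?case by (intro exI[of _ g]) simp
  next
    case (Suc j)
    then obtain g' where g': "pzero p (g - ?Y ^ j * g')" by force
    have e: "l = j + (l - j)" using Suc by simp
    have "pzero p ((A * g - ?Y ^ l * g2) - A * (g - ?Y ^ j * g'))"
      by (rule pzero_diff[OF h pzero_mult_left[OF g']])
    also have "(A * g - ?Y ^ l * g2) - A * (g - ?Y ^ j * g') = ?Y ^ j * (A * g' - ?Y ^ (l - j) * g2)"
      by (subst e) (simp only: power_add algebra_simps)
    finally have "pzero p (A * g' - ?Y ^ (l - j) * g2)"
      using p pzero_pow[OF p, of ?Y j] not_pzero_monic[OF p, of ?Y] by (auto simp: pzero_mult_iff)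
    then have "int p dvd poly (A * g' - ?Y ^ (l - j) * g2) y" by (rule pzero_poly)
    then have "int p dvd poly A y * poly g' y" using Suc.prems by (simp add: power_0_left)
    then have "int p dvd poly g' y" using A p by (simp add: prime_dvd_mult_iff)
    then obtain g'' where g'': "pzero p (g' - ?Y * g'')" using dvd_mod_p_of_root by blast
    have "g - ?Y ^ Suc j * g'' = (g - ?Y ^ j * g') + ?Y ^ j * (g' - ?Y * g'')"
      by (simp add: algebra_simps)
    then show ?case using g' g'' by (metis pzero_add pzero_mult_left)
  qed
  then show ?thesis by blast
qed

lemma prod_linear_powers_dvd_mod_p:
  assumes p: "prime p" and "finite S"
    and "\<And>x. x \<in> S \<Longrightarrow> \<exists>g. pzero p (h - [:-x, 1:] ^ l * g)"
    and "\<And>x y. x \<in> S \<Longrightarrow> y \<in> S \<Longrightarrow> x \<noteq> y \<Longrightarrow> \<not> int p dvd x - y"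
  shows "\<exists>g. pzero p (h - (\<Prod>x\<in>S. [:-x, 1:]) ^ l * g)"
  using assms(2-)
proof (induction S rule: finite_induct)
  case empty
  then show ?case by (intro exI[of _ h]) simp
next
  case (insert y S)
  obtain g where g: "pzero p (h - (\<Prod>x\<in>S. [:-x, 1:]) ^ l * g)"
    using insert.IH insert.prems by blast
  obtain g2 where g2: "pzero p (h - [:-y, 1:] ^ l * g2)" using insert.prems by blast
  let ?A = "(\<Prod>x\<in>S. [:-x, 1:]) ^ l"
  have "pzero p ((h - [:-y, 1:] ^ l * g2) - (h - ?A * g))"
    using g g2 by (rule pzero_diff[rotated])
  then have "pzero p (?A * g - [:-y, 1:] ^ l * g2)" by simp
  moreover have "\<not> int p dvd poly ?A y"
  proof
    assume "int p dvd poly ?A y"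
    then have "int p dvd (\<Prod>x\<in>S. y - x)"
      using p by (auto simp: poly_prod dest: prime_dvd_power[rotated])
    then obtain x where "x \<in> S" "int p dvd y - x"
      using p \<open>finite S\<close> by (auto simp: prime_dvd_prod_iff)
    then show False using insert.prems(2)[of y x] insert.hyps by auto
  qed
  ultimately obtain g' where g': "pzero p (g - [:-y, 1:] ^ l * g')"
    using factor_out_mod_p[OF p] by blast
  have "h - (\<Prod>x\<in>insert y S. [:-x, 1:]) ^ l * g' = (h - ?A * g) + ?A * (g - [:-y, 1:] ^ l * g')"
    unfolding prod.insert[OF insert.hyps] power_mult_distrib by (simp only: algebra_simps)
  then show ?case using g g' by (metis pzero_add pzero_mult_left)
qed

text \<open>Cutting off the top coefficients divisible by p makes the integer degree equal to the
  degree modulo p.\<close>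

lemma mod_p_reduce:
  assumes "prime p" "\<not> pzero p g"
  shows "\<exists>g'. pzero p (g - g') \<and> \<not> int p dvd lead_coeff g'"
proof -
  define N where "N = {n. \<not> int p dvd coeff g n}"
  have fin: "finite N"
    by (rule finite_subset[of _ "{..degree g}"]) (auto simp: N_def intro: le_degree)
  have ne: "N \<noteq> {}" using assms(2) by (auto simp: N_def pzero_def)
  define n where "n = Max N"
  have n: "n \<in> N" "\<And>m. m \<in> N \<Longrightarrow> m \<le> n" using fin ne by (auto simp: n_def)
  define g' where "g' = (\<Sum>i\<le>n. monom (coeff g i) i)"
  have c: "coeff g' i = (if i \<le> n then coeff g i else 0)" for i
    by (simp add: g'_def coeff_sum)
  have "degree g' = n"
  proof (rule antisym)
    show "degree g' \<le> n" by (rule degree_le) (simp add: c)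
    show "n \<le> degree g'" using n(1) by (intro le_degree) (auto simp: c N_def)
  qed
  then have "\<not> int p dvd lead_coeff g'" using n(1) by (simp add: c N_def)
  moreover have "pzero p (g - g')"
    using n(2) by (force simp: pzero_def c N_def)
  ultimately show ?thesis by blast
qed

text \<open>Modulo p, h has a monic factor of degree \<open>card S * l\<close>. Once the cofactor is
  cut down to a leading coefficient prime to p, the top coefficient of the product is nonzero modulo
  p, so h has a nonzero coefficient in that degree.\<close>

lemma card_roots_le_degree_mod_p:
  assumes p: "prime p" and "finite S" and h0: "\<not> pzero p h" and lp: "l \<le> p"
    and "\<And>x i. x \<in> S \<Longrightarrow> i < l \<Longrightarrow> int p dvd poly ((pderiv ^^ i) h) x"
    and "\<And>x y. x \<in> S \<Longrightarrow> y \<in> S \<Longrightarrow> x \<noteq> y \<Longrightarrow> \<not> int p dvd x - y"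
  shows "card S * l \<le> degree h"
proof -
  let ?A = "(\<Prod>x\<in>S. [:-x, 1:]) ^ l"
  obtain g where g: "pzero p (h - ?A * g)"
    using prod_linear_powers_dvd_mod_p[OF p \<open>finite S\<close>] multiplicity_mod_p_of_derivs[OF p lp] assms(5,6)
    by meson
  have "\<not> pzero p g"
    using h0 g pzero_add[OF g, of "?A * g"] by (auto simp: pzero_mult_left)
  then obtain g' where g': "pzero p (g - g')" "\<not> int p dvd lead_coeff g'"
    using mod_p_reduce[OF p] by blast
  have monA: "lead_coeff ?A = 1"
    by (simp add: lead_coeff_power lead_coeff_prod)
  have degA: "degree ?A = card S * l"
    using assms(2) by (subst degree_power_eq) (auto simp: degree_prod_sum_eq)
  have g0: "g' \<noteq> 0" using g'(2) by auto
  have A0: "?A \<noteq> 0" using monA by force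
  have "pzero p (h - ?A * g')"
    using pzero_add[OF g pzero_mult_left[OF g'(1), of ?A]] by (simp add: algebra_simps)
  then have "int p dvd coeff (h - ?A * g') (degree (?A * g'))" by (simp add: pzero_def)
  moreover have "coeff (?A * g') (degree (?A * g')) = lead_coeff g'"
    using monA by (metis lead_coeff_mult mult_1)
  ultimately have "coeff h (degree (?A * g')) \<noteq> 0" using g'(2)
    by (metis coeff_diff dvd_diff_commute diff_0_right dvd_0_right diff_zero)
  then have "degree (?A * g') \<le> degree h" by (rule le_degree)
  then show ?thesis using degA degree_mult_eq[OF A0 g0] by linarith
qed

lemma pzero_freshman:
  assumes "prime p" shows "pzero p ((f + g) ^ p - (f ^ p + g ^ p))"
proof -
  have p1: "p > 1" using assms by (rule prime_gt_1_nat)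
  define t where "t k = of_nat (p choose k) * f ^ k * g ^ (p - k)" for k
  have "(f + g) ^ p = (\<Sum>k\<le>p. t k)" unfolding t_def by (rule binomial_ring)
  also have "{..p} = insert 0 (insert p {0<..<p})" using p1 by auto
  also have "sum t (insert 0 (insert p {0<..<p})) = t 0 + (t p + sum t {0<..<p})"
    using p1 by (subst sum.insert; simp)+
  also have "t 0 = g ^ p" by (simp add: t_def)
  also have "t p = f ^ p" by (simp add: t_def)
  finally have "(f + g) ^ p - (f ^ p + g ^ p) = sum t {0<..<p}" by simp
  moreover have "pzero p (t k)" if "k \<in> {0<..<p}" for k
  proof -
    have "p dvd p choose k" using that assms by (intro dvd_choose_prime) auto
    then obtain c where "p choose k = p * c" by (auto elim: dvdE)
    then have "t k = smult (int p) (of_nat c * f ^ k * g ^ (p - k))"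
      by (simp add: t_def of_nat_poly mult.assoc)
    then show ?thesis by (simp add: pzero_smult)
  qed
  ultimately show ?thesis by (metis pzero_sum)
qed

section \<open>Independence of the terms of the auxiliary polynomial\<close>

definition shifted_prod :: "int set \<Rightarrow> int poly" where
  "shifted_prod H = (\<Prod>h\<in>H. [:h, 1:])"

lemma shifted_prod_insert: "finite H \<Longrightarrow> h \<notin> H \<Longrightarrow> shifted_prod (insert h H) = [:h, 1:] * shifted_prod H"
  unfolding shifted_prod_def by (rule prod.insert)

lemma degree_shifted_prod: "finite H \<Longrightarrow> degree (shifted_prod H) = card H"
  by (simp add: shifted_prod_def degree_prod_sum_eq)

lemma lead_coeff_shifted_prod: "lead_coeff (shifted_prod H) = 1"
  by (simp add: shifted_prod_def lead_coeff_prod)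

lemma poly_shifted_prod: "poly (shifted_prod H) x = (\<Prod>h\<in>H. h + x)"
  by (simp add: shifted_prod_def poly_prod)

text \<open>Each factor becomes h^p + X^p by the binomial theorem modulo p, so modulo X^p only the
  product of the h^p survives. It is a unit because no h is divisible by p.\<close>

lemma shifted_prod_power_p:
  assumes p: "prime p" and "finite H" and "\<And>h. h \<in> H \<Longrightarrow> \<not> int p dvd h"
  shows "\<exists>c w. pzero p (shifted_prod H ^ p - ([:c:] + monom 1 p * w)) \<and> \<not> int p dvd c"
  using assms(2,3)
proof (induction H rule: finite_induct)
  case empty
  then show ?case using p
    by (rule_tac exI[of _ 1], rule_tac exI[of _ 0]) (auto simp: shifted_prod_def prime_nat_iff simp flip: one_pCons)
next
  case (insert h H)
  then obtain c w where cw: "pzero p (shifted_prod H ^ p - ([:c:] + monom 1 p * w))" "\<not> int p dvd c" by auto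
  have hh: "\<not> int p dvd h" using insert.prems by simp
  have "[:h, 1:] = [:h:] + monom 1 1" by (simp add: monom_altdef)
  then have "pzero p ([:h, 1:] ^ p - ([:h:] ^ p + monom 1 1 ^ p))"
    using pzero_freshman[OF p, of "[:h:]" "monom 1 1"] by simp
  moreover have "[:h:] ^ p = [:h ^ p:]" by (simp add: poly_const_pow)
  moreover have "monom 1 1 ^ p = (monom 1 p :: int poly)" by (simp add: monom_power)
  ultimately have "pzero p ([:h, 1:] ^ p - ([:h ^ p:] + monom 1 p))" by simp
  from pzero_cong_mult[OF this cw(1)]
  have "pzero p ([:h, 1:] ^ p * shifted_prod H ^ p - ([:h ^ p:] + monom 1 p) * ([:c:] + monom 1 p * w))" .
  also have "[:h, 1:] ^ p * shifted_prod H ^ p = shifted_prod (insert h H) ^ p"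
    unfolding shifted_prod_insert[OF insert.hyps] power_mult_distrib ..
  also have "([:h ^ p:] + monom 1 p) * ([:c:] + monom 1 p * w)
       = [:h ^ p * c:] + monom 1 p * ([:h ^ p:] * w + [:c:] + monom 1 p * w)"
    by (simp add: algebra_simps)
  finally show ?case using cw(2) hh p
    by (metis prime_dvd_mult_iff prime_dvd_power prime_nat_int_transfer)
qed

text \<open>Descent on the degree: each root of the squarefree polynomial would have to occur to an odd order
  on one side and to an even order on the other.\<close>

lemma square_times_shifted_prod_mod_p:
  assumes p: "prime p" and H: "finite H" "h1 \<in> H"
    and dist: "\<And>x y. x \<in> H \<Longrightarrow> y \<in> H \<Longrightarrow> x \<noteq> y \<Longrightarrow> \<not> int p dvd x - y"
    and c: "\<not> int p dvd c"
    and eq: "pzero p (r ^ 2 * shifted_prod H - [:c:] * s ^ 2)"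
    and deg: "degree s \<le> n"
  shows "pzero p r \<and> pzero p s"
  using eq deg
proof (induction n arbitrary: r s rule: less_induct)
  case (less n)
  define F where "F = shifted_prod (H - {h1})"
  let ?Y = "[:h1, 1:]"
  have fH: "shifted_prod H = ?Y * F"
    using H shifted_prod_insert[of "H - {h1}" h1] by (simp add: F_def insert_absorb)
  have nY: "\<not> pzero p ?Y" by (rule not_pzero_monic[OF p]) simp
  have nF: "\<not> int p dvd poly F (-h1)"
  proof
    assume "int p dvd poly F (-h1)"
    then have "int p dvd (\<Prod>h\<in>H - {h1}. h - h1)" by (simp add: F_def poly_shifted_prod)
    then obtain x where "x \<in> H - {h1}" "int p dvd x - h1"
      using p H by (auto simp: prime_dvd_prod_iff)
    then show False using dist[of x h1] H by auto
  qed
  have "pzero p s"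
  proof (rule ccontr)
    assume ns: "\<not> pzero p s"
    have "int p dvd poly (r ^ 2 * shifted_prod H - [:c:] * s ^ 2) (-h1)"
      using less.prems(1) by (rule pzero_poly)
    then have "int p dvd c * poly s (-h1) ^ 2" by (simp add: fH)
    then have d: "int p dvd poly s (-h1)"
      using c p by (metis prime_dvd_mult_iff prime_dvd_power prime_nat_int_transfer)
    define s' where "s' = synthetic_div s (-h1)"
    have s': "s = ?Y * s' + [:poly s (-h1):]"
      using synthetic_div_correct'[of "-h1" s] by (simp add: s'_def)
    have pz: "pzero p (s - ?Y * s')"
      using d by (subst s') (simp add: pzero_def coeff_pCons split: nat.split)
    have "s' \<noteq> 0" using ns pz by auto
    then have n0: "degree s > 0" by (auto simp: s'_def synthetic_div_eq_0_iff)
    have "pzero p (s ^ 2 - (?Y * s') ^ 2)"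
      using pzero_cong_mult[OF pz pz] by (simp add: power2_eq_square)
    then have "pzero p ((r ^ 2 * shifted_prod H - [:c:] * s ^ 2) + [:c:] * (s ^ 2 - (?Y * s') ^ 2))"
      by (intro pzero_add less.prems pzero_mult_left)
    also have "(r ^ 2 * shifted_prod H - [:c:] * s ^ 2) + [:c:] * (s ^ 2 - (?Y * s') ^ 2)
         = ?Y * (r ^ 2 * F - [:c:] * ?Y * s' ^ 2)"
      unfolding fH by (simp only: power2_eq_square algebra_simps)
    finally have e2: "pzero p (r ^ 2 * F - [:c:] * ?Y * s' ^ 2)" using nY p by (simp only: pzero_mult_iff) blast
    then have "int p dvd poly (r ^ 2 * F - [:c:] * ?Y * s' ^ 2) (-h1)" by (rule pzero_poly)
    then have "int p dvd poly r (-h1) ^ 2 * poly F (-h1)" by simp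
    then have "int p dvd poly r (-h1)"
      using nF p by (metis prime_dvd_mult_iff prime_dvd_power prime_nat_int_transfer)
    then obtain r' where r': "pzero p (r - ?Y * r')" using dvd_mod_p_of_root[of p r "-h1"] by auto
    have "pzero p (r ^ 2 - (?Y * r') ^ 2)"
      using pzero_cong_mult[OF r' r'] by (simp add: power2_eq_square)
    then have "pzero p ((r ^ 2 * F - [:c:] * ?Y * s' ^ 2) - (r ^ 2 - (?Y * r') ^ 2) * F)"
      by (rule pzero_diff[OF e2 pzero_mult_right])
    also have "(r ^ 2 * F - [:c:] * ?Y * s' ^ 2) - (r ^ 2 - (?Y * r') ^ 2) * F
       = ?Y * (r' ^ 2 * shifted_prod H - [:c:] * s' ^ 2)"
      unfolding fH by (simp only: power2_eq_square algebra_simps)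
    finally have "pzero p (r' ^ 2 * shifted_prod H - [:c:] * s' ^ 2)"
      using nY p by (simp only: pzero_mult_iff) blast
    moreover have "degree s' < n" using n0 less.prems(2) by (simp add: s'_def degree_synthetic_div)
    ultimately have "pzero p s'" using less.IH by blast
    then show False using ns pzero_add[OF pz pzero_mult_left[of p s' ?Y]] by simp
  qed
  moreover have "pzero p r"
  proof -
    have "pzero p (r ^ 2 * shifted_prod H - [:c:] * s ^ 2 + [:c:] * s ^ 2)"
      using \<open>pzero p s\<close> by (intro pzero_add less.prems pzero_mult_left) (simp add: power2_eq_square pzero_mult_left)
    then have "pzero p (r ^ 2 * shifted_prod H)" by simp
    moreover have "\<not> pzero p (shifted_prod H)" by (rule not_pzero_monic[OF p lead_coeff_shifted_prod])
    ultimately show ?thesis using p pzero_pow by (auto simp: pzero_mult_iff)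
  qed
  ultimately show ?case by blast
qed

text \<open>Blocks with different powers X^(pj) cannot cancel. Let k be the lowest block not yet
  known to vanish and f the shifted product. Division by f^l X^(pk) gives U + V f^((p-1)/2) = 0;
  multiplying by the conjugate and by f gives U^2 f = V^2 f^p, and modulo X^p the power f^p is a
  constant c. All degrees involved are below p, so R_k^2 f = c S_k^2 holds exactly modulo p, and the
  descent forces both sides to vanish.\<close>

lemma stepanov_nonvanishing:
  fixes R S :: "nat \<Rightarrow> int poly"
  assumes p: "prime p" "odd p" and H: "finite H" "H \<noteq> {}"
    and H0: "\<And>h. h \<in> H \<Longrightarrow> \<not> int p dvd h"
    and dist: "\<And>x y. x \<in> H \<Longrightarrow> y \<in> H \<Longrightarrow> x \<noteq> y \<Longrightarrow> \<not> int p dvd x - y"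
    and deg: "\<And>j. degree (R j) < d" "\<And>j. degree (S j) < d" and d: "2 * d + card H \<le> p"
    and zero: "pzero p (\<Sum>j<J. (R j * shifted_prod H ^ l + S j * shifted_prod H ^ (l + (p - 1) div 2)) * monom 1 (p * j))"
    and j: "j < J"
  shows "pzero p (R j) \<and> pzero p (S j)"
  using j
proof (induction j rule: less_induct)
  case (less k)
  define f where "f = shifted_prod H"
  define E where "E = (p - 1) div 2"
  have E: "2 * E + 1 = p" using p by (auto simp: E_def elim: oddE)
  have nf: "\<not> pzero p f" unfolding f_def by (rule not_pzero_monic[OF p(1) lead_coeff_shifted_prod])
  define t where "t j = (R j + S j * f ^ E) * monom 1 (p * j)" for j
  have "(\<Sum>j<J. (R j * f ^ l + S j * f ^ (l + E)) * monom 1 (p * j)) = f ^ l * (\<Sum>j<J. t j)"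
    by (simp add: t_def sum_distrib_left power_add algebra_simps)
  then have zt: "pzero p (\<Sum>j<J. t j)"
    using zero nf pzero_pow[OF p(1), of f l] p(1) unfolding f_def[symmetric] E_def[symmetric]
    by (auto simp: pzero_mult_iff)
  have "{..<J} = {..<k} \<union> {k..<J}" using less.prems by auto
  then have "(\<Sum>j<J. t j) = (\<Sum>j<k. t j) + (\<Sum>j\<in>{k..<J}. t j)"
    by (simp add: sum.union_disjoint ivl_disj_int)
  moreover have "pzero p (\<Sum>j<k. t j)"
    using less by (intro pzero_sum) (auto simp: t_def intro!: pzero_mult_right pzero_add)
  ultimately have zt2: "pzero p (\<Sum>j\<in>{k..<J}. t j)"
    using pzero_diff[OF zt, of "\<Sum>j<k. t j"] by simp
  define A where "A = (\<Sum>j\<in>{Suc k..<J}. R j * monom 1 (p * (j - Suc k)))"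
  define B where "B = (\<Sum>j\<in>{Suc k..<J}. S j * monom 1 (p * (j - Suc k)))"
  have tm: "t j = monom 1 (p * k) * (monom 1 p * (R j * monom 1 (p * (j - Suc k)) + S j * monom 1 (p * (j - Suc k)) * f ^ E))"
    if jk: "j \<in> {Suc k..<J}" for j
  proof -
    have "p * j = p * k + (p + p * (j - Suc k))"
    proof -
      obtain i where "j = Suc k + i" using jk le_Suc_ex[of "Suc k" j] by auto
      then show ?thesis by (simp add: algebra_simps)
    qed
    then have "monom 1 (p * j) = monom 1 (p * k) * (monom 1 p * monom (1::int) (p * (j - Suc k)))"
      by (simp add: mult_monom)
    then show ?thesis by (simp only: t_def algebra_simps)
  qed
  have "(\<Sum>j\<in>{k..<J}. t j) = t k + (\<Sum>j\<in>{Suc k..<J}. t j)"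
    using less.prems by (simp add: sum.atLeast_Suc_lessThan)
  also have "(\<Sum>j\<in>{Suc k..<J}. t j) = monom 1 (p * k) * (monom 1 p * (A + B * f ^ E))"
    using tm by (simp add: A_def B_def sum_distrib_left sum_distrib_right sum.distrib algebra_simps)
  finally have "(\<Sum>j\<in>{k..<J}. t j) = monom 1 (p * k) * ((R k + monom 1 p * A) + (S k + monom 1 p * B) * f ^ E)"
    by (simp only: t_def algebra_simps)
  then have G: "pzero p ((R k + monom 1 p * A) + (S k + monom 1 p * B) * f ^ E)"
    using zt2 p(1) not_pzero_monic[OF p(1), of "monom 1 (p * k)"]
    by (auto simp: pzero_mult_iff degree_monom_eq)
  define U where "U = R k + monom 1 p * A"
  define V where "V = S k + monom 1 p * B"
  obtain c w where cw: "pzero p (f ^ p - ([:c:] + monom 1 p * w))" "\<not> int p dvd c"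
    using shifted_prod_power_p[OF p(1) H(1) H0] unfolding f_def by blast
  have "pzero p ((U + V * f ^ E) * (U - V * f ^ E) * f)"
    using G unfolding U_def V_def by (intro pzero_mult_right)
  also have "(U + V * f ^ E) * (U - V * f ^ E) * f = U ^ 2 * f - V ^ 2 * f ^ (2 * E + 1)"
    by (simp only: power_add power_one_right mult_2 power2_eq_square) (simp add: algebra_simps)
  finally have "pzero p (U ^ 2 * f - V ^ 2 * f ^ p)" unfolding E .
  then have "pzero p (U ^ 2 * f - V ^ 2 * f ^ p + V ^ 2 * (f ^ p - ([:c:] + monom 1 p * w)))"
    by (intro pzero_add pzero_mult_left cw)
  then have z3: "pzero p (U ^ 2 * f - V ^ 2 * ([:c:] + monom 1 p * w))" by (simp add: algebra_simps)
  define Q where "Q = (2 * R k * A + monom 1 p * A ^ 2) * f - (2 * S k * B + monom 1 p * B ^ 2) * [:c:] - V ^ 2 * w"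
  have id: "U ^ 2 * f - V ^ 2 * ([:c:] + monom 1 p * w) = (R k ^ 2 * f - [:c:] * S k ^ 2) + monom 1 p * Q"
    unfolding U_def V_def Q_def by (simp only: power2_eq_square algebra_simps mult_2)
  have degf: "degree f = card H" using H by (simp add: f_def degree_shifted_prod)
  have d0: "d > 0" using deg(1)[of k] by simp
  have "degree (R k ^ 2 * f) < p"
  proof -
    have "degree (R k ^ 2 * f) \<le> degree (R k ^ 2) + degree f" by (rule degree_mult_le)
    also have "degree (R k ^ 2) \<le> 2 * degree (R k)" by (metis degree_power_le mult.commute)
    finally show ?thesis using deg(1)[of k] d degf by linarith
  qed
  moreover have "degree ([:c:] * S k ^ 2) < p"
  proof -
    have "degree ([:c:] * S k ^ 2) \<le> degree (S k ^ 2)" by (metis degree_smult_le mult_pCons_left mult_zero_left pCons_0_0 add_0_right)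
    also have "\<dots> \<le> 2 * degree (S k)" by (metis degree_power_le mult.commute)
    finally show ?thesis using deg(2)[of k] d by linarith
  qed
  ultimately have dl: "degree (R k ^ 2 * f - [:c:] * S k ^ 2) < p" by (rule degree_diff_less)
  have "pzero p (R k ^ 2 * f - [:c:] * S k ^ 2)"
    unfolding pzero_def
  proof
    fix n
    show "int p dvd coeff (R k ^ 2 * f - [:c:] * S k ^ 2) n"
    proof (cases "n < p")
      case True
      have "int p dvd coeff ((R k ^ 2 * f - [:c:] * S k ^ 2) + monom 1 p * Q) n"
        using z3 unfolding id pzero_def by blast
      moreover have "coeff (monom 1 p * Q) n = 0" using True by (simp add: coeff_monom_mult)
      ultimately show ?thesis by (simp only: coeff_add add_0_right)
    next
      case False
      then have "coeff (R k ^ 2 * f - [:c:] * S k ^ 2) n = 0" using dl by (intro coeff_eq_0) linarith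
      then show ?thesis by (simp only: dvd_0_right)
    qed
  qed
  then show ?case
    using square_times_shifted_prod_mod_p[OF p(1) H(1) _ dist cw(2), of _ "R k" "S k" "degree (S k)"] H(2)
    unfolding f_def by (metis order_refl ex_in_conv)
qed

text \<open>The cofactor of \<^term>\<open>f ^ (e - i)\<close> in the \<open>i\<close>-th derivative of \<^term>\<open>r * f ^ e\<close>.\<close>

fun deriv_cofactor :: "int poly \<Rightarrow> nat \<Rightarrow> int poly \<Rightarrow> nat \<Rightarrow> int poly" where
  "deriv_cofactor f e r 0 = r"
| "deriv_cofactor f e r (Suc i) =
     pderiv (deriv_cofactor f e r i) * f + of_nat (e - i) * (deriv_cofactor f e r i * pderiv f)"

lemma deriv_cofactor_diff:
  "deriv_cofactor f e (r - s) i = deriv_cofactor f e r i - deriv_cofactor f e s i"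
proof (induction i)
  case (Suc i)
  show ?case by (simp only: deriv_cofactor.simps Suc.IH pderiv_diff) (simp add: algebra_simps)
qed simp

lemma degree_deriv_cofactor: "degree (deriv_cofactor f e r i) \<le> degree r + i * degree f"
proof (induction i)
  case (Suc i)
  let ?c = "deriv_cofactor f e r i"
  have "degree (pderiv ?c * f) \<le> degree ?c + degree f"
    by (rule order_trans[OF degree_mult_le]) (simp add: degree_pderiv)
  moreover have "degree (of_nat (e - i) * (?c * pderiv f)) \<le> degree ?c + degree f"
  proof -
    have "degree (of_nat (e - i) * (?c * pderiv f)) \<le> degree (?c * pderiv f)"
      by (simp add: of_nat_poly degree_smult_le)
    also have "\<dots> \<le> degree ?c + degree (pderiv f)" by (rule degree_mult_le)
    finally show ?thesis by (simp add: degree_pderiv)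
  qed
  ultimately have "degree (deriv_cofactor f e r (Suc i)) \<le> degree ?c + degree f"
    by (simp add: degree_add_le)
  then show ?case using Suc by simp
qed simp

text \<open>X^(pj) has derivative 0 modulo p and so acts as a constant. Such monomials make the
  auxiliary polynomial large in degree, yet at integers they take the values of X^j by
  Fermat.\<close>

lemma iter_pderiv_term:
  assumes "i \<le> e"
  shows "pzero p ((pderiv ^^ i) (r * f ^ e * monom 1 (p * j)) -
           deriv_cofactor f e r i * f ^ (e - i) * monom 1 (p * j))"
  using assms
proof (induction i)
  case (Suc i)
  let ?c = "deriv_cofactor f e r i" and ?X = "monom (1::int) (p * j)"
  obtain n where n: "e - i = Suc n" "e - Suc i = n" using Suc.prems by (cases "e - i") auto
  have IH: "pzero p ((pderiv ^^ i) (r * f ^ e * ?X) - ?c * f ^ (e - i) * ?X)" using Suc by simp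
  from pzero_pderiv[OF this]
  have "pzero p ((pderiv ^^ Suc i) (r * f ^ e * ?X) - pderiv (?c * f ^ Suc n * ?X))"
    by (simp add: pderiv_diff n)
  moreover have "pderiv (?c * f ^ Suc n * ?X) =
     deriv_cofactor f e r (Suc i) * f ^ n * ?X + ?c * f ^ Suc n * pderiv ?X"
    by (simp only: deriv_cofactor.simps pderiv_mult pderiv_power_Suc n of_nat_poly) (simp add: algebra_simps)
  moreover have "pzero p (pderiv ?X)" by (simp add: pderiv_monom pzero_def coeff_monom)
  ultimately show ?case
    using pzero_add[of p "(pderiv ^^ Suc i) (r * f ^ e * ?X) - pderiv (?c * f ^ Suc n * ?X)" "?c * f ^ Suc n * pderiv ?X"]
    by (simp add: n pzero_mult_left algebra_simps)
qed simp

lemma fermat_int: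
  assumes "prime p" shows "[(x::int) ^ p = x] (mod int p)"
proof (cases "int p dvd x")
  case True
  then show ?thesis using assms
    by (metis cong_0_iff cong_sym cong_trans dvd_power_same dvd_trans dvd_power prime_gt_0_nat)
next
  case False
  define y where "y = nat (x mod int p)"
  have p0: "int p > 0" using assms by (simp add: prime_gt_0_nat)
  have y: "[x = int y] (mod int p)" using p0 by (simp add: y_def cong_def)
  have "\<not> p dvd y" using False y by (metis cong_dvd_iff int_dvd_int_iff)
  then have "[y ^ (p - 1) = 1] (mod p)" using assms by (rule fermat_theorem[rotated])
  then have "[int y ^ (p - 1) = 1] (mod int p)" by (metis cong_int_iff of_nat_1 of_nat_power)
  then have "[int y ^ (p - 1) * int y = 1 * int y] (mod int p)" by (rule cong_scalar_right)
  then have "[int y ^ p = int y] (mod int p)"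
    using p0 by (metis mult_1 power_minus_mult of_nat_0_less_iff)
  then show ?thesis using y by (meson cong_pow cong_sym cong_trans)
qed

text \<open>The auxiliary polynomial of Stepanov's method exists by the pigeonhole principle.\<close>

lemma stepanov_count:
  assumes p: "prime p" "odd p" and H: "finite H" "H \<noteq> {}"
    and H0: "\<And>h. h \<in> H \<Longrightarrow> \<not> int p dvd h"
    and dist: "\<And>x y. x \<in> H \<Longrightarrow> y \<in> H \<Longrightarrow> x \<noteq> y \<Longrightarrow> \<not> int p dvd x - y"
    and d: "2 * d + card H \<le> p" "d > 0" and l: "l \<le> p"
    and many: "l * (d + l * card H + J) < 2 * J * d"
  shows "card {x\<in>{0..<int p}. [(\<Prod>h\<in>H. h + x) ^ ((p - 1) div 2) = a] (mod int p)} * l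
         \<le> p * J + card H * (l + p)"
proof -
  define f where "f = shifted_prod H"
  define E where "E = (p - 1) div 2"
  define m where "m = card H"
  define D where "D = d + l * m + J"
  have p0: "p > 0" using p by (simp add: prime_gt_0_nat)
  have J0: "J > 0" using many by (cases J) auto
  have degf: "degree f = m" using H by (simp add: f_def m_def degree_shifted_prod)
  define I where "I = ({..<J} \<times> {..<2::nat}) \<times> {..<d}"
  define ex where "ex \<epsilon> = l + \<epsilon> * E" for \<epsilon> :: nat
  define pol where "pol c v = (\<Sum>t<d. monom (c (v, t)) t :: int poly)" for c :: "(nat \<times> nat) \<times> nat \<Rightarrow> int" and v
  \<comment> \<open>At a counted point, where f(x)^E = a and x^p = x modulo p, the i-th derivative
    of h below is f(x)^(l - i) times \<open>poly (sg c i) x\<close>. Asking all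
    \<open>sg c i\<close> with i < l to vanish modulo p is a system of l * D linear conditions on 2
    * J * d unknowns, and \<open>many\<close> says that the unknowns prevail.\<close>
  define sg where "sg c i = (\<Sum>v\<in>{..<J} \<times> {..<2::nat}. smult (a ^ snd v) (deriv_cofactor f (ex (snd v)) (pol c v) i * monom 1 (fst v)))"
    for c i
  have coeff_pol: "coeff (pol c v) t = (if t < d then c (v, t) else 0)" for c v t
    by (simp add: pol_def coeff_sum)
  have deg_pol: "degree (pol c v) < d" for c v
    using d(2) by (intro degree_lessI) (auto simp: coeff_pol)
  have pol_diff: "pol (\<lambda>u. c u - c' u) v = pol c v - pol c' v" for c c' v
    by (rule poly_eqI) (simp add: coeff_pol)
  have sg_diff: "sg (\<lambda>u. c u - c' u) i = sg c i - sg c' i" for c c' i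
    by (simp add: sg_def pol_diff deriv_cofactor_diff smult_diff_right left_diff_distrib sum_subtractf)
  have deg_sg: "degree (sg c i) < D" if "i < l" for c i
  proof -
    have "degree (smult (a ^ snd v) (deriv_cofactor f (ex (snd v)) (pol c v) i * monom 1 (fst v))) < D"
      if v: "v \<in> {..<J} \<times> {..<2::nat}" for v
    proof -
      let ?c = "deriv_cofactor f (ex (snd v)) (pol c v) i"
      have "degree (smult (a ^ snd v) (?c * monom 1 (fst v))) \<le> degree (?c * monom 1 (fst v))"
        by (rule degree_smult_le)
      also have "\<dots> \<le> degree ?c + degree (monom (1::int) (fst v))" by (rule degree_mult_le)
      also have "degree (monom (1::int) (fst v)) < J" using v by (auto simp: degree_monom_eq)
      also have "degree ?c \<le> degree (pol c v) + i * m" using degree_deriv_cofactor[of f] degf by metis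
      also have "i * m \<le> l * m" using \<open>i < l\<close> by simp
      finally show ?thesis using deg_pol[of c v] by (simp add: D_def)
    qed
    moreover have "D > 0" using d by (simp add: D_def)
    ultimately show ?thesis unfolding sg_def by (intro degree_sum_less) auto
  qed
  define \<Phi> where "\<Phi> c = restrict (\<lambda>(i, n). coeff (sg c i) n mod int p) ({..<l} \<times> {..<D})" for c
  define C where "C = PiE I (\<lambda>_. {0..<int p})"
  have finI: "finite I" by (simp add: I_def)
  have cardI: "card I = 2 * J * d" by (simp add: I_def card_cartesian_product)
  have "\<Phi> ` C \<subseteq> PiE ({..<l} \<times> {..<D}) (\<lambda>_. {0..<int p})"
    unfolding \<Phi>_def using p0 by (intro image_subsetI) (simp add: restrict_PiE_iff split_beta)
  then have "card (\<Phi> ` C) \<le> card (PiE ({..<l} \<times> {..<D}) (\<lambda>_. {0..<int p}))"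
    by (intro card_mono finite_PiE) auto
  also have "\<dots> = p ^ (l * D)" by (simp add: card_PiE card_cartesian_product)
  also have "\<dots> < p ^ card I"
    using many prime_gt_1_nat[OF p(1)] by (intro power_strict_increasing) (auto simp: cardI D_def m_def)
  also have "p ^ card I = card C" using finI by (simp add: C_def card_PiE)
  finally have "\<not> inj_on \<Phi> C" using card_image by fastforce
  then obtain c1 c2 where c12: "c1 \<in> C" "c2 \<in> C" "\<Phi> c1 = \<Phi> c2" "c1 \<noteq> c2" by (auto simp: inj_on_def)
  \<comment> \<open>The difference of two choices with the same image solves the linear system, and
    some coefficient of it is nonzero modulo p.\<close>
  define c where "c = (\<lambda>u. c1 u - c2 u)"
  have sg0: "pzero p (sg c i)" if "i < l" for i
    unfolding pzero_def
  proof
    fix n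
    show "int p dvd coeff (sg c i) n"
    proof (cases "n < D")
      case True
      then have "coeff (sg c1 i) n mod int p = coeff (sg c2 i) n mod int p"
        using fun_cong[OF c12(3), of "(i, n)"] \<open>i < l\<close> by (simp add: \<Phi>_def)
      then show ?thesis by (simp add: c_def sg_diff mod_eq_dvd_iff)
    next
      case False
      then show ?thesis using deg_sg[OF that, of c] by (simp add: coeff_eq_0)
    qed
  qed
  obtain v0 t0 where vt: "(v0, t0) \<in> I" "c1 (v0, t0) \<noteq> c2 (v0, t0)"
    using c12 unfolding C_def by (metis PiE_ext surj_pair)
  have np: "\<not> pzero p (pol c v0)"
  proof
    assume "pzero p (pol c v0)"
    then have "int p dvd coeff (pol c v0) t0" by (simp add: pzero_def)
    then have "int p dvd c1 (v0, t0) - c2 (v0, t0)" using vt by (simp add: coeff_pol c_def I_def)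
    moreover have "c1 (v0, t0) \<in> {0..<int p}" "c2 (v0, t0) \<in> {0..<int p}"
      using c12 vt unfolding C_def by (auto dest: PiE_mem)
    ultimately show False using vt(2)
      by (metis atLeastLessThan_iff mod_eq_dvd_iff mod_pos_pos_trivial)
  qed
  define h where "h = (\<Sum>j<J. (pol c (j, 0) * f ^ l + pol c (j, 1) * f ^ (l + E)) * monom 1 (p * j))"
  have h_alt: "h = (\<Sum>v\<in>{..<J} \<times> {..<2}. pol c v * f ^ ex (snd v) * monom 1 (p * fst v))"
  proof -
    have "(\<Sum>v\<in>{..<J} \<times> {..<2}. pol c v * f ^ ex (snd v) * monom 1 (p * fst v))
       = (\<Sum>j<J. \<Sum>\<epsilon><2. pol c (j, \<epsilon>) * f ^ ex \<epsilon> * monom 1 (p * j))"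
      by (simp add: sum.cartesian_product split_beta)
    also have "\<dots> = h" unfolding h_def
      by (intro sum.cong refl) (simp add: ex_def numeral_2_eq_2 algebra_simps)
    finally show ?thesis by simp
  qed
  have "\<not> pzero p h"
  proof
    assume hz: "pzero p h"
    obtain j \<epsilon> where v0: "v0 = (j, \<epsilon>)" "j < J" "\<epsilon> < 2" using vt by (auto simp: I_def)
    have "pzero p (pol c (j, 0)) \<and> pzero p (pol c (j, 1))"
      using stepanov_nonvanishing[OF p H H0 dist, where R = "\<lambda>j. pol c (j, 0)" and S = "\<lambda>j. pol c (j, 1)" and d = d and J = J and l = l and j = j]
        deg_pol d(1) hz v0(2) unfolding h_def f_def E_def by blast
    then show False using np v0 by (auto simp: less_2_cases_iff)
  qed
  define S where "S = {x\<in>{0..<int p}. [(\<Prod>h\<in>H. h + x) ^ E = a] (mod int p)}"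
  have root: "int p dvd poly ((pderiv ^^ i) h) x" if x: "x \<in> S" and i: "i < l" for x i
  proof -
    let ?V = "{..<J} \<times> {..<2::nat}"
    let ?g = "\<lambda>v. deriv_cofactor f (ex (snd v)) (pol c v) i"
    have "(pderiv ^^ i) h = (\<Sum>v\<in>?V. (pderiv ^^ i) (pol c v * f ^ ex (snd v) * monom 1 (p * fst v)))"
      unfolding h_alt by (rule iter_pderiv_sum)
    then have "(pderiv ^^ i) h - (\<Sum>v\<in>?V. ?g v * f ^ (ex (snd v) - i) * monom 1 (p * fst v)) =
        (\<Sum>v\<in>?V. (pderiv ^^ i) (pol c v * f ^ ex (snd v) * monom 1 (p * fst v)) - ?g v * f ^ (ex (snd v) - i) * monom 1 (p * fst v))"
      by (simp add: sum_subtractf)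
    moreover have "pzero p \<dots>"
      using i by (intro pzero_sum iter_pderiv_term) (simp add: ex_def)
    ultimately have "pzero p ((pderiv ^^ i) h - (\<Sum>v\<in>?V. ?g v * f ^ (ex (snd v) - i) * monom 1 (p * fst v)))"
      by simp
    from pzero_poly[OF this, of x]
    have 1: "[poly ((pderiv ^^ i) h) x = (\<Sum>v\<in>?V. poly (?g v) x * poly f x ^ (ex (snd v) - i) * x ^ (p * fst v))] (mod int p)"
      by (simp add: cong_iff_dvd_diff poly_sum poly_monom)
    have fa: "[poly f x ^ E = a] (mod int p)" using x by (simp add: S_def f_def poly_shifted_prod)
    have 2: "[poly (?g v) x * poly f x ^ (ex (snd v) - i) * x ^ (p * fst v)
        = poly (?g v) x * (poly f x ^ (l - i) * a ^ snd v) * x ^ fst v] (mod int p)" for v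
    proof (intro cong_mult cong_refl)
      have "ex (snd v) - i = (l - i) + E * snd v" using i by (simp add: ex_def mult.commute)
      then have "poly f x ^ (ex (snd v) - i) = poly f x ^ (l - i) * (poly f x ^ E) ^ snd v"
        by (simp add: power_add power_mult)
      then show "[poly f x ^ (ex (snd v) - i) = poly f x ^ (l - i) * a ^ snd v] (mod int p)"
        using fa by (simp add: cong_mult cong_pow)
      show "[x ^ (p * fst v) = x ^ fst v] (mod int p)"
        using cong_pow[OF fermat_int[OF p(1), of x]] by (simp add: power_mult)
    qed
    have "(\<Sum>v\<in>?V. poly (?g v) x * (poly f x ^ (l - i) * a ^ snd v) * x ^ fst v) = poly f x ^ (l - i) * poly (sg c i) x"
      by (simp add: sg_def poly_sum poly_monom sum_distrib_left algebra_simps)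
    then have "[poly ((pderiv ^^ i) h) x = poly f x ^ (l - i) * poly (sg c i) x] (mod int p)"
      using cong_trans[OF 1 cong_sum[of ?V]] 2 by (metis (no_types, lifting))
    moreover have "int p dvd poly f x ^ (l - i) * poly (sg c i) x"
      using pzero_poly[OF sg0[OF i]] by simp
    ultimately show ?thesis by (simp add: cong_dvd_iff)
  qed
  have "card S * l \<le> degree h"
  proof (rule card_roots_le_degree_mod_p[OF p(1)])
    show "finite S" unfolding S_def by (rule finite_subset[of _ "{0..<int p}"]) auto
    show "\<not> int p dvd x - y" if "x \<in> S" "y \<in> S" "x \<noteq> y" for x y
      using that by (metis (no_types, lifting) S_def mem_Collect_eq atLeastLessThan_iff mod_eq_dvd_iff mod_pos_pos_trivial)
  qed (use \<open>\<not> pzero p h\<close> l root in auto)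
  also have "degree h \<le> p * J + m * (l + p)"
    unfolding h_alt
  proof (intro degree_sum_le)
    fix v assume v: "v \<in> {..<J} \<times> {..<2::nat}"
    have "degree (pol c v * f ^ ex (snd v) * monom 1 (p * fst v)) \<le> degree (pol c v * f ^ ex (snd v)) + degree (monom (1::int) (p * fst v))"
      by (rule degree_mult_le)
    also have "degree (pol c v * f ^ ex (snd v)) \<le> degree (pol c v) + degree (f ^ ex (snd v))" by (rule degree_mult_le)
    also have "degree (f ^ ex (snd v)) \<le> m * ex (snd v)" using degree_power_le[of f] degf by metis
    also have "ex (snd v) \<le> l + p"
      using v by (auto simp: ex_def E_def less_2_cases_iff mem_Times_iff)
    also have "degree (monom (1::int) (p * fst v)) = p * fst v" by (simp add: degree_monom_eq)
    also have "p * fst v \<le> p * (J - 1)" using v by auto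
    finally have "degree (pol c v * f ^ ex (snd v) * monom 1 (p * fst v)) \<le> d + m * (l + p) + p * (J - 1)"
      using deg_pol[of c v] by simp
    \<comment> \<open>The last block starts at p (J - 1); the remaining p covers the degree of its
      coefficient polynomial, as d <= p.\<close>
    also have "p * J = p * (J - 1) + p" using J0 by (cases J) auto
    ultimately show "degree (pol c v * f ^ ex (snd v) * monom 1 (p * fst v)) \<le> p * J + m * (l + p)"
      using d(1) by linarith
  qed auto
  finally show ?thesis by (simp add: S_def E_def m_def)
qed

section \<open>From Stepanov's count to Legendre symbols\<close>

lemma bij_betw_add_mod:
  assumes "(n::int) > 0"
  shows "bij_betw (\<lambda>x. (x + c) mod n) {0..<n} {0..<n}"
proof (rule bij_betwI[where g = "\<lambda>x. (x - c) mod n"])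
  show "((x + c) mod n - c) mod n = x" if "x \<in> {0..<n}" for x
    using that by (simp add: mod_simps)
  show "((x - c) mod n + c) mod n = x" if "x \<in> {0..<n}" for x
    using that by (simp add: mod_simps)
qed (use assms in auto)

lemma sum_periodic_shift:
  assumes "(n::int) > 0" "\<And>x. F (x mod n) = F x"
  shows "(\<Sum>x\<in>{0..<n}. F (x + c)) = (\<Sum>x\<in>{0..<n}. F x)"
  using sum.reindex_bij_betw[OF bij_betw_add_mod[OF assms(1), of c], of F] assms(2) by simp

lemma Legendre_cong:
  assumes "[a = b] (mod p)" shows "Legendre a p = Legendre b p"
proof -
  have "[a = 0] (mod p) \<longleftrightarrow> [b = 0] (mod p)" "QuadRes p a \<longleftrightarrow> QuadRes p b"
    using assms by (auto simp: QuadRes_def) (meson cong_trans cong_sym)+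
  then show ?thesis by (simp add: Legendre_def)
qed

lemma Legendre_values: "Legendre a p \<in> {-1, 0, 1}"
  by (simp add: Legendre_def)

lemma Legendre_eq_iff_power:
  assumes "prime p" "p > 2" "s \<in> {-1, 1}"
  shows "Legendre a (int p) = s \<longleftrightarrow> [a ^ ((p - 1) div 2) = s] (mod int p)"
proof
  assume "Legendre a (int p) = s"
  then show "[a ^ ((p - 1) div 2) = s] (mod int p)"
    using euler_criterion[OF assms(1,2), of a] by (simp add: cong_sym)
next
  assume "[a ^ ((p - 1) div 2) = s] (mod int p)"
  then have "[Legendre a (int p) = s] (mod int p)"
    using euler_criterion[OF assms(1,2), of a] cong_trans by blast
  then have "int p dvd Legendre a (int p) - s" by (simp add: cong_iff_dvd_diff)
  moreover have "\<bar>Legendre a (int p) - s\<bar> < int p"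
    using Legendre_values[of a "int p"] assms by auto
  ultimately show "Legendre a (int p) = s"
    by (metis dvd_imp_le_int linorder_not_le abs_of_nat eq_iff_diff_eq_0)
qed

text \<open>l is near sqrt p, d near p / 2, and J exceeds l / 2 by about 2 m, which lets the
  unknowns outnumber the conditions; p J / l is then p / 2 + O(m sqrt p). The hypothesis amounts to
  21 m < sqrt p, the range in which the bound of \<open>Legendre_shifted_prod_sum_bound\<close> is
  not trivial.\<close>

lemma stepanov_parameters:
  fixes p m :: nat
  assumes "441 * m^2 < p" "m > 0"
  obtains l d J where "2 * d + m \<le> p" "d > 0" "l \<le> p" "l * (d + l * m + J) < 2 * J * d" "l > 0"
    "real (p * J + m * (l + p)) / l \<le> real p / 2 + 6 * m * sqrt p"
proof -
  define l where "l = nat \<lfloor>sqrt p\<rfloor>"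
  define d where "d = (p - m) div 2"
  define J where "J = (l + 4 * m + 4) div 2"
  have "sqrt (441 * m^2) < sqrt p" using assms by (intro real_sqrt_less_mono) (metis of_nat_less_iff of_nat_mult of_nat_power of_nat_numeral)
  then have sq: "21 * m < sqrt p" by (simp add: real_sqrt_mult)
  have sp: "sqrt p * sqrt p = p" by simp
  have l: "real l \<le> sqrt p" "sqrt p < real l + 1" unfolding l_def by (simp_all add: floor_less_cancel)
  have m1: "real m \<ge> 1" using assms by simp
  have p21: "p \<ge> 21 * sqrt p"
  proof -
    have "21 * sqrt p \<le> sqrt p * sqrt p" using sq m1 by (intro mult_right_mono) auto
    then show ?thesis by simp
  qed
  have d2: "real (2 * d) \<ge> real p - m - 1" "2 * d + m \<le> p"
    using sq p21 m1 unfolding d_def by simp_all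
  have J2: "real (2 * J) \<ge> l + 4 * m + 3" "real (2 * J) \<le> l + 4 * m + 4"
    unfolding J_def by linarith+
  have l2: "real l * real l \<le> p" using l(1) sp by (metis mult_mono of_nat_0_le_iff real_sqrt_ge_zero)
  have dl: "real (2 * d) - l \<ge> p / 2" using d2 l sq p21 m1 by linarith
  show ?thesis
  proof (rule that[of d l J])
    show "2 * d + m \<le> p" by fact
    have "real d > 0" using dl p21 sq m1 by simp
    then show "d > 0" by simp
    show "l \<le> p" using l p21 by linarith
    show "l > 0" using l sq m1 by (cases l) auto
    have "(4 * real m + 2) * (real p / 2) < (4 * real m + 3) * (2 * real d - real l)"
      using dl assms by (intro mult_less_le_imp_less) auto
    moreover have "real l * real l * (2 * real m + 1) \<le> real p * (2 * real m + 1)"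
      using l2 by (intro mult_right_mono) auto
    moreover have "(real l + 4 * real m + 3) * (2 * real d - real l) \<le> 2 * real J * (2 * real d - real l)"
      using J2 dl by (intro mult_right_mono) auto
    ultimately have "real l * (real d + real l * real m + real J) < 2 * real J * real d" by (simp add: algebra_simps)
    then have "real (l * (d + l * m + J)) < real (2 * J * d)" by simp
    then show "l * (d + l * m + J) < 2 * J * d" by (simp only: of_nat_less_iff)
    have lp: "real l > 0" using \<open>l > 0\<close> by simp
    have "sqrt p * sqrt p \<le> sqrt p * ((21 / 20) * real l)"
      using l sq m1 by (intro mult_left_mono) auto
    then have "real p / real l \<le> (21 / 20) * sqrt p"
      using lp sp by (simp add: field_simps)
    then have "real p / real l * (3 * real m + 2) \<le> (21 / 20) * sqrt p * (5 * real m)"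
      using m1 by (intro mult_mono) auto
    moreover have "real m * 21 \<le> real m * sqrt p" using sq m1 by (intro mult_left_mono) auto
    moreover have "real (p * J + m * (l + p)) / l \<le> real p / 2 + real p / real l * (3 * real m + 2) + real m"
    proof -
      have "real p * (2 * real J) \<le> real p * (real l + 4 * real m + 4)" using J2 by (intro mult_left_mono) auto
      then have "real p * real J + real m * (real l + real p)
          \<le> real p * real l / 2 + real p * (3 * real m + 2) + real m * real l"
        by (simp add: algebra_simps)
      also have "\<dots> = (real p / 2 + real p / real l * (3 * real m + 2) + real m) * real l"
        using lp by (simp add: algebra_simps)
      finally show ?thesis using lp by (simp add: divide_le_eq)
    qed
    moreover have "(21 / 20) * sqrt p * (5 * real m) = 21 / 4 * (real m * sqrt p)"
      "6 * m * sqrt p = 6 * (real m * sqrt p)" by simp_all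
    ultimately show "real (p * J + m * (l + p)) / l \<le> real p / 2 + 6 * m * sqrt p" using m1 by linarith
  qed
qed

text \<open>A weak form of Weil's bound. Each of the values 1 and -1 occurs at most p / 2 + 6 m sqrt
  p times by Stepanov's count, and 0 at most m times; since the three counts add up to p, the upper
  bounds for 1 and -1 force both near p / 2. For p up to 441 m^2 the trivial bound p
  suffices.\<close>

theorem Legendre_shifted_prod_sum_bound:
  assumes p: "prime p" "odd p" and H: "finite H" "H \<noteq> {}"
    and dist: "\<And>x y. x \<in> H \<Longrightarrow> y \<in> H \<Longrightarrow> x \<noteq> y \<Longrightarrow> \<not> int p dvd x - y"
  shows "\<bar>real_of_int (\<Sum>x\<in>{0..<int p}. Legendre (\<Prod>h\<in>H. h + x) (int p))\<bar> \<le> 21 * card H * sqrt p"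
proof -
  define m where "m = card H"
  have m0: "m > 0" using H by (simp add: m_def card_gt_0_iff)
  have p2: "p > 2" using p prime_gt_1_nat[OF p(1)] by (cases "p = 2") auto
  define T where "T = (\<Sum>x\<in>{0..<int p}. Legendre (\<Prod>h\<in>H. h + x) (int p))"
  show ?thesis
  proof (cases "441 * m^2 < p")
    case False
    have "\<bar>T\<bar> \<le> (\<Sum>x\<in>{0..<int p}. 1)"
      unfolding T_def by (intro order_trans[OF sum_abs sum_mono]) (simp add: Legendre_def)
    then have "\<bar>T\<bar> \<le> int p" by simp
    then have "\<bar>real_of_int T\<bar> \<le> real p" by linarith
    also have "real p = sqrt p * sqrt p" by simp
    also have "\<dots> \<le> 21 * m * sqrt p"
    proof (intro mult_right_mono)
      have "sqrt p \<le> sqrt (441 * m^2)" using False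
        by (intro real_sqrt_le_mono) (metis of_nat_le_iff of_nat_mult of_nat_power of_nat_numeral linorder_not_less)
      then show "sqrt p \<le> 21 * m" by (simp add: real_sqrt_mult)
    qed simp
    finally show ?thesis by (simp add: T_def m_def)
  next
    case big: True
    obtain l d J where par: "2 * d + m \<le> p" "d > 0" "l \<le> p" "l * (d + l * m + J) < 2 * J * d" "l > 0"
      "real (p * J + m * (l + p)) / l \<le> real p / 2 + 6 * m * sqrt p"
      using stepanov_parameters[OF big m0] by metis
    have "m < p" using par by linarith
    \<comment> \<open>Translation by c moves H away from 0 modulo p, as
      \<open>stepanov_count\<close> requires; \<open>m < p\<close> leaves room for such a c.\<close>
    have "\<exists>c\<in>{0..<int p}. c \<notin> (\<lambda>h. (-h) mod int p) ` H"
    proof (rule ccontr)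
      assume "\<not> ?thesis"
      then have "{0..<int p} \<subseteq> (\<lambda>h. (-h) mod int p) ` H" by auto
      then have "card {0..<int p} \<le> card ((\<lambda>h. (-h) mod int p) ` H)" using H by (intro card_mono) auto
      also have "\<dots> \<le> m" unfolding m_def using H by (intro card_image_le)
      finally show False using \<open>m < p\<close> by simp
    qed
    then obtain c where c: "c \<in> {0..<int p}" "c \<notin> (\<lambda>h. (-h) mod int p) ` H" by blast
    define H' where "H' = (\<lambda>h. h + c) ` H"
    have inj: "inj_on (\<lambda>h. h + c) H" by (auto simp: inj_on_def)
    have H': "finite H'" "H' \<noteq> {}" "card H' = m"
      using H inj by (auto simp: H'_def m_def card_image)
    have H'0: "\<not> int p dvd h" if "h \<in> H'" for h
    proof
      assume "int p dvd h"
      then obtain g where g: "g \<in> H" "int p dvd g + c" using \<open>h \<in> H'\<close> by (auto simp: H'_def)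
      then have "int p dvd c - (-g)" by (simp add: add.commute)
      then have "c mod int p = (-g) mod int p" by (simp only: mod_eq_dvd_iff)
      then show False using c g by auto
    qed
    have dist': "\<not> int p dvd x - y" if "x \<in> H'" "y \<in> H'" "x \<noteq> y" for x y
      using that dist by (auto simp: H'_def)
    define F where "F x = Legendre (\<Prod>h\<in>H. h + x) (int p)" for x
    have F_mod: "F (x mod int p) = F x" for x
      unfolding F_def by (intro Legendre_cong cong_prod cong_add cong_refl) (simp add: cong_def)
    have FH': "F (x + c) = Legendre (\<Prod>h\<in>H'. h + x) (int p)" for x
      using inj by (simp add: F_def H'_def prod.reindex algebra_simps)
    have "T = (\<Sum>x\<in>{0..<int p}. F x)" by (simp add: T_def F_def)
    also have "\<dots> = (\<Sum>x\<in>{0..<int p}. F (x + c))"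
      using p F_mod by (intro sum_periodic_shift[symmetric]) (auto simp: prime_gt_0_nat)
    finally have T: "T = (\<Sum>x\<in>{0..<int p}. F (x + c))" .
    define N where "N s = card {x\<in>{0..<int p}. F (x + c) = s}" for s
    have Nb: "real (N s) \<le> real p / 2 + 6 * m * sqrt p" if s: "s \<in> {-1, 1}" for s
    proof -
      have "N s * l \<le> p * J + m * (l + p)"
        using stepanov_count[OF p H'(1,2) H'0 dist', of d l J s] par s
        unfolding N_def FH' Legendre_eq_iff_power[OF p(1) p2 s] H'(3) by blast
      then have "real (N s) * l \<le> real (p * J + m * (l + p))" by (metis of_nat_le_iff of_nat_mult)
      then have "real (N s) \<le> real (p * J + m * (l + p)) / l" using par(5) by (simp add: le_divide_eq)
      then show ?thesis using par(6) by linarith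
    qed
    have N0: "N 0 \<le> m"
    proof -
      have "{x\<in>{0..<int p}. F (x + c) = 0} \<subseteq> (\<lambda>h. (-h) mod int p) ` H'"
      proof
        fix x assume x: "x \<in> {x\<in>{0..<int p}. F (x + c) = 0}"
        then have "int p dvd (\<Prod>h\<in>H'. h + x)" by (simp add: FH' Legendre_def cong_0_iff split: if_splits)
        then obtain h where h: "h \<in> H'" "int p dvd h + x" using p H' by (auto simp: prime_dvd_prod_iff)
        then have "int p dvd x - (-h)" by (simp add: add.commute)
        then have "x mod int p = (-h) mod int p" by (simp only: mod_eq_dvd_iff)
        then show "x \<in> (\<lambda>h. (-h) mod int p) ` H'" using x h by auto
      qed
      then have "N 0 \<le> card ((\<lambda>h. (-h) mod int p) ` H')" unfolding N_def using H' by (intro card_mono) auto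
      also have "\<dots> \<le> m" using card_image_le[OF H'(1)] H'(3) by metis
      finally show ?thesis .
    qed
    have sums: "(\<Sum>x\<in>{0..<int p}. G (F (x + c))) = int (N (-1)) * G (-1) + int (N 0) * G 0 + int (N 1) * G 1"
      for G :: "int \<Rightarrow> int"
    proof -
      have "(\<Sum>x\<in>{0..<int p}. G (F (x + c))) = (\<Sum>x\<in>{0..<int p}. \<Sum>s\<in>{-1,0,1}. if F (x + c) = s then G s else 0)"
        using Legendre_values by (intro sum.cong refl) (auto simp: F_def)
      also have "\<dots> = (\<Sum>s\<in>{-1,0,1}. \<Sum>x\<in>{0..<int p}. if F (x + c) = s then G s else 0)" by (rule sum.swap)
      also have "\<dots> = (\<Sum>s\<in>{-1,0,1}. int (N s) * G s)"
        unfolding N_def by (intro sum.cong refl) (subst sum.inter_filter[symmetric]; simp)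
      finally show ?thesis by simp
    qed
    have "T = int (N 1) - int (N (-1))" using sums[of "\<lambda>s. s"] T by simp
    moreover have "int p = int (N (-1)) + int (N 0) + int (N 1)" using sums[of "\<lambda>s. 1"] by simp
    ultimately have TT: "real_of_int T = 2 * real (N 1) - real p + real (N 0)"
      "real_of_int T = real p - real (N 0) - 2 * real (N (-1))" by linarith+
    have "real m * 1 \<le> real m * sqrt p" using p2 by (intro mult_left_mono) auto
    moreover have "6 * real m * sqrt p = 6 * (real m * sqrt p)" "21 * real m * sqrt p = 21 * (real m * sqrt p)"
      by simp_all
    moreover have "real (N 0) \<le> real m" using N0 by simp
    moreover have "real (N 1) \<le> real p / 2 + 6 * real m * sqrt p" "real (N (-1)) \<le> real p / 2 + 6 * real m * sqrt p"
      using Nb by auto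
    ultimately have "\<bar>real_of_int T\<bar> \<le> 21 * real m * sqrt p"
      using TT unfolding abs_le_iff by linarith
    then show ?thesis by (simp add: T_def m_def)
  qed
qed

section \<open>Rough squarefree numbers\<close>

definition coprime_upto :: "nat set \<Rightarrow> nat \<Rightarrow> nat set" where
  "coprime_upto P z = {m\<in>{1..z}. \<forall>p\<in>P. \<not> p dvd m}"

text \<open>Sieving one prime at a time: the multiples of p in the set fall back into it after
  division by p, so removing them costs at most the fraction 1 / p of the reciprocal sum. No error
  term arises.\<close>

lemma sum_inverse_coprime_upto:
  assumes "finite P" "\<And>p. p \<in> P \<Longrightarrow> prime p"
  shows "(\<Prod>p\<in>P. 1 - 1 / real p) * (\<Sum>m\<in>{1..z}. 1 / real m) \<le> (\<Sum>m\<in>coprime_upto P z. 1 / real m)"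
  using assms
proof (induction P rule: finite_induct)
  case empty
  have "coprime_upto {} z = {1..z}" by (auto simp: coprime_upto_def)
  then show ?case by simp
next
  case (insert p P)
  let ?S = "coprime_upto P z"
  have p: "prime p" "p > 1" using insert.prems prime_gt_1_nat[of p] by auto
  have finS: "finite ?S" by (simp add: coprime_upto_def)
  have "(\<Sum>m\<in>{m\<in>?S. p dvd m}. 1 / real m) = (\<Sum>m\<in>{m\<in>?S. p dvd m}. 1 / p * (1 / real (m div p)))"
    using p by (intro sum.cong refl) (auto elim!: dvdE)
  also have "\<dots> = 1 / p * (\<Sum>k\<in>(\<lambda>m. m div p) ` {m\<in>?S. p dvd m}. 1 / real k)"
    using p by (subst sum.reindex) (auto simp: inj_on_def sum_distrib_left elim!: dvdE)
  also have "\<dots> \<le> 1 / p * (\<Sum>k\<in>?S. 1 / real k)"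
  proof (intro mult_left_mono sum_mono2 finS)
    show "(\<lambda>m. m div p) ` {m\<in>?S. p dvd m} \<subseteq> ?S"
    proof (rule image_subsetI)
      fix m assume m: "m \<in> {m\<in>?S. p dvd m}"
      then obtain k where k: "m = p * k" by auto
      have "k dvd m" using k by simp
      moreover have "k > 0" using m k by (auto simp: coprime_upto_def)
      moreover have "k \<le> m" using k p by simp
      moreover have "m \<le> z" "\<forall>p\<in>P. \<not> p dvd m" using m by (auto simp: coprime_upto_def)
      moreover have "m div p = k" using k p by simp
      ultimately show "m div p \<in> ?S" by (auto simp: coprime_upto_def dest: dvd_trans)
    qed
  qed auto
  finally have le: "(\<Sum>m\<in>{m\<in>?S. p dvd m}. 1 / real m) \<le> 1 / p * (\<Sum>k\<in>?S. 1 / real k)" .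
  have "coprime_upto (insert p P) z = ?S - {m\<in>?S. p dvd m}" by (auto simp: coprime_upto_def)
  then have "(\<Sum>m\<in>coprime_upto (insert p P) z. 1 / real m) = (\<Sum>m\<in>?S. 1 / real m) - (\<Sum>m\<in>{m\<in>?S. p dvd m}. 1 / real m)"
    using finS by (simp add: sum_diff)
  also have "\<dots> \<ge> (1 - 1 / p) * (\<Sum>m\<in>?S. 1 / real m)" using le by (simp add: algebra_simps)
  finally have "(1 - 1 / p) * (\<Sum>m\<in>?S. 1 / real m) \<le> (\<Sum>m\<in>coprime_upto (insert p P) z. 1 / real m)" .
  moreover have "(1 - 1 / p) * ((\<Prod>p\<in>P. 1 - 1 / real p) * (\<Sum>m\<in>{1..z}. 1 / real m)) \<le> (1 - 1 / p) * (\<Sum>m\<in>?S. 1 / real m)"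
    using insert p by (intro mult_left_mono) auto
  ultimately show ?case using insert.hyps by (simp add: mult.assoc)
qed

text \<open>Squarefree numbers are encoded by their sets of prime factors, so that
  \<open>card T\<close> is the number of prime factors and multiplicative weights are products over
  T.\<close>

definition rough_prime_sets :: "nat \<Rightarrow> nat \<Rightarrow> nat set set" where
  "rough_prime_sets y z = {T. T \<subseteq> {p. prime p \<and> y < p \<and> p \<le> z} \<and> \<Prod>T \<le> z}"

lemma finite_rough_prime_sets: "finite (rough_prime_sets y z)"
  by (rule finite_subset[of _ "Pow {p. prime p \<and> p \<le> z}"])
     (auto simp: rough_prime_sets_def finite_primes_atMost)

lemma sum_inverse_squares_le_2: "(\<Sum>w\<in>{1..n}. 1 / (real w)\<^sup>2) \<le> 2"
proof (cases "n = 0")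
  case False
  then have "n \<ge> 1" by simp
  then have "(\<Sum>w\<in>{1..n}. 1 / (real w)\<^sup>2) \<le> 2 - 1 / real n"
  proof (induction n rule: nat_induct_at_least)
    case (Suc n)
    then have n: "real n \<ge> 1" by simp
    have "1 / (real n + 1)\<^sup>2 \<le> 1 / (real n * (real n + 1))"
      using n by (intro divide_left_mono) (auto simp: power2_eq_square)
    also have "\<dots> = 1 / real n - 1 / (real n + 1)" using n by (simp add: field_simps)
    finally show ?case using Suc.IH by (simp add: add.commute)
  qed simp
  moreover have "0 \<le> 1 / real n" by simp
  ultimately show ?thesis by linarith
qed simp

text \<open>Write m = s w^2 with s squarefree; the sum of 1 / w^2 over w costs the factor 2.\<close>

lemma sum_coprime_upto_le_rough_prime_sets:
  "(\<Sum>m\<in>coprime_upto {p. prime p \<and> p \<le> y} z. 1 / real m) \<le> 2 * (\<Sum>T\<in>rough_prime_sets y z. 1 / real (\<Prod>T))"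
proof -
  let ?S = "coprime_upto {p. prime p \<and> p \<le> y} z"
  define \<phi> where "\<phi> m = (prime_factors (squarefree_part m), square_part m)" for m :: nat
  define g where "g = (\<lambda>(T, w). 1 / real (\<Prod>T) * (1 / (real w)\<^sup>2))"
  have dec: "m = \<Prod>(prime_factors (squarefree_part m)) * (square_part m)\<^sup>2" "square_part m > 0" if "m \<in> ?S" for m
  proof -
    have m: "m > 0" using that by (auto simp: coprime_upto_def)
    then have sf0: "squarefree_part m > 0" using squarefree_decompose[of m] by (metis gr0I mult_0 less_irrefl)
    have "multiplicity p (squarefree_part m) = 1" if "p \<in> prime_factors (squarefree_part m)" for p
    proof -
      have "multiplicity p (squarefree_part m) \<le> 1"
        using squarefree_squarefree_part[of m] that sf0 squarefree_factorial_semiring''[of "squarefree_part m"] by auto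
      moreover have "multiplicity p (squarefree_part m) > 0" using that by (simp add: prime_factors_multiplicity)
      ultimately show ?thesis by simp
    qed
    then have "\<Prod>(prime_factors (squarefree_part m)) = squarefree_part m"
      using prod_prime_factors[of "squarefree_part m"] sf0 by simp
    then show "m = \<Prod>(prime_factors (squarefree_part m)) * (square_part m)\<^sup>2"
      using squarefree_decompose[of m] by simp
    show "square_part m > 0" using m by (metis gr0I square_part_0_iff less_irrefl)
  qed
  have inj: "inj_on \<phi> ?S"
    by (rule inj_onI) (metis dec(1) \<phi>_def prod.inject)
  have sub: "\<phi> ` ?S \<subseteq> rough_prime_sets y z \<times> {1..z}"
  proof (rule image_subsetI)
    fix m assume m: "m \<in> ?S"
    have m0: "m > 0" "m \<le> z" using m by (auto simp: coprime_upto_def)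
    let ?T = "prime_factors (squarefree_part m)"
    have dv: "\<Prod>?T dvd m" "square_part m dvd m" using dec[OF m] by (metis dvd_triv_left, metis dvd_mult power2_eq_square dvd_triv_left)
    have "?T \<subseteq> {p. prime p \<and> y < p \<and> p \<le> z}"
    proof
      fix p assume p: "p \<in> ?T"
      then have "p dvd \<Prod>?T" by (intro dvd_prodI) auto
      then have "p dvd m" using dv by (meson dvd_trans)
      moreover have "prime p" using p by auto
      ultimately show "p \<in> {p. prime p \<and> y < p \<and> p \<le> z}"
        using m m0 dvd_imp_le[of p m] by (auto simp: coprime_upto_def)
    qed
    moreover have "\<Prod>?T \<le> z" using dvd_imp_le[OF dv(1) m0(1)] m0 by simp
    moreover have "square_part m \<le> z" using dvd_imp_le[OF dv(2) m0(1)] m0 by simp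
    ultimately show "\<phi> m \<in> rough_prime_sets y z \<times> {1..z}"
      using dec(2)[OF m] by (simp add: \<phi>_def rough_prime_sets_def Suc_le_eq)
  qed
  have "(\<Sum>m\<in>?S. 1 / real m) = (\<Sum>m\<in>?S. g (\<phi> m))"
  proof (intro sum.cong refl)
    fix m assume m: "m \<in> ?S"
    have "real m = real (\<Prod>(prime_factors (squarefree_part m))) * (real (square_part m))\<^sup>2"
      using arg_cong[OF dec(1)[OF m], of real] by simp
    then show "1 / real m = g (\<phi> m)" by (simp add: g_def \<phi>_def)
  qed
  also have "\<dots> = (\<Sum>v\<in>\<phi> ` ?S. g v)" using inj by (simp add: sum.reindex)
  also have "\<dots> \<le> (\<Sum>v\<in>rough_prime_sets y z \<times> {1..z}. g v)"
    using sub finite_rough_prime_sets by (intro sum_mono2) (auto simp: g_def intro!: mult_nonneg_nonneg prod_nonneg)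
  also have "\<dots> = (\<Sum>T\<in>rough_prime_sets y z. 1 / real (\<Prod>T)) * (\<Sum>w\<in>{1..z}. 1 / (real w)\<^sup>2)"
    unfolding g_def by (simp only: sum.cartesian_product[symmetric] sum_product)
  also have "\<dots> \<le> (\<Sum>T\<in>rough_prime_sets y z. 1 / real (\<Prod>T)) * 2"
    using sum_inverse_squares_le_2 by (intro mult_left_mono sum_nonneg) (auto intro: prod_nonneg)
  finally show ?thesis by simp
qed

text \<open>The 4 bounds twice the sum of 1 / p^2, from ln (1 - x) >= -x - 2 x^2; the halving is the
  price of the square parts.\<close>

definition rough_const :: real where
  "rough_const = exp (- mertens_const - 4) / 2"

text \<open>Sieving out the primes up to y leaves at least the fraction
  \<open>\<Prod>p. 1 - 1 / p\<close> of the harmonic sum up to z, and Mertens' estimate bounds this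
  product below by a constant over ln y.\<close>

theorem rough_prime_sets_lower_bound:
  assumes "y \<ge> 2" "z \<ge> 1"
  shows "(\<Sum>T\<in>rough_prime_sets y z. 1 / real (\<Prod>T)) \<ge> rough_const * ln z / ln y"
proof -
  let ?P = "{p. prime p \<and> p \<le> y}"
  have p2: "real p \<ge> 2" if "p \<in> ?P" for p using that prime_ge_2_nat[of p] by simp
  have "exp (- (ln (ln y) + mertens_const) - 4) \<le> exp (\<Sum>p\<in>?P. - (1 / real p) - 2 * (1 / (real p)\<^sup>2))"
  proof -
    have "(\<Sum>p\<in>?P. 1 / real p) \<le> ln (ln y) + mertens_const" using assms by (intro sum_inverse_primes_le)
    moreover have "(\<Sum>p\<in>?P. 1 / (real p)\<^sup>2) \<le> (\<Sum>w\<in>{1..y}. 1 / (real w)\<^sup>2)"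
      by (intro sum_mono2) (auto dest: prime_ge_1_nat)
    then have "(\<Sum>p\<in>?P. 1 / (real p)\<^sup>2) \<le> 2" using sum_inverse_squares_le_2[of y] by linarith
    moreover have "(\<Sum>p\<in>?P. - (1 / real p) - 2 * (1 / (real p)\<^sup>2)) = - (\<Sum>p\<in>?P. 1 / real p) - 2 * (\<Sum>p\<in>?P. 1 / (real p)\<^sup>2)"
      by (simp only: sum_subtractf sum_negf sum_distrib_left)
    ultimately show ?thesis unfolding exp_le_cancel_iff by linarith
  qed
  also have "\<dots> = (\<Prod>p\<in>?P. exp (- (1 / real p) - 2 * (1 / (real p)\<^sup>2)))"
    by (rule exp_sum) (rule finite_primes_atMost)
  also have "\<dots> \<le> (\<Prod>p\<in>?P. 1 - 1 / real p)"
  proof (intro prod_mono conjI)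
    fix p assume p: "p \<in> ?P"
    have "- (1 / real p) - 2 * (1 / real p)\<^sup>2 \<le> ln (1 - 1 / real p)"
      using p2[OF p] by (intro ln_one_minus_pos_lower_bound) (auto simp: field_simps)
    then have "exp (- (1 / real p) - 2 * (1 / real p)\<^sup>2) \<le> exp (ln (1 - 1 / real p))" by simp
    also have "\<dots> = 1 - 1 / real p" using p2[OF p] by (intro exp_ln) (simp add: field_simps)
    finally show "exp (- (1 / real p) - 2 * (1 / (real p)\<^sup>2)) \<le> 1 - 1 / real p" by (simp add: power_divide)
  qed simp
  finally have 1: "exp (- (ln (ln y) + mertens_const) - 4) \<le> (\<Prod>p\<in>?P. 1 - 1 / real p)" .
  have "ln (real z) \<le> ln (real z + 1)" using assms by simp
  also have "\<dots> \<le> harm z" by (rule ln_le_harm)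
  also have "harm z = (\<Sum>m\<in>{1..z}. 1 / real m)" by (simp add: harm_def divide_inverse)
  finally have 2: "ln (real z) \<le> (\<Sum>m\<in>{1..z}. 1 / real m)" .
  have "exp (- (ln (ln y) + mertens_const) - 4) * ln z \<le> (\<Prod>p\<in>?P. 1 - 1 / real p) * (\<Sum>m\<in>{1..z}. 1 / real m)"
    using 1 2 assms by (intro mult_mono) (auto intro!: prod_nonneg dest!: prime_ge_1_nat)
  also have "\<dots> \<le> (\<Sum>m\<in>coprime_upto ?P z. 1 / real m)"
    by (rule sum_inverse_coprime_upto) (auto simp: finite_primes_atMost)
  also have "\<dots> \<le> 2 * (\<Sum>T\<in>rough_prime_sets y z. 1 / real (\<Prod>T))"
    by (rule sum_coprime_upto_le_rough_prime_sets)
  also have "exp (- (ln (ln y) + mertens_const) - 4) = exp (- mertens_const - 4) * exp (- ln (ln y))"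
    by (simp add: exp_add[symmetric])
  also have "exp (- ln (ln (real y))) = 1 / ln y" using assms by (simp add: exp_minus field_simps)
  finally show ?thesis by (simp add: rough_const_def)
qed

lemma sum_Pow_prod:
  fixes f :: "'a \<Rightarrow> real"
  assumes "finite A" shows "(\<Sum>T\<in>Pow A. \<Prod>x\<in>T. f x) = (\<Prod>x\<in>A. 1 + f x)"
  using assms
proof (induction A rule: finite_induct)
  case (insert a A)
  have "(\<Sum>T\<in>Pow (insert a A). \<Prod>x\<in>T. f x) = (\<Sum>T\<in>Pow A. \<Prod>x\<in>T. f x) + (\<Sum>T\<in>insert a ` Pow A. \<Prod>x\<in>T. f x)"
    unfolding Pow_insert using insert.hyps by (intro sum.union_disjoint) auto
  also have "(\<Sum>T\<in>insert a ` Pow A. \<Prod>x\<in>T. f x) = (\<Sum>T\<in>Pow A. \<Prod>x\<in>insert a T. f x)"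
    using insert.hyps by (subst sum.reindex) (auto simp: inj_on_def)
  also have "\<dots> = (\<Sum>T\<in>Pow A. f a * (\<Prod>x\<in>T. f x))"
    using insert.hyps by (intro sum.cong refl prod.insert) (auto intro: finite_subset)
  finally show ?case using insert by (simp add: sum_distrib_left[symmetric] algebra_simps)
qed simp

text \<open>Rankin's trick: extended to all sets of primes up to z, the sum becomes an Euler
  product. With c < 1 it serves against sets with too few primes, with c > 1 against those with too
  many.\<close>

lemma rough_prime_sets_rankin:
  fixes c :: real
  assumes "c \<ge> 0" "z \<ge> 2"
  shows "(\<Sum>T\<in>rough_prime_sets y z. c ^ card T / real (\<Prod>T)) \<le> exp (c * (ln (ln z) + mertens_const))"
proof -
  let ?P = "{p. prime p \<and> p \<le> z}"
  have "(\<Sum>T\<in>rough_prime_sets y z. c ^ card T / real (\<Prod>T)) \<le> (\<Sum>T\<in>Pow ?P. c ^ card T / real (\<Prod>T))"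
  proof (intro sum_mono2)
    show "0 \<le> c ^ card T / real (\<Prod>T)" for T using assms by (intro divide_nonneg_nonneg of_nat_0_le_iff) auto
  qed (auto simp: finite_primes_atMost rough_prime_sets_def)
  also have "\<dots> = (\<Sum>T\<in>Pow ?P. \<Prod>p\<in>T. c / real p)"
    by (intro sum.cong refl) (simp add: prod_dividef)
  also have "\<dots> = (\<Prod>p\<in>?P. 1 + c / real p)" by (rule sum_Pow_prod[OF finite_primes_atMost])
  also have "\<dots> \<le> (\<Prod>p\<in>?P. exp (c / real p))"
    using assms by (intro prod_mono) (auto intro: exp_ge_add_one_self)
  also have "\<dots> = exp (c * (\<Sum>p\<in>?P. 1 / real p))"
    by (simp add: exp_sum[OF finite_primes_atMost] sum_distrib_left)
  also have "\<dots> \<le> exp (c * (ln (ln z) + mertens_const))"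
    using assms sum_inverse_primes_le[of z] by (simp add: mult_left_mono)
  finally show ?thesis .
qed

section \<open>Patterns of quadratic residues\<close>

lemma Legendre_mult:
  assumes "prime p" "p > 2"
  shows "Legendre (a * b) (int p) = Legendre a (int p) * Legendre b (int p)"
proof -
  have "[Legendre (a * b) (int p) = (a * b) ^ ((p - 1) div 2)] (mod int p)" by (rule euler_criterion[OF assms])
  moreover have "[Legendre a (int p) * Legendre b (int p) = a ^ ((p - 1) div 2) * b ^ ((p - 1) div 2)] (mod int p)"
    by (intro cong_mult euler_criterion[OF assms])
  ultimately have "[Legendre (a * b) (int p) = Legendre a (int p) * Legendre b (int p)] (mod int p)"
    by (metis cong_sym cong_trans power_mult_distrib)
  then have "int p dvd Legendre (a * b) (int p) - Legendre a (int p) * Legendre b (int p)"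
    by (simp add: cong_iff_dvd_diff)
  moreover have "\<bar>Legendre (a * b) (int p) - Legendre a (int p) * Legendre b (int p)\<bar> < int p"
    using Legendre_values[of "a * b" "int p"] Legendre_values[of a "int p"] Legendre_values[of b "int p"] assms by auto
  ultimately show ?thesis
    using dvd_imp_le_int[of "Legendre (a * b) (int p) - Legendre a (int p) * Legendre b (int p)" "int p"] by auto
qed

lemma Legendre_prod:
  assumes "prime p" "p > 2" "finite S"
  shows "(\<Prod>h\<in>S. Legendre (f h) (int p)) = Legendre (\<Prod>h\<in>S. f h) (int p)"
  using assms(3)
proof (induction S rule: finite_induct)
  case empty
  have "\<not> [1 = (0::int)] (mod int p)" using assms by (auto simp: cong_def)
  moreover have "QuadRes (int p) 1" unfolding QuadRes_def by (intro exI[of _ 1]) simp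
  ultimately show ?case by (simp add: Legendre_def)
qed (simp add: Legendre_mult[OF assms(1,2)])

lemma QuadRes_cong: "[a = b] (mod m) \<Longrightarrow> QuadRes m a \<longleftrightarrow> QuadRes m b"
  unfolding QuadRes_def by (meson cong_sym cong_trans)

lemma QuadRes_iff_Legendre: "QuadRes p a \<longleftrightarrow> Legendre a p \<in> {0, 1}"
proof -
  have "QuadRes p a" if "[a = 0] (mod p)"
    unfolding QuadRes_def using that by (intro exI[of _ 0]) (simp add: cong_sym)
  then show ?thesis by (auto simp: Legendre_def)
qed

text \<open>Off the zeros of \<open>b (x + h)\<close> the indicator of the event is \<open>\<Prod>\<^sub>h (1 + chi (b (x + h))) / 2\<close>.\<close>

lemma card_QuadRes_pattern:
  assumes p: "prime p" "p > 2" and b: "\<not> int p dvd b" and H: "finite H"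
    and dist: "\<And>x y. x \<in> H \<Longrightarrow> y \<in> H \<Longrightarrow> x \<noteq> y \<Longrightarrow> \<not> int p dvd x - y"
  shows "\<bar>real (card {x\<in>{0..<int p}. \<forall>h\<in>H. QuadRes (int p) (b * (x + h))}) - p / 2 ^ card H\<bar>
         \<le> 22 * card H * sqrt p"
proof -
  define chi where "chi a = Legendre a (int p)" for a
  define k where "k = card H"
  define ind where "ind x = (if \<forall>h\<in>H. QuadRes (int p) (b * (x + h)) then 1 else 0 :: real)" for x
  define G where "G x = (\<Prod>h\<in>H. (1 + real_of_int (chi (b * (x + h)))) / 2)" for x
  define Zs where "Zs = {x\<in>{0..<int p}. \<exists>h\<in>H. int p dvd x + h}"
  have odd: "odd p" using p by (metis prime_odd_nat)
  have sp1: "sqrt p \<ge> 1" using p by simp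
  have val: "chi a \<in> {-1, 0, 1}" for a unfolding chi_def by (rule Legendre_values)
  have cardZ: "card Zs \<le> k"
  proof -
    have "Zs \<subseteq> (\<lambda>h. (-h) mod int p) ` H"
    proof
      fix x assume "x \<in> Zs"
      then obtain h where h: "h \<in> H" "int p dvd x - (-h)" "x \<in> {0..<int p}" by (auto simp: Zs_def)
      then have "x mod int p = (-h) mod int p" by (simp only: mod_eq_dvd_iff)
      then show "x \<in> (\<lambda>h. (-h) mod int p) ` H" using h by auto
    qed
    then have "card Zs \<le> card ((\<lambda>h. (-h) mod int p) ` H)" using H by (intro card_mono) auto
    also have "\<dots> \<le> k" unfolding k_def by (rule card_image_le[OF H])
    finally show ?thesis .
  qed
  have eqG: "ind x = G x" if "x \<in> {0..<int p} - Zs" for x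
  proof -
    have nz: "chi (b * (x + h)) \<in> {-1, 1}" if "h \<in> H" for h
    proof -
      have "\<not> int p dvd b * (x + h)"
        using b p \<open>h \<in> H\<close> \<open>x \<in> {0..<int p} - Zs\<close> by (auto simp: Zs_def prime_dvd_mult_iff)
      then show ?thesis by (simp add: chi_def Legendre_def cong_0_iff)
    qed
    show ?thesis
    proof (cases "\<forall>h\<in>H. QuadRes (int p) (b * (x + h))")
      case True
      then have "chi (b * (x + h)) = 1" if "h \<in> H" for h
        using that nz[OF that] by (auto simp: QuadRes_iff_Legendre chi_def)
      then show ?thesis using True by (simp add: ind_def G_def)
    next
      case False
      then obtain h where h: "h \<in> H" "\<not> QuadRes (int p) (b * (x + h))" by blast
      then have "chi (b * (x + h)) = -1" using nz[OF h(1)] by (auto simp: QuadRes_iff_Legendre chi_def)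
      then have "G x = 0" unfolding G_def using h H by (intro prod_zero bexI[of _ h]) auto
      then show ?thesis unfolding ind_def using False by (simp only: if_False)
    qed
  qed
  have G01: "0 \<le> G x" "G x \<le> 1" for x
  proof -
    have "0 \<le> (1 + real_of_int (chi a)) / 2" "(1 + real_of_int (chi a)) / 2 \<le> 1" for a
      using val[of a] by auto
    then show "0 \<le> G x" "G x \<le> 1" unfolding G_def by (auto intro!: prod_nonneg prod_le_1)
  qed
  have "\<bar>(\<Sum>x\<in>{0..<int p}. ind x) - (\<Sum>x\<in>{0..<int p}. G x)\<bar> = \<bar>\<Sum>x\<in>{0..<int p}. ind x - G x\<bar>"
    by (simp add: sum_subtractf)
  also have "(\<Sum>x\<in>{0..<int p}. ind x - G x) = (\<Sum>x\<in>Zs. ind x - G x)"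
    using eqG by (intro sum.mono_neutral_right) (auto simp: Zs_def)
  also have "\<bar>\<dots>\<bar> \<le> (\<Sum>x\<in>Zs. 1)"
  proof (rule order_trans[OF sum_abs sum_mono])
    show "\<bar>ind x - G x\<bar> \<le> 1" for x using G01[of x] by (auto simp: ind_def)
  qed
  also have "\<dots> \<le> k" using cardZ by simp
  finally have d1: "\<bar>(\<Sum>x\<in>{0..<int p}. ind x) - (\<Sum>x\<in>{0..<int p}. G x)\<bar> \<le> k" .
  define W where "W S = real_of_int (\<Sum>x\<in>{0..<int p}. chi (\<Prod>h\<in>S. h + x))" for S
  have Gexp: "G x = (\<Sum>S\<in>Pow H. real_of_int (chi b) ^ card S * real_of_int (chi (\<Prod>h\<in>S. h + x))) / 2 ^ k" for x
  proof -
    have "G x = (\<Prod>h\<in>H. 1 + real_of_int (chi (b * (x + h)))) / 2 ^ k"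
      by (simp add: G_def prod_dividef k_def)
    also have "(\<Prod>h\<in>H. 1 + real_of_int (chi (b * (x + h)))) = (\<Sum>S\<in>Pow H. \<Prod>h\<in>S. real_of_int (chi (b * (x + h))))"
      using H by (rule sum_Pow_prod[symmetric])
    also have "\<dots> = (\<Sum>S\<in>Pow H. real_of_int (chi b) ^ card S * real_of_int (chi (\<Prod>h\<in>S. h + x)))"
    proof (intro sum.cong refl)
      fix S assume "S \<in> Pow H"
      then have fS: "finite S" using H finite_subset by auto
      have "(\<Prod>h\<in>S. chi (b * (x + h))) = (\<Prod>h\<in>S. chi b * chi (h + x))"
        by (simp add: chi_def Legendre_mult[OF p] add.commute)
      also have "\<dots> = chi b ^ card S * chi (\<Prod>h\<in>S. h + x)"
        by (simp add: prod.distrib chi_def Legendre_prod[OF p fS])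
      finally show "(\<Prod>h\<in>S. real_of_int (chi (b * (x + h)))) = real_of_int (chi b) ^ card S * real_of_int (chi (\<Prod>h\<in>S. h + x))"
        by (metis of_int_mult of_int_power of_int_prod)
    qed
    finally show ?thesis .
  qed
  have "(\<Sum>x\<in>{0..<int p}. G x) = (\<Sum>S\<in>Pow H. real_of_int (chi b) ^ card S * W S) / 2 ^ k"
    unfolding Gexp W_def sum_divide_distrib[symmetric]
    by (subst sum.swap) (simp add: sum_distrib_left)
  \<comment> \<open>The empty set yields the main term \<open>p / 2 ^ k\<close>. Fewer than 2^k sets
    remain, so the denominator cancels their number and the bound 21 k sqrt p for one of them bounds
    the whole; the zeros add k and turn 21 into 22.\<close>
  also have "Pow H = insert {} (Pow H - {{}})" by auto
  also have "(\<Sum>S\<in>insert {} (Pow H - {{}}). real_of_int (chi b) ^ card S * W S) = W {} + (\<Sum>S\<in>Pow H - {{}}. real_of_int (chi b) ^ card S * W S)"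
    using H by (subst sum.insert) auto
  also have "W {} = p"
    using Legendre_prod[OF p, of "{}" "\<lambda>h. h"] by (simp add: W_def chi_def)
  finally have Gs: "(\<Sum>x\<in>{0..<int p}. G x) - p / 2 ^ k = (\<Sum>S\<in>Pow H - {{}}. real_of_int (chi b) ^ card S * W S) / 2 ^ k"
    by (simp add: add_divide_distrib)
  have "\<bar>\<Sum>S\<in>Pow H - {{}}. real_of_int (chi b) ^ card S * W S\<bar> \<le> (\<Sum>S\<in>Pow H - {{}}. 21 * k * sqrt p)"
  proof (rule order_trans[OF sum_abs sum_mono])
    fix S assume S: "S \<in> Pow H - {{}}"
    then have fS: "finite S" "card S \<le> k" using H finite_subset card_mono by (auto simp: k_def)
    have "\<bar>real_of_int (chi b)\<bar> \<le> 1" using val[of b] by auto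
    then have "\<bar>real_of_int (chi b) ^ card S * W S\<bar> \<le> 1 * \<bar>W S\<bar>"
      unfolding abs_mult power_abs by (intro mult_right_mono power_le_one) auto
    also have "\<bar>W S\<bar> \<le> 21 * card S * sqrt p"
      unfolding W_def chi_def using S dist by (intro Legendre_shifted_prod_sum_bound p odd fS) auto
    also have "\<dots> \<le> 21 * k * sqrt p" using fS by (intro mult_right_mono) auto
    finally show "\<bar>real_of_int (chi b) ^ card S * W S\<bar> \<le> 21 * k * sqrt p" by simp
  qed
  also have "\<dots> = card (Pow H - {{}}) * (21 * k * sqrt p)" by simp
  also have "\<dots> \<le> 2 ^ k * (21 * k * sqrt p)"
  proof (rule mult_right_mono)
    have "card (Pow H - {{}}) \<le> card (Pow H)" using H by (intro card_mono) auto
    then show "real (card (Pow H - {{}})) \<le> 2 ^ k" using H by (simp add: card_Pow k_def)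
  qed simp
  finally have "\<bar>(\<Sum>x\<in>{0..<int p}. G x) - p / 2 ^ k\<bar> \<le> 21 * k * sqrt p"
    unfolding Gs by (simp add: abs_divide divide_le_eq mult.commute)
  moreover have "(\<Sum>x\<in>{0..<int p}. ind x) = card {x\<in>{0..<int p}. \<forall>h\<in>H. QuadRes (int p) (b * (x + h))}"
    unfolding ind_def by (subst sum.inter_filter[symmetric]) auto
  moreover have "real k * 1 \<le> k * sqrt p" using sp1 by (intro mult_left_mono) auto
  moreover have "21 * real k * sqrt p = 21 * (real k * sqrt p)" "22 * real k * sqrt p = 22 * (real k * sqrt p)" by simp_all
  ultimately show ?thesis using d1 unfolding k_def[symmetric] abs_le_iff by linarith
qed

section \<open>Squares and counts under the Chinese remainder theorem\<close>

lemma QuadRes_mult_coprime: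
  assumes "coprime m n"
  shows "QuadRes (m * n) a \<longleftrightarrow> QuadRes m a \<and> QuadRes n a"
proof
  assume "QuadRes (m * n) a"
  then show "QuadRes m a \<and> QuadRes n a" unfolding QuadRes_def
    by (metis cong_modulus_mult mult.commute)
next
  assume "QuadRes m a \<and> QuadRes n a"
  then obtain x y where xy: "[x^2 = a] (mod m)" "[y^2 = a] (mod n)" by (auto simp: QuadRes_def)
  obtain z where z: "[z = x] (mod m)" "[z = y] (mod n)"
    using binary_chinese_remainder_int[OF assms, of x y] by blast
  have "[z^2 = a] (mod m)" "[z^2 = a] (mod n)"
    using z xy by (meson cong_pow cong_trans)+
  then have "[z^2 = a] (mod m * n)" using assms by (intro coprime_cong_mult)
  then show "QuadRes (m * n) a" by (auto simp: QuadRes_def)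
qed

lemma QuadRes_mult_prod:
  assumes "finite T" "\<And>p. p \<in> T \<Longrightarrow> prime (p::nat)" "\<And>p. p \<in> T \<Longrightarrow> coprime p q"
  shows "QuadRes (int (q * \<Prod>T)) a \<longleftrightarrow> QuadRes (int q) a \<and> (\<forall>p\<in>T. QuadRes (int p) a)"
  using assms
proof (induction T rule: finite_induct)
  case (insert p T)
  have "coprime p (q * \<Prod>T)"
    using insert.prems insert.hyps by (auto intro!: prod_coprime_right primes_coprime)
  then have c: "coprime (int p) (int (q * \<Prod>T))" by (simp only: coprime_int_iff)
  have e: "int (q * \<Prod>(insert p T)) = int p * int (q * \<Prod>T)" using insert.hyps by simp
  have IH: "QuadRes (int (q * \<Prod>T)) a \<longleftrightarrow> QuadRes (int q) a \<and> (\<forall>p\<in>T. QuadRes (int p) a)"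
    by (rule insert.IH) (use insert.prems in auto)
  show ?case unfolding e QuadRes_mult_coprime[OF c] IH by auto
qed simp

lemma card_crt:
  assumes mn: "coprime m n" "m > 0" "n > (0::int)"
    and P: "\<And>x. P (x mod m) = P x" and Q: "\<And>x. Q (x mod n) = Q x"
  shows "card {x\<in>{0..<m * n}. P x \<and> Q x} = card {x\<in>{0..<m}. P x} * card {x\<in>{0..<n}. Q x}"
proof -
  have "bij_betw (\<lambda>x. (x mod m, x mod n)) {x\<in>{0..<m * n}. P x \<and> Q x} ({x\<in>{0..<m}. P x} \<times> {x\<in>{0..<n}. Q x})"
  proof (rule bij_betwI')
    fix x y assume xy: "x \<in> {x\<in>{0..<m * n}. P x \<and> Q x}" "y \<in> {x\<in>{0..<m * n}. P x \<and> Q x}"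
    show "((x mod m, x mod n) = (y mod m, y mod n)) = (x = y)"
    proof
      assume "(x mod m, x mod n) = (y mod m, y mod n)"
      then have "[x = y] (mod m * n)" using mn(1) by (intro coprime_cong_mult) (auto simp: cong_def)
      then show "x = y" using xy by (simp add: cong_def)
    qed auto
  next
    fix x assume "x \<in> {x\<in>{0..<m * n}. P x \<and> Q x}"
    then show "(x mod m, x mod n) \<in> {x\<in>{0..<m}. P x} \<times> {x\<in>{0..<n}. Q x}" using mn P Q by auto
  next
    fix v assume v: "v \<in> {x\<in>{0..<m}. P x} \<times> {x\<in>{0..<n}. Q x}"
    obtain z where z: "[z = fst v] (mod m)" "[z = snd v] (mod n)"
      using binary_chinese_remainder_int[OF mn(1)] by blast
    define x where "x = z mod (m * n)"
    have "x mod m = fst v" "x mod n = snd v"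
      using z v by (auto simp: x_def cong_def mod_mod_cancel)
    moreover have "0 \<le> x" "x < m * n" using mn by (simp_all add: x_def)
    moreover have "P x" "Q x" using calculation(1,2) v P[of x] Q[of x] by auto
    ultimately show "\<exists>x\<in>{x\<in>{0..<m * n}. P x \<and> Q x}. v = (x mod m, x mod n)"
      by (intro bexI[of _ x]) auto
  qed
  from bij_betw_same_card[OF this] show ?thesis by (simp only: card_cartesian_product)
qed

lemma card_crt_prod:
  assumes "finite T" "\<And>p. p \<in> T \<Longrightarrow> prime (p::nat)" "\<And>p. p \<in> T \<Longrightarrow> coprime p q" "q > 0"
    and P0: "\<And>x. P0 (x mod int q) = P0 x"
    and P: "\<And>p x. p \<in> T \<Longrightarrow> P p (x mod int p) = P p x"
  shows "card {x\<in>{0..<int (q * \<Prod>T)}. P0 x \<and> (\<forall>p\<in>T. P p x)} = card {x\<in>{0..<int q}. P0 x} * (\<Prod>p\<in>T. card {x\<in>{0..<int p}. P p x})"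
  using assms(1-3) P
proof (induction T rule: finite_induct)
  case (insert p T)
  have cop: "coprime p (q * \<Prod>T)"
    using insert.prems insert.hyps by (auto intro!: prod_coprime_right primes_coprime)
  then have c: "coprime (int (q * \<Prod>T)) (int p)" by (simp only: coprime_int_iff coprime_commute)
  have "q * \<Prod>T > 0" "p > 0"
    using assms(4) insert.prems(1) by (simp_all add: prime_gt_0_nat prod_pos)
  then have pos: "int (q * \<Prod>T) > 0" "int p > 0" by (simp_all only: of_nat_0_less_iff)
  have per: "(P0 (x mod int (q * \<Prod>T)) \<and> (\<forall>p\<in>T. P p (x mod int (q * \<Prod>T)))) = (P0 x \<and> (\<forall>p\<in>T. P p x))" for x
  proof -
    have "P0 (x mod int (q * \<Prod>T)) = P0 x"
      using P0[of "x mod int (q * \<Prod>T)"] P0[of x] by (simp add: mod_mod_cancel)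
    moreover have "P p' (x mod int (q * \<Prod>T)) = P p' x" if "p' \<in> T" for p'
    proof -
      have "p' dvd q * \<Prod>T" using that insert.hyps by (intro dvd_mult dvd_prodI) auto
      then have "int p' dvd int (q * \<Prod>T)" by (simp only: int_dvd_int_iff)
      then have "x mod int (q * \<Prod>T) mod int p' = x mod int p'" by (rule mod_mod_cancel)
      then show ?thesis using insert.prems(3)[of p'] that by (metis insertCI)
    qed
    ultimately show ?thesis by auto
  qed
  have e: "int (q * \<Prod>(insert p T)) = int (q * \<Prod>T) * int p" using insert.hyps by simp
  have "card {x\<in>{0..<int (q * \<Prod>(insert p T))}. P0 x \<and> (\<forall>p\<in>insert p T. P p x)}
      = card {x\<in>{0..<int (q * \<Prod>T) * int p}. (P0 x \<and> (\<forall>p\<in>T. P p x)) \<and> P p x}"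
    unfolding e by (intro arg_cong[of _ _ card]) auto
  also have "\<dots> = card {x\<in>{0..<int (q * \<Prod>T)}. P0 x \<and> (\<forall>p\<in>T. P p x)} * card {x\<in>{0..<int p}. P p x}"
    using insert.prems(3) by (intro card_crt c pos per) auto
  finally show ?case using insert by simp
qed simp

section \<open>Empty windows: the Bonferroni estimate\<close>

lemma prod_near_one:
  fixes a :: "'a \<Rightarrow> real"
  assumes "finite T" "\<And>i. i \<in> T \<Longrightarrow> \<bar>a i - 1\<bar> \<le> \<eta>" "\<eta> \<ge> 0"
  shows "\<bar>(\<Prod>i\<in>T. a i) - 1\<bar> \<le> (1 + \<eta>) ^ card T - 1"
  using assms(1,2)
proof (induction T rule: finite_induct)
  case (insert i T)
  define X where "X = (\<Prod>i\<in>T. a i)"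
  have IH: "\<bar>X - 1\<bar> \<le> (1 + \<eta>) ^ card T - 1" using insert by (simp add: X_def)
  have ai: "\<bar>a i - 1\<bar> \<le> \<eta>" using insert.prems by simp
  have "\<bar>a i * X - 1\<bar> = \<bar>(a i - 1) * X + (X - 1)\<bar>" by (simp add: algebra_simps)
  also have "\<dots> \<le> \<bar>a i - 1\<bar> * \<bar>X\<bar> + \<bar>X - 1\<bar>" by (metis abs_mult abs_triangle_ineq)
  also have "\<dots> \<le> \<eta> * (1 + \<eta>) ^ card T + ((1 + \<eta>) ^ card T - 1)"
    using ai IH assms(3) by (intro add_mono mult_mono) auto
  also have "\<dots> = (1 + \<eta>) ^ card (insert i T) - 1" using insert.hyps by (simp add: algebra_simps)
  finally show ?case using insert.hyps by (simp add: X_def)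
qed simp

lemma alternating_binomial_sum:
  "(\<Sum>k\<le>K. (-1) ^ k * int (Suc n choose k)) = (-1) ^ K * int (n choose K)"
  by (induction K) (simp_all add: algebra_simps)

text \<open>For nonempty X the truncated alternating sum of binomial coefficients collapses to
  (-1)^K times one binomial coefficient, which is nonnegative for even K.\<close>

lemma bonferroni_even:
  assumes "finite X" "even K"
  shows "(if X = {} then 1 else 0) \<le> (\<Sum>H\<in>{H\<in>Pow X. card H \<le> K}. (-1) ^ card H :: real)"
proof -
  have "(\<Sum>H\<in>{H\<in>Pow X. card H \<le> K}. (-1) ^ card H :: int) =
      (\<Sum>k\<in>{..K}. \<Sum>H\<in>{H\<in>{H\<in>Pow X. card H \<le> K}. card H = k}. (-1) ^ card H)"
    using assms(1) by (intro sum.group[symmetric]) auto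
  also have "\<dots> = (\<Sum>k\<le>K. (-1) ^ k * int (card X choose k))"
  proof (intro sum.cong refl)
    fix k assume k: "k \<in> {..K}"
    have "{H\<in>{H\<in>Pow X. card H \<le> K}. card H = k} = {H. H \<subseteq> X \<and> card H = k}" using k by auto
    then have "card {H\<in>{H\<in>Pow X. card H \<le> K}. card H = k} = card X choose k"
      using n_subsets[OF assms(1)] by simp
    then show "(\<Sum>H\<in>{H\<in>{H\<in>Pow X. card H \<le> K}. card H = k}. (-1) ^ card H) = (-1) ^ k * int (card X choose k)"
      by simp
  qed
  also have "\<dots> \<ge> (if X = {} then 1 else 0)"
  proof (cases "X = {}")
    case True
    have "(\<Sum>k\<le>K. (-1) ^ k * int (0 choose k)) = (\<Sum>k\<in>{0}. (-1) ^ k * int (0 choose k))"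
      by (intro sum.mono_neutral_right) auto
    then show ?thesis using True by simp
  next
    case False
    then obtain n where "card X = Suc n" using assms(1) by (metis card_0_eq not0_implies_Suc)
    then show ?thesis using False alternating_binomial_sum[where n = n] assms(2) by simp
  qed
  finally have "(if X = {} then 1 else 0) \<le> (\<Sum>H\<in>{H\<in>Pow X. card H \<le> K}. (-1) ^ card H :: int)" .
  then have "real_of_int (if X = {} then 1 else 0) \<le> real_of_int (\<Sum>H\<in>{H\<in>Pow X. card H \<le> K}. (-1) ^ card H)"
    by (simp only: of_int_le_iff)
  then show ?thesis by (simp split: if_splits)
qed

text \<open>T is the set of prime factors of t. The bound y serves twice: it makes the character sum
  errors small, and window lengths up to y keep distinct shifts distinct modulo every p in
  T.\<close>

locale residue_setting =
  fixes q y :: nat and T :: "nat set"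
  assumes q0: "q > 0" and finT: "finite T" and y0: "y > 0"
    and T: "\<And>p. p \<in> T \<Longrightarrow> prime p \<and> p > 2 \<and> coprime p q \<and> y < p"
begin

definition M :: nat where "M = q * \<Prod>T"

definition \<alpha> :: real where "\<alpha> = 1 / 2 ^ card T"

text \<open>Each prime contributes a factor within \<open>22 * K * 2 ^ K / sqrt y\<close> of 1: the
  error 22 K sqrt p of \<open>card_QuadRes_pattern\<close> relative to the main term p /
  2^K.\<close>

definition pattern_error :: "nat \<Rightarrow> real" where
  "pattern_error K = (1 + 22 * K * 2 ^ K / sqrt y) ^ card T - 1"

lemma \<alpha>_bounds: "0 < \<alpha>" "\<alpha> \<le> 1"
  by (simp_all add: \<alpha>_def)

lemma pattern_error_nonneg: "0 \<le> pattern_error K"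
  by (simp add: pattern_error_def one_le_power)

lemma prodT_pos: "\<Prod>T > 0"
  using T by (intro prod_pos) (auto simp: prime_gt_0_nat)

lemma M_pos: "M > 0"
  using q0 prodT_pos by (simp add: M_def)

text \<open>The factor b is there for the dilated residue sets of the large sieve argument. The
  class modulo q is fixed, since only the primes of T behave randomly.\<close>

definition pattern_set :: "int \<Rightarrow> int \<Rightarrow> int set \<Rightarrow> int set" where
  "pattern_set b u H = {x\<in>{0..<int M}. x mod int q = u \<and> (\<forall>p\<in>T. \<forall>h\<in>H. QuadRes (int p) (b * (x + h)))}"

lemma card_pattern_set:
  assumes b: "coprime b (int M)" and u: "u \<in> {0..<int q}" and H: "H \<subseteq> {1..int L}" "card H \<le> K" and L: "L \<le> y"
  shows "\<bar>real (card (pattern_set b u H)) - \<Prod>T * \<alpha> ^ card H\<bar> \<le> \<Prod>T * \<alpha> ^ card H * pattern_error K"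
proof -
  define N where "N p = card {x\<in>{0..<int p}. \<forall>h\<in>H. QuadRes (int p) (b * (x + h))}" for p :: nat
  define k where "k = card H"
  define \<eta> where "\<eta> = 22 * real K * 2 ^ K / sqrt y"
  have finH: "finite H" using H finite_subset by blast
  have "card {x\<in>{0..<int (q * \<Prod>T)}. x mod int q = u \<and> (\<forall>p\<in>T. \<forall>h\<in>H. QuadRes (int p) (b * (x + h)))} =
      card {x\<in>{0..<int q}. x mod int q = u} * (\<Prod>p\<in>T. N p)"
    unfolding N_def
  proof (rule card_crt_prod[OF finT _ _ q0])
    fix p x assume p: "p \<in> T"
    have "QuadRes (int p) (b * (x mod int p + h)) = QuadRes (int p) (b * (x + h))" for h
      by (intro QuadRes_cong cong_mult cong_add cong_refl) (simp add: cong_def)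
    then show "(\<forall>h\<in>H. QuadRes (int p) (b * (x mod int p + h))) = (\<forall>h\<in>H. QuadRes (int p) (b * (x + h)))" by simp
  qed (use T in auto)
  also have "{x\<in>{0..<int q}. x mod int q = u} = {u}" using u by auto
  finally have c: "card (pattern_set b u H) = (\<Prod>p\<in>T. N p)" by (simp add: pattern_set_def M_def)
  have near: "\<bar>real (N p) * 2 ^ k / p - 1\<bar> \<le> \<eta>" if p: "p \<in> T" for p
  proof -
    have pp: "prime p" "p > 2" "y < p" using T[OF p] by auto
    have "p dvd M" unfolding M_def using p finT by (intro dvd_mult dvd_prodI) auto
    then have "int p dvd int M" by (simp only: int_dvd_int_iff)
    then have "\<not> int p dvd b"
      using b pp(1) by (metis coprime_common_divisor not_prime_unit prime_nat_int_transfer)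
    moreover have "\<not> int p dvd x - z" if xz: "x \<in> H" "z \<in> H" "x \<noteq> z" for x z
    proof
      assume "int p dvd x - z"
      moreover have "\<bar>x - z\<bar> < int p"
      proof -
        have "x \<in> {1..int L}" "z \<in> {1..int L}" using xz H by auto
        then show ?thesis using L pp(3) by auto
      qed
      ultimately show False using xz(3) dvd_imp_le_int[of "x - z" "int p"] by auto
    qed
    ultimately have "\<bar>real (N p) - p / 2 ^ k\<bar> \<le> 22 * k * sqrt p"
      unfolding N_def k_def using card_QuadRes_pattern[OF pp(1,2) _ finH] by blast
    then have "\<bar>real (N p) - p / 2 ^ k\<bar> * (2 ^ k / p) \<le> 22 * k * sqrt p * (2 ^ k / p)"
      by (intro mult_right_mono) auto
    also have "\<bar>real (N p) - p / 2 ^ k\<bar> * (2 ^ k / p) = \<bar>(real (N p) - p / 2 ^ k) * (2 ^ k / p)\<bar>"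
      by (simp add: abs_mult)
    also have "(real (N p) - p / 2 ^ k) * (2 ^ k / p) = real (N p) * 2 ^ k / p - 1"
      using pp by (simp add: field_simps)
    also have "22 * k * sqrt p * (2 ^ k / p) = 22 * real k * 2 ^ k / sqrt p"
      using pp by (simp add: field_simps)
    also have "\<dots> \<le> 22 * real K * 2 ^ K / sqrt y"
      using H(2) pp y0 by (intro frac_le mult_mono power_increasing) (auto simp: k_def)
    finally show ?thesis by (simp add: \<eta>_def)
  qed
  have "real (card (pattern_set b u H)) = (\<Prod>p\<in>T. real p / 2 ^ k * (real (N p) * 2 ^ k / p))"
    unfolding c of_nat_prod
  proof (rule prod.cong[OF refl])
    fix p assume "p \<in> T"
    then have "p > 0" using T[of p] by auto
    then show "real (N p) = real p / 2 ^ k * (real (N p) * 2 ^ k / p)" by simp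
  qed
  also have "\<dots> = (\<Prod>p\<in>T. real p / 2 ^ k) * (\<Prod>p\<in>T. real (N p) * 2 ^ k / p)" by (rule prod.distrib)
  also have "(\<Prod>p\<in>T. real p / 2 ^ k) = real (\<Prod>T) * \<alpha> ^ k"
    by (simp add: prod_dividef \<alpha>_def power_divide power_mult[symmetric] mult.commute)
  finally have "real (card (pattern_set b u H)) - real (\<Prod>T) * \<alpha> ^ k = real (\<Prod>T) * \<alpha> ^ k * ((\<Prod>p\<in>T. real (N p) * 2 ^ k / p) - 1)"
    by (simp add: algebra_simps)
  then have "\<bar>real (card (pattern_set b u H)) - real (\<Prod>T) * \<alpha> ^ k\<bar> = real (\<Prod>T) * \<alpha> ^ k * \<bar>(\<Prod>p\<in>T. real (N p) * 2 ^ k / p) - 1\<bar>"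
    using \<alpha>_bounds by (simp add: abs_mult prod_nonneg)
  also have "\<dots> \<le> real (\<Prod>T) * \<alpha> ^ k * ((1 + \<eta>) ^ card T - 1)"
    using near \<alpha>_bounds by (intro mult_left_mono prod_near_one finT mult_nonneg_nonneg of_nat_0_le_iff) (auto simp: \<eta>_def)
  finally show ?thesis by (simp add: k_def \<eta>_def pattern_error_def)
qed

text \<open>The first term is the cut-off part of the inclusion-exclusion sum, the second the
  pattern errors weighted by the sum of \<open>\<alpha> ^ card H\<close>; \<kappa> bounds the
  expected number of squares in the window.\<close>

definition window_error :: "nat \<Rightarrow> real \<Rightarrow> real" where
  "window_error K \<kappa> = exp (2 * \<kappa>) / 2 ^ K + pattern_error K * exp \<kappa>"

lemma window_error_nonneg: "0 \<le> window_error K \<kappa>"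
  using pattern_error_nonneg by (simp add: window_error_def)

text \<open>Bonferroni's inequality at an even level K. With the pattern counts inserted, the sum is
  a truncation of the expansion of \<open>(1 - \<alpha>) ^ card A\<close>, and completing it costs
  the terms with more than K elements.\<close>

lemma card_avoiding_le:
  assumes b: "coprime b (int M)" and u: "u \<in> {0..<int q}" and A: "A \<subseteq> {1..int L}" and L: "L \<le> y" and K: "even K"
    and \<kappa>: "card A * \<alpha> \<le> \<kappa>"
  shows "real (card {x\<in>{0..<int M}. x mod int q = u \<and> (\<forall>h\<in>A. \<not> (\<forall>p\<in>T. QuadRes (int p) (b * (x + h))))})
    \<le> \<Prod>T * ((1 - \<alpha>) ^ card A + window_error K \<kappa>)"
proof -
  define X where "X = {x\<in>{0..<int M}. x mod int q = u}"
  define hits where "hits x = {h\<in>A. \<forall>p\<in>T. QuadRes (int p) (b * (x + h))}" for x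
  define HH where "HH = {H\<in>Pow A. card H \<le> K}"
  define n where "n = card A"
  define t where "t = real (\<Prod>T)"
  have t0: "t \<ge> 0" by (simp add: t_def prod_nonneg)
  have finA: "finite A" using A finite_subset by blast
  have finX: "finite X" unfolding X_def by (rule finite_subset[of _ "{0..<int M}"]) auto
  have finHH: "finite HH" using finA by (simp add: HH_def)
  have "{x\<in>{0..<int M}. x mod int q = u \<and> (\<forall>h\<in>A. \<not> (\<forall>p\<in>T. QuadRes (int p) (b * (x + h))))} = {x\<in>X. hits x = {}}"
    by (auto simp: X_def hits_def)
  then have "real (card {x\<in>{0..<int M}. x mod int q = u \<and> (\<forall>h\<in>A. \<not> (\<forall>p\<in>T. QuadRes (int p) (b * (x + h))))}) = (\<Sum>x\<in>X. if hits x = {} then 1 else 0)"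
    using finX by (simp only: card_filter_eq_sum) (simp add: of_nat_sum[symmetric] sum.inter_filter[symmetric])
  also have "\<dots> \<le> (\<Sum>x\<in>X. \<Sum>H\<in>HH. if H \<subseteq> hits x then (-1) ^ card H else 0)"
  proof (intro sum_mono)
    fix x
    have "(\<Sum>H\<in>{H\<in>Pow (hits x). card H \<le> K}. (-1) ^ card H :: real) = (\<Sum>H\<in>{H\<in>HH. H \<subseteq> hits x}. (-1) ^ card H)"
      by (intro sum.cong refl) (auto simp: HH_def hits_def)
    also have "\<dots> = (\<Sum>H\<in>HH. if H \<subseteq> hits x then (-1) ^ card H else 0)" by (rule sum.inter_filter[OF finHH])
    finally show "(if hits x = {} then 1 else 0) \<le> (\<Sum>H\<in>HH. if H \<subseteq> hits x then (-1) ^ card H else (0::real))"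
      using bonferroni_even[of "hits x" K] K finA by (simp add: hits_def)
  qed
  also have "\<dots> = (\<Sum>H\<in>HH. \<Sum>x\<in>X. if H \<subseteq> hits x then (-1) ^ card H else 0)" by (rule sum.swap)
  also have "\<dots> = (\<Sum>H\<in>HH. (-1) ^ card H * real (card (pattern_set b u H)))"
  proof (rule sum.cong[OF refl])
    fix H assume H: "H \<in> HH"
    have "(\<Sum>x\<in>X. if H \<subseteq> hits x then (-1) ^ card H else 0) = (\<Sum>x\<in>{x\<in>X. H \<subseteq> hits x}. (-1) ^ card H :: real)"
      by (rule sum.inter_filter[OF finX, symmetric])
    also have "{x\<in>X. H \<subseteq> hits x} = pattern_set b u H"
      using H by (auto simp: X_def hits_def pattern_set_def HH_def)
    finally show "(\<Sum>x\<in>X. if H \<subseteq> hits x then (-1) ^ card H else 0) = (-1) ^ card H * real (card (pattern_set b u H))" by simp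
  qed
  also have "\<dots> \<le> (\<Sum>H\<in>HH. t * ((- \<alpha>) ^ card H + \<alpha> ^ card H * pattern_error K))"
  proof (intro sum_mono)
    fix H assume H: "H \<in> HH"
    have "H \<subseteq> {1..int L}" "card H \<le> K" using H A by (auto simp: HH_def)
    from card_pattern_set[OF b u this L]
    have d: "\<bar>real (card (pattern_set b u H)) - t * \<alpha> ^ card H\<bar> \<le> t * \<alpha> ^ card H * pattern_error K" by (simp add: t_def)
    have "(-1) ^ card H * real (card (pattern_set b u H)) - t * (- \<alpha>) ^ card H = (-1) ^ card H * (real (card (pattern_set b u H)) - t * \<alpha> ^ card H)"
      by (simp add: algebra_simps power_minus[of \<alpha>])
    also have "\<dots> \<le> \<bar>(-1) ^ card H * (real (card (pattern_set b u H)) - t * \<alpha> ^ card H)\<bar>" by simp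
    also have "\<dots> = \<bar>real (card (pattern_set b u H)) - t * \<alpha> ^ card H\<bar>" by (simp add: abs_mult)
    finally show "(-1) ^ card H * real (card (pattern_set b u H)) \<le> t * ((- \<alpha>) ^ card H + \<alpha> ^ card H * pattern_error K)"
      using d by (simp add: algebra_simps)
  qed
  also have "\<dots> = t * ((\<Sum>H\<in>HH. (- \<alpha>) ^ card H) + (\<Sum>H\<in>HH. \<alpha> ^ card H) * pattern_error K)"
    by (simp only: sum_distrib_left[symmetric] sum.distrib sum_distrib_right[symmetric])
  also have "\<dots> \<le> t * ((1 - \<alpha>) ^ n + window_error K \<kappa>)"
  proof (rule mult_left_mono[OF _ t0])
    have pw: "(\<Sum>H\<in>Pow A. c ^ card H) = (1 + c) ^ n" for c :: real
      using sum_Pow_prod[OF finA, of "\<lambda>_. c"] by (simp add: n_def)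
    have expn: "(1 + c * \<alpha>) ^ n \<le> exp (c * \<kappa>)" if c: "c \<ge> 0" for c :: real
    proof -
      have "(1 + c * \<alpha>) ^ n \<le> exp (c * \<alpha>) ^ n"
        using c \<alpha>_bounds by (intro power_mono exp_ge_add_one_self) auto
      also have "\<dots> = exp (c * (n * \<alpha>))" by (simp add: exp_of_nat_mult[symmetric] algebra_simps)
      also have "\<dots> \<le> exp (c * \<kappa>)" using c \<kappa> by (simp add: n_def mult_left_mono)
      finally show ?thesis .
    qed
    have HHsub: "HH \<subseteq> Pow A" by (auto simp: HH_def)
    have "(\<Sum>H\<in>HH. (- \<alpha>) ^ card H) = (1 - \<alpha>) ^ n + - (\<Sum>H\<in>Pow A - HH. (- \<alpha>) ^ card H)"
      using pw[of "- \<alpha>"] sum_diff[OF _ HHsub, of "\<lambda>H. (- \<alpha>) ^ card H"] finA by simp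
    \<comment> \<open>Sets outside HH have more than K elements, so the weight
      \<open>2 ^ card H / 2 ^ K\<close> is at least 1 on them and allows the sum to be extended to
      all subsets of A.\<close>
    also have "- (\<Sum>H\<in>Pow A - HH. (- \<alpha>) ^ card H) \<le> (\<Sum>H\<in>Pow A - HH. (2 * \<alpha>) ^ card H / 2 ^ K)"
    proof -
      have "- (\<Sum>H\<in>Pow A - HH. (- \<alpha>) ^ card H) \<le> \<bar>\<Sum>H\<in>Pow A - HH. (- \<alpha>) ^ card H\<bar>" by simp
      also have "\<dots> \<le> (\<Sum>H\<in>Pow A - HH. \<alpha> ^ card H)"
        using \<alpha>_bounds by (intro order_trans[OF sum_abs] sum_mono) (simp add: power_abs)
      also have "\<dots> \<le> (\<Sum>H\<in>Pow A - HH. (2 * \<alpha>) ^ card H / 2 ^ K)"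
      proof (intro sum_mono)
        fix H assume "H \<in> Pow A - HH"
        then have "card H \<ge> K" by (auto simp: HH_def)
        then have "(2::real) ^ K \<le> 2 ^ card H" by (intro power_increasing) auto
        then have "\<alpha> ^ card H * 2 ^ K \<le> \<alpha> ^ card H * 2 ^ card H" using \<alpha>_bounds by (intro mult_left_mono) auto
        then show "\<alpha> ^ card H \<le> (2 * \<alpha>) ^ card H / 2 ^ K" by (simp add: le_divide_eq power_mult_distrib mult.commute)
      qed
      finally show ?thesis .
    qed
    also have "(\<Sum>H\<in>Pow A - HH. (2 * \<alpha>) ^ card H / 2 ^ K) \<le> (\<Sum>H\<in>Pow A. (2 * \<alpha>) ^ card H / 2 ^ K)"
      using finA \<alpha>_bounds by (intro sum_mono2) auto
    also have "\<dots> = (1 + 2 * \<alpha>) ^ n / 2 ^ K" by (simp only: sum_divide_distrib[symmetric] pw)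
    also have "\<dots> \<le> exp (2 * \<kappa>) / 2 ^ K" using expn[of 2] by (intro divide_right_mono) auto
    finally have 1: "(\<Sum>H\<in>HH. (- \<alpha>) ^ card H) \<le> (1 - \<alpha>) ^ n + exp (2 * \<kappa>) / 2 ^ K" by simp
    have "(\<Sum>H\<in>HH. \<alpha> ^ card H) \<le> (\<Sum>H\<in>Pow A. \<alpha> ^ card H)"
      using finA \<alpha>_bounds HHsub by (intro sum_mono2) auto
    also have "\<dots> \<le> exp \<kappa>" using expn[of 1] by (simp add: pw)
    finally have "(\<Sum>H\<in>HH. \<alpha> ^ card H) * pattern_error K \<le> exp \<kappa> * pattern_error K"
      using pattern_error_nonneg by (rule mult_right_mono)
    then show "(\<Sum>H\<in>HH. (- \<alpha>) ^ card H) + (\<Sum>H\<in>HH. \<alpha> ^ card H) * pattern_error K \<le> (1 - \<alpha>) ^ n + window_error K \<kappa>"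
      using 1 by (simp add: window_error_def mult.commute)
  qed
  finally show ?thesis by (simp add: t_def n_def)
qed

definition local_count :: "int \<Rightarrow> int \<Rightarrow> nat \<Rightarrow> nat" where
  "local_count b u L = card {i\<in>{1..int L}. QuadRes (int q) (b * (u + i))}"

definition empty_windows :: "int \<Rightarrow> nat \<Rightarrow> int set" where
  "empty_windows b L = {x\<in>{0..<int M}. \<forall>i\<in>{1..int L}. \<not> QuadRes (int M) (b * (x + i))}"

lemma QuadRes_M: "QuadRes (int M) a \<longleftrightarrow> QuadRes (int q) a \<and> (\<forall>p\<in>T. QuadRes (int p) a)"
  unfolding M_def using T by (intro QuadRes_mult_prod finT) auto

text \<open>The class u of x modulo q decides at which shifts \<open>b * (x + i)\<close> is a square
  modulo q; only at those \<open>local_count b u L\<close> shifts must the primes of T prevent a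
  square.\<close>

lemma card_empty_windows_le:
  assumes b: "coprime b (int M)" and L: "L \<le> y" and K: "even K"
    and \<kappa>: "\<And>u. u \<in> {0..<int q} \<Longrightarrow> local_count b u L * \<alpha> \<le> \<kappa>"
  shows "real (card (empty_windows b L)) \<le> \<Prod>T * (\<Sum>u\<in>{0..<int q}. (1 - \<alpha>) ^ local_count b u L + window_error K \<kappa>)"
proof -
  define A where "A u = {i\<in>{1..int L}. QuadRes (int q) (b * (u + i))}" for u
  have fin: "finite (empty_windows b L)"
    unfolding empty_windows_def by (rule finite_subset[of _ "{0..<int M}"]) auto
  have "card (empty_windows b L) = (\<Sum>x\<in>empty_windows b L. 1)" by simp
  also have "\<dots> = (\<Sum>u\<in>{0..<int q}. \<Sum>x\<in>{x\<in>empty_windows b L. x mod int q = u}. 1)"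
    using q0 by (intro sum.group[symmetric] fin) auto
  finally have "card (empty_windows b L) = (\<Sum>u\<in>{0..<int q}. card {x\<in>empty_windows b L. x mod int q = u})" by simp
  then have "real (card (empty_windows b L)) = (\<Sum>u\<in>{0..<int q}. real (card {x\<in>empty_windows b L. x mod int q = u}))" by simp
  also have "\<dots> \<le> (\<Sum>u\<in>{0..<int q}. \<Prod>T * ((1 - \<alpha>) ^ local_count b u L + window_error K \<kappa>))"
  proof (intro sum_mono)
    fix u assume u: "u \<in> {0..<int q}"
    have "{x\<in>empty_windows b L. x mod int q = u} = {x\<in>{0..<int M}. x mod int q = u \<and> (\<forall>h\<in>A u. \<not> (\<forall>p\<in>T. QuadRes (int p) (b * (x + h))))}"
    proof -
      have res: "QuadRes (int q) (b * (x + i)) \<longleftrightarrow> QuadRes (int q) (b * (u + i))" if "x mod int q = u" for x i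
        using that by (intro QuadRes_cong cong_mult cong_add cong_refl) (auto simp: cong_def)
      have "(\<forall>i\<in>{1..int L}. \<not> QuadRes (int M) (b * (x + i))) \<longleftrightarrow> (\<forall>h\<in>A u. \<not> (\<forall>p\<in>T. QuadRes (int p) (b * (x + h))))"
        if x: "x mod int q = u" for x
        using res[OF x] unfolding QuadRes_M A_def by blast
      then show ?thesis unfolding empty_windows_def by blast
    qed
    moreover have "card (A u) = local_count b u L" by (simp add: A_def local_count_def)
    moreover have "A u \<subseteq> {1..int L}" by (auto simp: A_def)
    ultimately show "real (card {x\<in>empty_windows b L. x mod int q = u}) \<le> \<Prod>T * ((1 - \<alpha>) ^ local_count b u L + window_error K \<kappa>)"
      using card_avoiding_le[OF b u _ L K, of "A u" \<kappa>] \<kappa>[OF u] by simp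
  qed
  finally show ?thesis by (simp add: sum_distrib_left)
qed

end

section \<open>The periodic model\<close>

lemma one_minus_power_le:
  fixes a :: real
  assumes "0 \<le> a" "a \<le> 1"
  shows "(1 - a) ^ n \<le> 1 - n * a + real n * (real n - 1) / 2 * a\<^sup>2"
proof (induction n)
  case (Suc n)
  have "(1 - a) ^ Suc n \<le> (1 - a) * (1 - n * a + real n * (real n - 1) / 2 * a\<^sup>2)"
    using Suc assms by (simp add: mult_left_mono)
  also have "\<dots> = (1 - Suc n * a + real (Suc n) * (real (Suc n) - 1) / 2 * a\<^sup>2) - real n * (real n - 1) / 2 * a ^ 3"
    by (simp add: field_simps power2_eq_square power3_eq_cube)
  also have "\<dots> \<le> 1 - Suc n * a + real (Suc n) * (real (Suc n) - 1) / 2 * a\<^sup>2"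
  proof -
    have "real n * (real n - 1) \<ge> 0" by (cases n) auto
    then show ?thesis using assms by (simp add: zero_le_mult_iff)
  qed
  finally show ?case .
qed simp

lemma bij_betw_filter: "bij_betw f A B \<Longrightarrow> bij_betw f {i\<in>A. P (f i)} {v\<in>B. P v}"
  unfolding bij_betw_def inj_on_def by auto

context residue_setting
begin

definition e :: nat where "e = card {v\<in>{0..<int q}. QuadRes (int q) v}"

lemma e_pos: "e \<ge> 1"
proof -
  have "QuadRes (int q) 0" unfolding QuadRes_def by (intro exI[of _ 0]) simp
  then have "0 \<in> {v\<in>{0..<int q}. QuadRes (int q) v}" using q0 by simp
  moreover have "finite {v\<in>{0..<int q}. QuadRes (int q) v}" by (rule finite_subset[of _ "{0..<int q}"]) auto
  ultimately have "card {v\<in>{0..<int q}. QuadRes (int q) v} > 0" by (subst card_gt_0_iff) blast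
  then show ?thesis by (simp add: e_def)
qed

text \<open>The class q - 1 can be left out when squaring, as it has the same square as 1 and
  differs from 1 for q >= 3.\<close>

lemma e_less_q:
  assumes "q \<ge> 3" shows "e + 1 \<le> q"
proof -
  have "{v\<in>{0..<int q}. QuadRes (int q) v} \<subseteq> (\<lambda>a. a\<^sup>2 mod int q) ` {0..<int q - 1}"
  proof
    fix v assume v: "v \<in> {v\<in>{0..<int q}. QuadRes (int q) v}"
    then obtain a where "[a\<^sup>2 = v] (mod int q)" by (auto simp: QuadRes_def)
    then have av: "(a mod int q)\<^sup>2 mod int q = v" using v by (simp add: cong_def power_mod)
    show "v \<in> (\<lambda>a. a\<^sup>2 mod int q) ` {0..<int q - 1}"
    proof (cases "a mod int q = int q - 1")
      case True
      have "(int q - 1)\<^sup>2 = 1\<^sup>2 + int q * (int q - 2)" by (simp add: power2_eq_square algebra_simps)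
      then have "(int q - 1)\<^sup>2 mod int q = 1\<^sup>2 mod int q" by (simp only: mod_mult_self2)
      then have "v = 1\<^sup>2 mod int q" using av True by simp
      then show ?thesis using assms by (intro image_eqI[of _ _ 1]) auto
    next
      case False
      have "0 \<le> a mod int q" "a mod int q < int q" using q0 by auto
      then show ?thesis using av False by (intro image_eqI[of _ _ "a mod int q"]) auto
    qed
  qed
  then have "e \<le> card ((\<lambda>a. a\<^sup>2 mod int q) ` {0..<int q - 1})" unfolding e_def by (intro card_mono) auto
  also have "\<dots> \<le> card {0..<int q - 1}" by (rule card_image_le) simp
  finally show ?thesis using assms by simp
qed

lemma local_count_le: "local_count b u L \<le> L"
proof -
  have "local_count b u L \<le> card {1..int L}" unfolding local_count_def by (intro card_mono) auto
  then show ?thesis by simp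
qed

lemma local_count_period:
  assumes "coprime b (int q)"
  shows "local_count b u q = e"
proof -
  have "bij_betw (\<lambda>i. b * (u + i) mod int q) {1..int q} {0..<int q}"
    unfolding bij_betw_def
  proof
    show inj: "inj_on (\<lambda>i. b * (u + i) mod int q) {1..int q}"
    proof (rule inj_onI)
      fix i j assume ij: "i \<in> {1..int q}" "j \<in> {1..int q}" "b * (u + i) mod int q = b * (u + j) mod int q"
      then have "[b * (u + i) = b * (u + j)] (mod int q)" by (simp add: cong_def)
      then have "[u + i = u + j] (mod int q)" using assms by (simp add: cong_mult_lcancel)
      then have "int q dvd i - j" by (simp add: cong_iff_dvd_diff)
      moreover have "\<bar>i - j\<bar> < int q" using ij by auto
      ultimately show "i = j" using dvd_imp_le_int[of "i - j" "int q"] by auto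
    qed
    have "(\<lambda>i. b * (u + i) mod int q) ` {1..int q} \<subseteq> {0..<int q}" using q0 by auto
    moreover have "card ((\<lambda>i. b * (u + i) mod int q) ` {1..int q}) = card {0..<int q}"
      using inj by (simp add: card_image)
    ultimately show "(\<lambda>i. b * (u + i) mod int q) ` {1..int q} = {0..<int q}" by (intro card_subset_eq) auto
  qed
  then have "bij_betw (\<lambda>i. b * (u + i) mod int q) {i\<in>{1..int q}. QuadRes (int q) (b * (u + i) mod int q)} {v\<in>{0..<int q}. QuadRes (int q) v}"
    by (rule bij_betw_filter)
  then have "card {i\<in>{1..int q}. QuadRes (int q) (b * (u + i) mod int q)} = e"
    unfolding e_def by (rule bij_betw_same_card)
  moreover have "QuadRes (int q) (a mod int q) = QuadRes (int q) a" for a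
    by (rule QuadRes_cong) (simp add: cong_def)
  ultimately show ?thesis by (simp add: local_count_def)
qed

lemma local_count_add:
  assumes "coprime b (int q)"
  shows "local_count b u (q + L) = e + local_count b u L"
proof -
  let ?f = "\<lambda>i. QuadRes (int q) (b * (u + i))"
  have per: "?f (i + int q) = ?f i" for i
    by (intro QuadRes_cong cong_mult cong_refl) (simp add: cong_def add.assoc[symmetric])
  have split: "{i\<in>{1..int (q + L)}. ?f i} = {i\<in>{1..int q}. ?f i} \<union> (\<lambda>i. i + int q) ` {i\<in>{1..int L}. ?f i}"
  proof (intro equalityI subsetI)
    fix i assume i: "i \<in> {i\<in>{1..int (q + L)}. ?f i}"
    show "i \<in> {i\<in>{1..int q}. ?f i} \<union> (\<lambda>i. i + int q) ` {i\<in>{1..int L}. ?f i}"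
    proof (cases "i \<le> int q")
      case False
      have "?f (i - int q)" using i per[of "i - int q"] by simp
      then show ?thesis using i False by (intro UnI2 image_eqI[of _ _ "i - int q"]) auto
    qed (use i in auto)
  next
    fix i assume "i \<in> {i\<in>{1..int q}. ?f i} \<union> (\<lambda>i. i + int q) ` {i\<in>{1..int L}. ?f i}"
    then show "i \<in> {i\<in>{1..int (q + L)}. ?f i}" using per by auto
  qed
  have fin: "finite {i\<in>{1..int n}. ?f i}" for n by (rule finite_subset[of _ "{1..int n}"]) auto
  have "card {i\<in>{1..int (q + L)}. ?f i} = card {i\<in>{1..int q}. ?f i} + card ((\<lambda>i. i + int q) ` {i\<in>{1..int L}. ?f i})"
    unfolding split using fin by (intro card_Un_disjoint finite_imageI) auto
  also have "card ((\<lambda>i. i + int q) ` {i\<in>{1..int L}. ?f i}) = card {i\<in>{1..int L}. ?f i}"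
    by (rule card_image) (simp add: inj_on_def)
  finally show ?thesis using local_count_period[OF assms, of u] by (simp add: local_count_def)
qed

lemma local_count_mult_add:
  assumes "coprime b (int q)"
  shows "local_count b u (q * j + L) = e * j + local_count b u L"
proof (induction j)
  case (Suc j)
  have "local_count b u (q * Suc j + L) = local_count b u (q + (q * j + L))" by (simp add: add.assoc)
  then show ?case using Suc local_count_add[OF assms, of u "q * j + L"] by simp
qed simp

lemma local_count_mult:
  assumes "coprime b (int q)"
  shows "local_count b u (q * j) = e * j"
  using local_count_mult_add[OF assms, of u j 0] by (simp add: local_count_def)

lemma local_count_mono: "L \<le> L' \<Longrightarrow> local_count b u L \<le> local_count b u L'"
  unfolding local_count_def by (intro card_mono finite_subset[of "{i \<in> {1..int L'}. QuadRes (int q) (b * (u + i))}" "{1..int L'}"]) auto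

lemma sum_local_count: "(\<Sum>u\<in>{0..<int q}. local_count 1 u L) = e * L"
proof -
  have per: "QuadRes (int q) (x mod int q) = QuadRes (int q) x" for x
    by (rule QuadRes_cong) (simp add: cong_def)
  have e: "e = (\<Sum>v\<in>{0..<int q}. if QuadRes (int q) v then 1 else 0)"
    unfolding e_def by (rule card_filter_eq_sum) simp
  have "(\<Sum>u\<in>{0..<int q}. local_count 1 u L) = (\<Sum>u\<in>{0..<int q}. \<Sum>i\<in>{1..int L}. if QuadRes (int q) (u + i) then 1 else 0)"
    unfolding local_count_def mult_1 by (intro sum.cong refl card_filter_eq_sum) simp
  also have "\<dots> = (\<Sum>i\<in>{1..int L}. \<Sum>u\<in>{0..<int q}. if QuadRes (int q) (u + i) then 1 else 0)" by (rule sum.swap)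
  also have "\<dots> = (\<Sum>i\<in>{1..int L}. e)"
  proof (rule sum.cong[OF refl])
    fix i
    show "(\<Sum>u\<in>{0..<int q}. if QuadRes (int q) (u + i) then 1 else 0) = e"
      unfolding e using q0 per by (intro sum_periodic_shift) auto
  qed
  finally show ?thesis by simp
qed

text \<open>The gain \<open>1 / (4 q)\<close> over the value \<open>q / (e \<alpha>)\<close> of a purely random set reflects the regularity of the
  residues modulo \<open>q\<close>; it is positive because \<open>e < q\<close>.\<close>

lemma model_sum_le:
  assumes q3: "q \<ge> 3" and small: "real q ^ 3 * \<alpha> \<le> 1 / 2"
  shows "(\<Sum>u\<in>{0..<int q}. \<Sum>L<q * g. (1 - \<alpha>) ^ local_count 1 u L) \<le> q * (q / (e * \<alpha>) - 1 / (4 * q))"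
proof -
  define Q E where "Q = real q" and "E = real e"
  have QE: "E + 1 \<le> Q" "1 \<le> E" "3 \<le> Q"
    using e_less_q[OF q3] e_pos q3 by (auto simp: Q_def E_def)
  note \<alpha> = \<alpha>_bounds
  define S where "S u = (\<Sum>L<q. (1 - \<alpha>) ^ local_count 1 u L)" for u
  define w where "w = (1 - \<alpha>) ^ e"
  \<comment> \<open>A full period multiplies the summand by w whatever u is, so the sum is a
    geometric series times the sum over one period.\<close>
  have blocks: "(\<Sum>L<q * g. (1 - \<alpha>) ^ local_count 1 u L) = (\<Sum>j<g. w ^ j) * S u" for u
  proof -
    have "(\<Sum>L<q * g. (1 - \<alpha>) ^ local_count 1 u L) = (\<Sum>j<g. \<Sum>L\<in>{j * q..<j * q + q}. (1 - \<alpha>) ^ local_count 1 u L)"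
      using sum.nat_group[of "\<lambda>L. (1 - \<alpha>) ^ local_count 1 u L" q g] by (simp add: mult.commute)
    also have "\<dots> = (\<Sum>j<g. \<Sum>L<q. (1 - \<alpha>) ^ local_count 1 u (q * j + L))"
    proof (rule sum.cong[OF refl])
      fix j
      show "(\<Sum>L\<in>{j * q..<j * q + q}. (1 - \<alpha>) ^ local_count 1 u L) = (\<Sum>L<q. (1 - \<alpha>) ^ local_count 1 u (q * j + L))"
        using sum.shift_bounds_nat_ivl[of "\<lambda>L. (1 - \<alpha>) ^ local_count 1 u L" 0 "j * q" q]
        by (simp add: add.commute mult.commute lessThan_atLeast0)
    qed
    also have "\<dots> = (\<Sum>j<g. w ^ j * S u)"
      by (simp add: local_count_mult_add S_def sum_distrib_left power_add power_mult w_def)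
    finally show ?thesis by (simp add: sum_distrib_right)
  qed
  have E2: "E * (E - 1) * \<alpha>\<^sup>2 / 2 = E * \<alpha> * ((E - 1) * \<alpha> / 2)" by (simp add: power2_eq_square)
  have EQ3: "(E - 1) * \<alpha> \<le> 1 / 2"
  proof -
    have "(E - 1) * \<alpha> \<le> Q ^ 3 * \<alpha>"
    proof (rule mult_right_mono)
      have "Q ^ 1 \<le> Q ^ 3" using QE by (intro power_increasing) auto
      then show "E - 1 \<le> Q ^ 3" using QE by simp
    qed (use \<alpha> in auto)
    then show ?thesis using small by (simp add: Q_def)
  qed
  \<comment> \<open>A second-order lower bound for 1 - w. The correction
    \<open>(E - 1) * \<alpha> / 2\<close> enters the part of the result that stays bounded for small
    \<alpha>, which is where the gain lies.\<close>
  define d where "d = E * \<alpha> * (1 - (E - 1) * \<alpha> / 2)"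
  have d0: "d > 0" using QE \<alpha> EQ3 by (simp add: d_def)
  have wd: "w \<le> 1 - d"
    using one_minus_power_le[of \<alpha> e] \<alpha> by (simp add: w_def d_def E_def power2_eq_square field_simps)
  have w0: "0 \<le> w" using \<alpha> by (simp add: w_def)
  have geo: "(\<Sum>j<g. w ^ j) \<le> 1 / d"
  proof -
    have "(\<Sum>j<g. w ^ j) = (1 - w ^ g) / (1 - w)" using wd d0 by (simp add: sum_gp_strict)
    also have "\<dots> \<le> 1 / (1 - w)" using wd d0 w0 by (intro divide_right_mono) auto
    also have "\<dots> \<le> 1 / d" using wd d0 by (intro divide_left_mono) auto
    finally show ?thesis .
  qed
  have S0: "S u \<ge> 0" for u using \<alpha> by (simp add: S_def sum_nonneg)
  have "(\<Sum>u\<in>{0..<int q}. S u) \<le> (\<Sum>u\<in>{0..<int q}. \<Sum>L<q. 1 - local_count 1 u L * \<alpha> + Q\<^sup>2 / 2 * \<alpha>\<^sup>2)"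
    unfolding S_def
  proof (intro sum_mono)
    fix u L assume "L \<in> {..<q}"
    define n where "n = local_count 1 u L"
    have n: "real n \<le> Q" using local_count_le[of 1 u L] \<open>L \<in> {..<q}\<close> by (simp add: n_def Q_def)
    have "real n * (real n - 1) / 2 * \<alpha>\<^sup>2 \<le> Q\<^sup>2 / 2 * \<alpha>\<^sup>2"
    proof (rule mult_right_mono)
      have "real n * (real n - 1) \<le> real n * real n" by (simp add: mult_left_mono)
      also have "\<dots> \<le> Q * Q" using n by (intro mult_mono) auto
      finally show "real n * (real n - 1) / 2 \<le> Q\<^sup>2 / 2" by (simp add: power2_eq_square)
    qed simp
    then show "(1 - \<alpha>) ^ local_count 1 u L \<le> 1 - local_count 1 u L * \<alpha> + Q\<^sup>2 / 2 * \<alpha>\<^sup>2"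
      using one_minus_power_le[of \<alpha> n] \<alpha> unfolding n_def[symmetric] by linarith
  qed
  also have "\<dots> = (\<Sum>L<q. \<Sum>u\<in>{0..<int q}. 1 - local_count 1 u L * \<alpha> + Q\<^sup>2 / 2 * \<alpha>\<^sup>2)" by (rule sum.swap)
  also have "\<dots> = (\<Sum>L<q. Q - E * L * \<alpha> + Q * (Q\<^sup>2 / 2 * \<alpha>\<^sup>2))"
  proof (rule sum.cong[OF refl])
    fix L
    have "(\<Sum>u\<in>{0..<int q}. real (local_count 1 u L)) = E * L"
      using arg_cong[OF sum_local_count[of L], of real] by (simp add: E_def)
    then show "(\<Sum>u\<in>{0..<int q}. 1 - local_count 1 u L * \<alpha> + Q\<^sup>2 / 2 * \<alpha>\<^sup>2) = Q - E * L * \<alpha> + Q * (Q\<^sup>2 / 2 * \<alpha>\<^sup>2)"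
      by (simp add: sum.distrib sum_subtractf sum_distrib_right[symmetric] Q_def)
  qed
  also have "\<dots> = Q * Q - E * \<alpha> * (\<Sum>L<q. real L) + Q * (Q * (Q\<^sup>2 / 2 * \<alpha>\<^sup>2))"
    by (simp add: sum.distrib sum_subtractf sum_distrib_left Q_def mult.commute mult.left_commute)
  also have "(\<Sum>L<q. real L) = Q * (Q - 1) / 2"
    unfolding Q_def by (induction q) (simp_all add: field_simps)
  finally have "(\<Sum>u\<in>{0..<int q}. S u) \<le> Q * Q - E * \<alpha> * (Q * (Q - 1) / 2) + Q * (Q * (Q\<^sup>2 / 2 * \<alpha>\<^sup>2))" .
  also have "\<dots> \<le> (Q\<^sup>2 / (E * \<alpha>) - 1 / 4) * d"
  proof -
    have "(Q\<^sup>2 / (E * \<alpha>) - 1 / 4) * d = (Q\<^sup>2 - E * \<alpha> / 4) * (1 - (E - 1) * \<alpha> / 2)"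
      using QE \<alpha> by (simp add: d_def field_simps)
    also have "\<dots> = Q\<^sup>2 - Q\<^sup>2 * (E - 1) * \<alpha> / 2 - E * \<alpha> / 4 + E * \<alpha> / 4 * ((E - 1) * \<alpha> / 2)"
      by (simp add: field_simps)
    finally have rhs: "(Q\<^sup>2 / (E * \<alpha>) - 1 / 4) * d \<ge> Q\<^sup>2 - Q\<^sup>2 * (E - 1) * \<alpha> / 2 - E * \<alpha> / 4"
      using QE \<alpha> by simp
    \<comment> \<open>The two first-order terms differ by
      \<open>\<alpha> / 2 * (Q * (Q - E))\<close>, which e < q makes at least
      \<open>\<alpha> * Q / 2\<close>. One half of this pays for the second-order error, the other
      for the gain \<open>E * \<alpha> / 4\<close>.\<close>
    have "Q * (Q ^ 3 * \<alpha>) \<le> Q * (1 / 2)" using small QE by (intro mult_left_mono) (auto simp: Q_def)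
    moreover have "Q * 1 \<le> Q * (Q - E)" using QE by (intro mult_left_mono) auto
    ultimately have "Q * (Q ^ 3 * \<alpha>) + E / 2 \<le> Q * (Q - E)" using QE by linarith
    then have "\<alpha> / 2 * (Q * (Q ^ 3 * \<alpha>) + E / 2) \<le> \<alpha> / 2 * (Q * (Q - E))" using \<alpha> by (intro mult_left_mono) auto
    then have "Q * Q - E * \<alpha> * (Q * (Q - 1) / 2) + Q * (Q * (Q\<^sup>2 / 2 * \<alpha>\<^sup>2)) \<le> Q\<^sup>2 - Q\<^sup>2 * (E - 1) * \<alpha> / 2 - E * \<alpha> / 4"
      by (simp add: power2_eq_square power3_eq_cube field_simps)
    then show ?thesis using rhs by linarith
  qed
  finally have Sb: "(\<Sum>u\<in>{0..<int q}. S u) \<le> (Q\<^sup>2 / (E * \<alpha>) - 1 / 4) * d" .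
  have "(\<Sum>u\<in>{0..<int q}. \<Sum>L<q * g. (1 - \<alpha>) ^ local_count 1 u L) = (\<Sum>j<g. w ^ j) * (\<Sum>u\<in>{0..<int q}. S u)"
    by (simp add: blocks sum_distrib_left)
  also have "\<dots> \<le> 1 / d * ((Q\<^sup>2 / (E * \<alpha>) - 1 / 4) * d)"
    using geo Sb S0 d0 by (intro mult_mono) (auto intro: sum_nonneg)
  also have "\<dots> = Q\<^sup>2 / (E * \<alpha>) - 1 / 4" using d0 by simp
  also have "\<dots> = q * (q / (e * \<alpha>) - 1 / (4 * q))"
    using q0 by (simp add: Q_def E_def power2_eq_square right_diff_distrib)
  finally show ?thesis .
qed

end

section \<open>Long empty windows\<close>

lemma pigeonhole_fiber:
  assumes "finite A" "finite C" "f ` A \<subseteq> C" "C \<noteq> {}"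
  obtains c where "c \<in> C" "real (card A) \<le> card C * card {a\<in>A. f a = c}"
proof -
  have "\<exists>c\<in>C. real (card A) \<le> card C * card {a\<in>A. f a = c}"
  proof (rule ccontr)
    assume neg: "\<not> ?thesis"
    have c0: "card C > 0" using assms by (simp add: card_gt_0_iff)
    have "real (card A) = (\<Sum>c\<in>C. real (card {a\<in>A. f a = c}))"
    proof -
      have "(\<Sum>a\<in>A. 1::real) = (\<Sum>c\<in>C. \<Sum>a\<in>{a\<in>A. f a = c}. 1)"
        using assms by (intro sum.group[symmetric])
      then show ?thesis by simp
    qed
    also have "\<dots> < (\<Sum>c\<in>C. card A / card C)"
      using neg c0 assms by (intro sum_strict_mono) (auto simp: less_divide_eq mult.commute not_le)
    also have "\<dots> = card A" using c0 by simp
    finally show False by simp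
  qed
  then show ?thesis using that by blast
qed

context residue_setting
begin

lemma finite_empty_windows: "finite (empty_windows b L)"
  unfolding empty_windows_def by (rule finite_subset[of _ "{0..<int M}"]) auto

text \<open>At each p of T a unit b acts on the Legendre symbol of \<open>b * v\<close> only through
  its own symbol.\<close>

lemma QuadRes_twist:
  assumes "coprime b (int M)" "coprime c (int M)" "[b = c] (mod int q)"
    and "\<And>p. p \<in> T \<Longrightarrow> QuadRes (int p) b \<longleftrightarrow> QuadRes (int p) c"
  shows "QuadRes (int M) (b * v) \<longleftrightarrow> QuadRes (int M) (c * v)"
proof -
  have "QuadRes (int q) (b * v) \<longleftrightarrow> QuadRes (int q) (c * v)"
    using assms(3) by (intro QuadRes_cong cong_mult) auto
  moreover have "QuadRes (int p) (b * v) \<longleftrightarrow> QuadRes (int p) (c * v)" if p: "p \<in> T" for p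
  proof -
    have pp: "prime p" "p > 2" using T[OF p] by auto
    have "p dvd M" unfolding M_def using p finT by (intro dvd_mult dvd_prodI) auto
    then have "int p dvd int M" by (simp only: int_dvd_int_iff)
    then have nd: "\<not> int p dvd b" "\<not> int p dvd c"
      using assms(1,2) pp(1) by (metis coprime_common_divisor not_prime_unit prime_nat_int_transfer)+
    then have "Legendre b (int p) = Legendre c (int p)"
      using assms(4)[OF p] by (simp add: Legendre_def cong_0_iff)
    then show ?thesis by (simp add: QuadRes_iff_Legendre Legendre_mult[OF pp])
  qed
  ultimately show ?thesis unfolding QuadRes_M by blast
qed

text \<open>Dividing an empty window of length \<open>H\<close> by a prime \<open>b \<le> B\<close> yields windows of length \<open>J\<close> that are empty for the
  twisted set \<open>{v. b v is a square}\<close>, which depends only on \<open>b\<close> modulo \<open>q\<close> and on the Legendre symbols of \<open>b\<close>.\<close>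

lemma card_empty_windows_large_sieve:
  fixes \<delta> :: real
  assumes \<delta>: "\<And>b. coprime b (int M) \<Longrightarrow> card (empty_windows b J) \<le> \<delta> * M" and \<delta>2: "\<delta> \<le> 1 / 2"
    and B: "0 < B" "B \<le> h" "h + B * J \<le> H"
  shows "real (card (empty_windows 1 H)) * card {b. prime b \<and> b \<le> B \<and> coprime b M}
         \<le> q * 2 ^ card T * (20 * log 2 ((real B + 1) * M) * \<delta> * M)"
proof -
  define BB0 where "BB0 = {b. prime b \<and> b \<le> B \<and> coprime b M}"
  define key where "key b = (b mod q, {p\<in>T. QuadRes (int p) (int b)})" for b
  define C where "C = {0..<q} \<times> Pow T"
  have finBB0: "finite BB0" unfolding BB0_def by (rule finite_subset[of _ "{..B}"]) auto
  have cardC: "card C = q * 2 ^ card T" using finT by (simp add: C_def card_Pow)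
  \<comment> \<open>The large sieve needs one set D for all its primes; primes with a common key
    share their twisted set. The pigeonhole costs the number of keys,
    \<open>q * 2 ^ card T\<close>.\<close>
  obtain c where c: "real (card BB0) \<le> card C * card {b\<in>BB0. key b = c}"
  proof (rule pigeonhole_fiber[OF finBB0, of C key])
    show "key ` BB0 \<subseteq> C" using q0 by (auto simp: key_def C_def)
    show "C \<noteq> {}" using q0 by (auto simp: C_def)
    show "finite C" using finT by (simp add: C_def)
  qed
  define BB where "BB = {b\<in>BB0. key b = c}"
  define \<kappa> where "\<kappa> = 5 * log 2 ((real B + 1) * M)"
  have \<delta>0: "0 \<le> \<delta> * M" using \<delta>[of 1] by simp
  have kap0: "\<kappa> \<ge> 0"
    using one_le_Suc_mult_pos[of "int M" B] M_pos by (simp add: \<kappa>_def)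
  have main: "real (card (empty_windows 1 H)) * card BB \<le> 4 * \<kappa> * \<delta> * M"
  proof (cases "BB = {}")
    case True
    then show ?thesis using \<delta>0 kap0 by (simp add: mult.assoc)
  next
    case False
    then obtain b0 where b0: "b0 \<in> BB" by blast
    have cop: "coprime (int b) (int M)" if "b \<in> BB" for b
      using that by (simp add: BB_def BB0_def)
    define D where "D = empty_windows (int b0) J"
    have "real (card (empty_windows 1 H)) * card BB * (real_of_int (int M) - card D)\<^sup>2 \<le> 5 * log 2 ((real B + 1) * int M) * (int M)\<^sup>2 * card D"
    proof (rule large_sieve_dilates[OF _ _ _ B(1,2)])
      show "int M > 0" using M_pos by simp
      show "finite BB" using finBB0 by (simp add: BB_def)
      show "prime b \<and> b \<le> B \<and> coprime (int b) (int M)" if "b \<in> BB" for b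
        using that by (simp add: BB_def BB0_def)
      show "D \<subseteq> {0..<int M}" "empty_windows 1 H \<subseteq> {0..<int M}" by (auto simp: D_def empty_windows_def)
      fix z b s y
      assume z: "z \<in> empty_windows 1 H" and b: "b \<in> BB" and s: "s < h" and y: "y \<in> {0..<int M}"
        and eq: "[int b * y = z + int s] (mod int M)"
      have tw: "QuadRes (int M) (int b0 * v) \<longleftrightarrow> QuadRes (int M) (int b * v)" for v
      proof (rule QuadRes_twist[OF cop[OF b0] cop[OF b]])
        have "key b0 = key b" using b b0 by (simp add: BB_def)
        then have k: "b0 mod q = b mod q" "{p\<in>T. QuadRes (int p) (int b0)} = {p\<in>T. QuadRes (int p) (int b)}"
          by (simp_all add: key_def)
        have "[b0 = b] (mod q)" using k(1) by (simp add: cong_def)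
        then show "[int b0 = int b] (mod int q)" by (simp only: cong_int_iff)
        show "QuadRes (int p) (int b0) \<longleftrightarrow> QuadRes (int p) (int b)" if "p \<in> T" for p using k(2) that by blast
      qed
      have "\<not> QuadRes (int M) (int b0 * (y + i))" if i: "i \<in> {1..int J}" for i
      proof
        assume "QuadRes (int M) (int b0 * (y + i))"
        then have "QuadRes (int M) (int b * (y + i))" using tw by simp
        moreover have "[int b * (y + i) = z + (int s + int b * i)] (mod int M)"
          using cong_add[OF eq cong_refl[of "int b * i" "int M"]] by (simp add: algebra_simps)
        ultimately have "QuadRes (int M) (z + (int s + int b * i))" using QuadRes_cong by blast
        moreover have "int s + int b * i \<in> {1..int H}"
        proof -
          have b1: "1 \<le> int b" "int b \<le> int B" using b by (auto simp: BB_def BB0_def Suc_le_eq prime_gt_0_nat)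
          have "1 * 1 \<le> int b * i" using b1 i by (intro mult_mono) auto
          moreover have "int b * i \<le> int B * int J" using b1 i by (intro mult_mono) auto
          moreover have "int h + int B * int J \<le> int H" using B(3) by (metis of_nat_add of_nat_le_iff of_nat_mult)
          ultimately show ?thesis using s by auto
        qed
        ultimately show False using z by (auto simp: empty_windows_def)
      qed
      then show "y \<in> D" using y by (simp add: D_def empty_windows_def)
    qed
    then have ls: "real (card (empty_windows 1 H)) * card BB * (real M - card D)\<^sup>2 \<le> \<kappa> * (real M)\<^sup>2 * card D"
      by (simp add: \<kappa>_def)
    have D: "real (card D) \<le> \<delta> * M" unfolding D_def by (rule \<delta>[OF cop[OF b0]])
    moreover have "\<delta> * M \<le> 1 / 2 * M" using \<delta>2 by (intro mult_right_mono) auto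
    \<comment> \<open>The complement of D keeps at least half of all residues; squared, this is the
      factor 4 that turns 5 into 20.\<close>
    ultimately have "real M / 2 \<le> real M - card D" by simp
    then have "(real M / 2)\<^sup>2 \<le> (real M - card D)\<^sup>2" by (intro power_mono) auto
    then have "real (card (empty_windows 1 H)) * card BB * (real M / 2)\<^sup>2 \<le> real (card (empty_windows 1 H)) * card BB * (real M - card D)\<^sup>2"
      by (intro mult_left_mono) auto
    also note ls
    also have "\<kappa> * (real M)\<^sup>2 * card D \<le> \<kappa> * (real M)\<^sup>2 * (\<delta> * M)" using D kap0 by (intro mult_left_mono) auto
    finally have "(real (card (empty_windows 1 H)) * card BB) * (real M)\<^sup>2 \<le> (4 * \<kappa> * \<delta> * M) * (real M)\<^sup>2"
      by (simp add: power2_eq_square algebra_simps)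
    then show ?thesis using M_pos by simp
  qed
  have "real (card (empty_windows 1 H)) * card BB0 \<le> real (card (empty_windows 1 H)) * (card C * card BB)"
    using c by (intro mult_left_mono) (auto simp: BB_def)
  also have "\<dots> = card C * (real (card (empty_windows 1 H)) * card BB)" by simp
  also have "\<dots> \<le> card C * (4 * \<kappa> * \<delta> * M)" using main by (intro mult_left_mono) auto
  finally show ?thesis by (simp add: cardC \<kappa>_def BB0_def)
qed

lemma empty_windows_antimono: "L \<le> L' \<Longrightarrow> card (empty_windows b L') \<le> card (empty_windows b L)"
  by (intro card_mono finite_empty_windows) (auto simp: empty_windows_def)

text \<open>Over whole periods the local count is \<open>e * g\<close> for every class u and every
  unit b, so the bound is uniform in the twist.\<close>

lemma card_empty_windows_full_periods:
  assumes b: "coprime b (int M)" and L: "q * g \<le> y" and K: "even K" and \<kappa>: "e * g * \<alpha> \<le> \<kappa>"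
  shows "real (card (empty_windows b (q * g))) \<le> M * ((1 - \<alpha>) ^ (e * g) + window_error K \<kappa>)"
proof -
  have bq: "coprime b (int q)" using b by (simp add: M_def)
  have "real (card (empty_windows b (q * g))) \<le> \<Prod>T * (\<Sum>u\<in>{0..<int q}. (1 - \<alpha>) ^ local_count b u (q * g) + window_error K \<kappa>)"
    using \<kappa> by (intro card_empty_windows_le[OF b L K]) (simp add: local_count_mult[OF bq])
  then show ?thesis by (simp add: local_count_mult[OF bq] M_def mult.assoc mult.left_commute)
qed

lemma sum_card_empty_windows_head:
  assumes q3: "q \<ge> 3" and small: "real q ^ 3 * \<alpha> \<le> 1 / 2"
    and L: "q * g \<le> y" and K: "even K" and \<kappa>: "e * g * \<alpha> \<le> \<kappa>"
  shows "(\<Sum>L<q * g. real (card (empty_windows 1 L))) \<le> M * (q / (e * \<alpha>) - 1 / (4 * q) + q * g * window_error K \<kappa>)"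
proof -
  have "(\<Sum>L<q * g. real (card (empty_windows 1 L)))
     \<le> (\<Sum>L<q * g. \<Prod>T * (\<Sum>u\<in>{0..<int q}. (1 - \<alpha>) ^ local_count 1 u L + window_error K \<kappa>))"
  proof (intro sum_mono card_empty_windows_le K)
    fix L' u assume "L' \<in> {..<q * g}"
    then have "local_count 1 u L' \<le> local_count 1 u (q * g)" by (intro local_count_mono) simp
    then have "local_count 1 u L' \<le> e * g" by (simp add: local_count_mult)
    then have "real (local_count 1 u L') \<le> real (e * g)" by (simp only: of_nat_le_iff)
    then have "local_count 1 u L' * \<alpha> \<le> real (e * g) * \<alpha>" using \<alpha>_bounds by (intro mult_right_mono) auto
    then show "local_count 1 u L' * \<alpha> \<le> \<kappa>" using \<kappa> by simp
    show "L' \<le> y" using \<open>L' \<in> {..<q * g}\<close> L by simp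
  qed simp
  also have "\<dots> = \<Prod>T * ((\<Sum>u\<in>{0..<int q}. \<Sum>L<q * g. (1 - \<alpha>) ^ local_count 1 u L) + q * (q * g) * window_error K \<kappa>)"
  proof -
    have "(\<Sum>u\<in>{0..<int q}. \<Sum>L<q * g. (1 - \<alpha>) ^ local_count 1 u L) = (\<Sum>L<q * g. \<Sum>u\<in>{0..<int q}. (1 - \<alpha>) ^ local_count 1 u L)"
      by (rule sum.swap)
    then show ?thesis by (simp add: sum_distrib_left[symmetric] sum.distrib algebra_simps)
  qed
  also have "\<dots> \<le> \<Prod>T * (q * (q / (e * \<alpha>) - 1 / (4 * q)) + q * (q * g) * window_error K \<kappa>)"
    using model_sum_le[OF q3 small, of g] by (intro mult_left_mono add_right_mono of_nat_0_le_iff)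
  also have "\<dots> = M * (q / (e * \<alpha>) - 1 / (4 * q) + q * g * window_error K \<kappa>)"
    by (simp add: M_def algebra_simps)
  finally show ?thesis .
qed

lemma card_QuadRes_M:
  defines "k \<equiv> card {x\<in>{0..<int M}. QuadRes (int M) x}"
  shows "real k \<le> e * \<Prod>T * \<alpha> * (1 + pattern_error 1)" "e * \<Prod>T * \<alpha> * (1 - pattern_error 1) \<le> real k"
proof -
  define N where "N p = card {x\<in>{0..<int p}. QuadRes (int p) x}" for p :: nat
  \<comment> \<open>44 is \<open>22 * 1 * 2 ^ 1\<close>, matching
    \<open>pattern_error 1\<close>.\<close>
  define \<eta> where "\<eta> = 44 / sqrt y"
  have per: "QuadRes (int n) (x mod int n) = QuadRes (int n) x" for n x
    by (rule QuadRes_cong) (simp add: cong_def)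
  have "card {x\<in>{0..<int (q * \<Prod>T)}. QuadRes (int q) x \<and> (\<forall>p\<in>T. QuadRes (int p) x)} = card {x\<in>{0..<int q}. QuadRes (int q) x} * (\<Prod>p\<in>T. N p)"
    unfolding N_def using T by (intro card_crt_prod finT q0 per) auto
  then have k: "k = e * (\<Prod>p\<in>T. N p)" unfolding k_def QuadRes_M e_def unfolding M_def .
  have near: "\<bar>real (N p) * 2 / p - 1\<bar> \<le> \<eta>" if p: "p \<in> T" for p
  proof -
    have pp: "prime p" "p > 2" "y < p" using T[OF p] by auto
    have "\<not> int p dvd 1" using pp by (auto simp: zdvd1_eq)
    from card_QuadRes_pattern[OF pp(1,2) this, of "{0}"]
    have "\<bar>real (N p) - p / 2\<bar> \<le> 22 * sqrt p" by (simp add: N_def)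
    then have "\<bar>real (N p) - p / 2\<bar> * (2 / p) \<le> 22 * sqrt p * (2 / p)" by (intro mult_right_mono) auto
    also have "\<bar>real (N p) - p / 2\<bar> * (2 / p) = \<bar>(real (N p) - p / 2) * (2 / p)\<bar>" by (rule abs_mult_pos) simp
    also have "(real (N p) - p / 2) * (2 / p) = real (N p) * 2 / p - 1" using pp by (simp add: field_simps)
    also have "22 * sqrt p * (2 / p) = 44 / sqrt p" using pp by (simp add: field_simps)
    also have "\<dots> \<le> 44 / sqrt y" using pp y0 by (intro divide_left_mono) auto
    finally show ?thesis by (simp add: \<eta>_def)
  qed
  have "(\<Prod>p\<in>T. real (N p)) = (\<Prod>p\<in>T. real p / 2 * (real (N p) * 2 / p))"
  proof (rule prod.cong[OF refl])
    fix p assume "p \<in> T"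
    then have "p > 0" using T[of p] by auto
    then show "real (N p) = real p / 2 * (real (N p) * 2 / p)" by simp
  qed
  also have "\<dots> = (\<Prod>p\<in>T. real p / 2) * (\<Prod>p\<in>T. real (N p) * 2 / p)" by (rule prod.distrib)
  also have "(\<Prod>p\<in>T. real p / 2) = real (\<Prod>T) * \<alpha>" by (simp add: prod_dividef \<alpha>_def)
  finally have kk: "real k = e * \<Prod>T * \<alpha> * (\<Prod>p\<in>T. real (N p) * 2 / p)" by (simp add: k)
  have "\<bar>(\<Prod>p\<in>T. real (N p) * 2 / p) - 1\<bar> \<le> (1 + \<eta>) ^ card T - 1"
    using near by (intro prod_near_one finT) (auto simp: \<eta>_def)
  then have pe: "\<bar>(\<Prod>p\<in>T. real (N p) * 2 / p) - 1\<bar> \<le> pattern_error 1" by (simp add: pattern_error_def \<eta>_def)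
  have nn: "0 \<le> e * \<Prod>T * \<alpha>" using \<alpha>_bounds by (intro mult_nonneg_nonneg of_nat_0_le_iff) auto
  show "real k \<le> e * \<Prod>T * \<alpha> * (1 + pattern_error 1)" "e * \<Prod>T * \<alpha> * (1 - pattern_error 1) \<le> real k"
    unfolding kk using pe nn by (intro mult_left_mono; simp)+
qed

end

section \<open>Moduli of the family\<close>

lemma exp_nat_mult_ln:
  assumes "x > 0" shows "exp (real n * ln x) = x ^ n"
  using assms by (simp add: exp_of_nat_mult)

lemma exp_2_le_8: "exp (2::real) \<le> 8"
proof -
  have "exp (2::real) = exp 1 * exp 1" by (simp flip: exp_add)
  also have "\<dots> \<le> (272/100) * (272/100)" using e_less_272 by (intro mult_mono) auto
  finally show ?thesis by simp
qed

text \<open>K is about 100 ln \<Lambda>. As ln 2 lies between 2/3 and 25/36, 2^K lies between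
  \<Lambda>^66, enough to kill the cut-off part, and about \<Lambda>^70, which sqrt y >=
  \<Lambda>^110 still outweighs.\<close>

lemma truncation_level:
  fixes \<Lambda> :: real
  assumes "\<Lambda> \<ge> 20000"
  obtains K where "even K" "1 \<le> K" "real K \<le> 100 * ln \<Lambda> + 2" "\<Lambda> ^ 66 \<le> 2 ^ K" "2 ^ K \<le> exp 2 * \<Lambda> ^ 70"
proof
  define K where "K = 2 * nat \<lceil>50 * ln \<Lambda>\<rceil>"
  have l0: "ln \<Lambda> > 0" using assms by simp
  have K: "100 * ln \<Lambda> \<le> real K" "real K \<le> 100 * ln \<Lambda> + 2"
    using l0 unfolding K_def by linarith+
  show "even K" by (simp add: K_def)
  show "1 \<le> K" using K l0 by (cases K) auto
  show "real K \<le> 100 * ln \<Lambda> + 2" by (rule K)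
  have two: "(2::real) ^ K = exp (K * ln 2)" by (simp add: exp_of_nat_mult)
  have "real 66 * ln \<Lambda> \<le> 100 * ln \<Lambda> * ln 2" using ln2_ge_two_thirds l0 by simp
  also have "\<dots> \<le> real K * ln 2" using K by (intro mult_right_mono) auto
  finally show "\<Lambda> ^ 66 \<le> 2 ^ K"
    unfolding two using exp_nat_mult_ln[of \<Lambda> 66] assms by (metis exp_le_cancel_iff less_le_trans zero_less_numeral)
  have "real K * ln 2 \<le> (100 * ln \<Lambda> + 2) * (25 / 36)" using K ln2_le_25_over_36 l0 by (intro mult_mono) auto
  also have "\<dots> \<le> 2 + real 70 * ln \<Lambda>" using l0 by simp
  finally have "2 ^ K \<le> exp (2 + real 70 * ln \<Lambda>)" unfolding two by simp
  also have "\<dots> = exp 2 * \<Lambda> ^ 70" using exp_nat_mult_ln[of \<Lambda> 70] assms by (simp add: exp_add)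
  finally show "2 ^ K \<le> exp 2 * \<Lambda> ^ 70" .
qed

lemma inverse_power_mono: "(x::real) \<ge> 1 \<Longrightarrow> m \<le> n \<Longrightarrow> 1 / x ^ n \<le> 1 / x ^ m"
  by (intro divide_left_mono power_increasing) auto

lemma inverse_power_absorb: "(x::real) > 0 \<Longrightarrow> c \<le> x ^ m \<Longrightarrow> c / x ^ (n + m) \<le> 1 / x ^ n"
  by (simp add: field_simps power_add)

lemma card_prime_divisors_le_log_nat:
  fixes n :: nat
  assumes "n > 0" shows "real (card {b. prime b \<and> b dvd n}) \<le> log 2 n"
proof -
  have "finite {b. prime b \<and> b dvd n}"
    by (rule finite_subset[of _ "{..n}"]) (use assms dvd_imp_le in auto)
  then have "real (card {b. prime b \<and> b dvd n}) \<le> log 2 \<bar>real_of_int (int n)\<bar>"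
    using assms by (intro card_prime_divisors_le_log) (auto simp: int_dvd_int_iff)
  then show ?thesis by simp
qed

text \<open>\<Lambda> stands for ln N. With q <= \<Lambda>^(1/20), the bound \<alpha> <=
  \<Lambda>^(-1/4) makes \<open>q^3 * \<alpha>\<close> small; \<alpha> >= \<Lambda>^(-2) keeps
  window lengths and pigeonhole losses polynomial in \<Lambda>. The value 20000 lets a factor
  \<Lambda> absorb every numerical constant.\<close>

locale good_modulus = residue_setting +
  fixes \<Lambda> :: real
  assumes \<Lambda>: "\<Lambda> \<ge> 20000" and q3: "q \<ge> 3" and q20: "real q ^ 20 \<le> \<Lambda>"
    and r_lower: "\<Lambda> \<le> (2 ^ card T) ^ 4" and r_upper: "2 ^ card T \<le> \<Lambda> ^ 2"
    and y: "\<Lambda> ^ 220 \<le> real y" and M_upper: "ln (real M) \<le> \<Lambda>"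
begin

lemma \<Lambda>1: "\<Lambda> \<ge> 1" "\<Lambda> > 0" using \<Lambda> by auto

lemma ln_\<Lambda>: "0 < ln \<Lambda>" "ln \<Lambda> \<le> \<Lambda>"
proof -
  show "0 < ln \<Lambda>" using \<Lambda> by simp
  show "ln \<Lambda> \<le> \<Lambda>" using ln_le_minus_one[of \<Lambda>] \<Lambda> by simp
qed

lemma q_le: "real q \<le> \<Lambda>"
proof -
  have "real q ^ 1 \<le> real q ^ 20" using q3 by (intro power_increasing) auto
  then show ?thesis using q20 unfolding power_one_right by linarith
qed

lemma \<alpha>_lower: "1 / \<Lambda> ^ 2 \<le> \<alpha>"
  unfolding \<alpha>_def using r_upper by (intro divide_left_mono) (use \<Lambda>1 in auto)

text \<open>The 20th power turns the exponents 3/20 and 1/4 into integers, with the margin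
  \<open>\<Lambda> ^ 3 / \<Lambda> ^ 5\<close>.\<close>

lemma q3\<alpha>: "real q ^ 3 * \<alpha> \<le> 1 / 2"
proof (rule ccontr)
  assume "\<not> ?thesis"
  then have "(1 / 2) ^ 20 < (real q ^ 3 * \<alpha>) ^ 20" by (intro power_strict_mono) auto
  also have "\<dots> = (real q ^ 20) ^ 3 / ((2 ^ card T) ^ 4) ^ 5"
    by (simp add: \<alpha>_def power_mult_distrib power_divide flip: power_mult)
  also have "\<dots> \<le> \<Lambda> ^ 3 / \<Lambda> ^ 5"
    using q20 r_lower \<Lambda>1 by (intro frac_le power_mono) auto
  also have "\<dots> = 1 / \<Lambda> ^ 2" using \<Lambda>1 by (simp add: field_simps)
  also have "\<dots> \<le> 1 / 20000 ^ 2" using \<Lambda> by (intro divide_left_mono power_mono) auto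
  finally show False by (simp add: power_divide)
qed

lemma e\<alpha>: "0 < e * \<alpha>" "e * \<alpha> \<le> 1"
proof -
  show "0 < e * \<alpha>" using e_pos \<alpha>_bounds by simp
  have "real e \<le> real q ^ 1" using e_less_q[OF q3] by simp
  also have "\<dots> \<le> real q ^ 3" using q3 by (intro power_increasing) auto
  finally have "e * \<alpha> \<le> real q ^ 3 * \<alpha>" using \<alpha>_bounds by (intro mult_right_mono) auto
  then show "e * \<alpha> \<le> 1" using q3\<alpha> by simp
qed

lemma cardT_le: "real (card T) \<le> \<Lambda>"
proof -
  have "real (card T) * (2 / 3) \<le> real (card T) * ln 2" using ln2_ge_two_thirds by (intro mult_left_mono) auto
  also have "\<dots> = ln (2 ^ card T)" by (simp add: ln_realpow)
  also have "\<dots> \<le> ln (\<Lambda> ^ 2)" using r_upper \<Lambda>1 by (subst ln_le_cancel_iff) auto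
  also have "\<dots> = 2 * ln \<Lambda>" using \<Lambda>1 by (simp add: ln_realpow)
  finally have 1: "real (card T) \<le> 3 * ln \<Lambda>" by simp
  have "ln \<Lambda> = 2 * ln (sqrt \<Lambda>)" using \<Lambda>1 by (simp add: ln_sqrt)
  also have "\<dots> \<le> 2 * sqrt \<Lambda>" using ln_le_minus_one[of "sqrt \<Lambda>"] \<Lambda>1 by simp
  finally have "3 * ln \<Lambda> \<le> 6 * sqrt \<Lambda>" by simp
  also have "\<dots> \<le> sqrt \<Lambda> * sqrt \<Lambda>"
  proof (rule mult_right_mono)
    have "sqrt 36 \<le> sqrt \<Lambda>" using \<Lambda> by (intro real_sqrt_le_mono) auto
    moreover have "sqrt 36 = (6::real)" by (rule real_sqrt_unique) auto
    ultimately show "6 \<le> sqrt \<Lambda>" by simp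
  qed (use \<Lambda>1 in simp)
  finally show ?thesis using 1 \<Lambda>1 by simp
qed

lemma pattern_error_le:
  assumes "real K \<le> 100 * ln \<Lambda> + 2" "2 ^ K \<le> exp 2 * \<Lambda> ^ 70"
  shows "pattern_error K \<le> 1 / \<Lambda> ^ 36"
proof -
  define \<eta> where "\<eta> = 22 * K * 2 ^ K / sqrt y"
  have "\<Lambda> ^ 110 = sqrt (\<Lambda> ^ 220)" using \<Lambda>1 by (intro real_sqrt_unique[symmetric]) (auto simp flip: power_mult)
  also have "\<dots> \<le> sqrt y" using y by (rule real_sqrt_le_mono)
  finally have sy: "\<Lambda> ^ 110 \<le> sqrt y" .
  have "22 * real K \<le> 22 * (102 * \<Lambda>)" using assms(1) ln_\<Lambda> \<Lambda> by simp
  then have "22 * real K * 2 ^ K \<le> 22 * (102 * \<Lambda>) * (8 * \<Lambda> ^ 70)"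
    using assms(2) exp_2_le_8 \<Lambda>1 by (intro mult_mono) (auto intro: order_trans[OF _ mult_right_mono])
  then have "\<eta> \<le> 22 * (102 * \<Lambda>) * (8 * \<Lambda> ^ 70) / \<Lambda> ^ 110"
    unfolding \<eta>_def using sy \<Lambda>1 by (intro frac_le) auto
  \<comment> \<open>17952 = 22 * 102 * 8 is the constant that decides the size of the bound on
    \<Lambda>.\<close>
  also have "22 * (102 * \<Lambda>) * (8 * \<Lambda> ^ 70) = (17952 * \<Lambda> ^ 70) * \<Lambda>" by simp
  also have "(17952 * \<Lambda> ^ 70) * \<Lambda> / \<Lambda> ^ 110 \<le> (\<Lambda> * \<Lambda> ^ 70) * \<Lambda> / \<Lambda> ^ 110"
    using \<Lambda> by (intro divide_right_mono mult_right_mono) auto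
  also have "\<dots> = 1 / \<Lambda> ^ 38" using \<Lambda>1 by (simp add: field_simps flip: power_Suc power_add)
  finally have \<eta>: "\<eta> \<le> 1 / \<Lambda> ^ 38" .
  have \<eta>0: "\<eta> \<ge> 0" by (simp add: \<eta>_def)
  have r\<eta>: "card T * \<eta> \<le> 1 / \<Lambda> ^ 37"
  proof -
    have "card T * \<eta> \<le> \<Lambda> * (1 / \<Lambda> ^ 38)" using cardT_le \<eta> \<eta>0 \<Lambda>1 by (intro mult_mono) auto
    also have "\<dots> = 1 / \<Lambda> ^ 37" using \<Lambda>1 by (simp add: field_simps flip: power_Suc)
    finally show ?thesis .
  qed
  have r\<eta>1: "card T * \<eta> \<le> 1" using r\<eta> inverse_power_mono[OF \<Lambda>1(1), of 0 37] by simp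
  have "(1 + \<eta>) ^ card T \<le> exp \<eta> ^ card T" using \<eta>0 by (intro power_mono exp_ge_add_one_self) auto
  also have "\<dots> = exp (card T * \<eta>)" by (simp add: exp_of_nat_mult)
  also have "\<dots> \<le> 1 + card T * \<eta> + (card T * \<eta>)\<^sup>2" using r\<eta>1 \<eta>0 by (intro exp_bound) auto
  also have "\<dots> \<le> 1 + 2 * (card T * \<eta>)"
  proof -
    have "(card T * \<eta>)\<^sup>2 \<le> card T * \<eta>"
      unfolding power2_eq_square using r\<eta>1 \<eta>0 by (intro mult_left_le_one_le) auto
    then show ?thesis by linarith
  qed
  finally have "pattern_error K \<le> 2 * (card T * \<eta>)" by (simp add: pattern_error_def \<eta>_def)
  also have "\<dots> \<le> 2 * (1 / \<Lambda> ^ (36 + 1))" using r\<eta> by simp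
  also have "\<dots> \<le> 1 / \<Lambda> ^ 36" using inverse_power_absorb[of \<Lambda> 2 1 36] \<Lambda> by simp
  finally show ?thesis .
qed

lemma pattern_error_1_le: "pattern_error 1 \<le> 1 / \<Lambda> ^ 36"
proof (rule pattern_error_le)
  show "real 1 \<le> 100 * ln \<Lambda> + 2" using ln_\<Lambda> by simp
  have "2 * 1 \<le> exp 2 * \<Lambda> ^ 70"
    using \<Lambda>1 exp_ge_add_one_self[of "2::real"] by (intro mult_mono) (auto simp: one_le_power)
  then show "2 ^ 1 \<le> exp 2 * \<Lambda> ^ 70" by simp
qed

text \<open>For \<kappa> = 16 ln \<Lambda> + 1 the factor exp (2 \<kappa>) is about \<Lambda>^32
  against \<open>2 ^ K \<ge> \<Lambda> ^ 66\<close>, and exp \<kappa> about \<Lambda>^16 against a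
  pattern error of at most \<Lambda>^-36.\<close>

lemma window_error_le:
  assumes "real K \<le> 100 * ln \<Lambda> + 2" "2 ^ K \<le> exp 2 * \<Lambda> ^ 70" "\<Lambda> ^ 66 \<le> 2 ^ K"
  shows "window_error K (16 * ln \<Lambda> + 1) \<le> 1 / \<Lambda> ^ 18"
proof -
  have e1: "exp (16 * ln \<Lambda> + 1) \<le> 8 * \<Lambda> ^ 16"
  proof -
    have "exp (16 * ln \<Lambda> + 1) = exp (real 16 * ln \<Lambda>) * exp 1" by (simp add: exp_add)
    also have "\<dots> = \<Lambda> ^ 16 * exp 1" by (simp only: exp_nat_mult_ln[OF \<Lambda>1(2)])
    also have "\<dots> \<le> \<Lambda> ^ 16 * 8" using e_less_272 \<Lambda>1 by (intro mult_left_mono) auto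
    finally show ?thesis by simp
  qed
  have e2: "exp (2 * (16 * ln \<Lambda> + 1)) \<le> 8 * \<Lambda> ^ 32"
  proof -
    have "exp (2 * (16 * ln \<Lambda> + 1)) = exp (real 32 * ln \<Lambda>) * exp 2" by (simp flip: exp_add)
    also have "\<dots> = \<Lambda> ^ 32 * exp 2" by (simp only: exp_nat_mult_ln[OF \<Lambda>1(2)])
    also have "\<dots> \<le> \<Lambda> ^ 32 * 8" using exp_2_le_8 \<Lambda>1 by (intro mult_left_mono) auto
    finally show ?thesis by simp
  qed
  have "exp (2 * (16 * ln \<Lambda> + 1)) / 2 ^ K \<le> 8 * \<Lambda> ^ 32 / \<Lambda> ^ 66"
    using e2 assms(3) \<Lambda>1 by (intro frac_le) auto
  also have "\<dots> = 8 / \<Lambda> ^ (33 + 1)" using \<Lambda>1 by (simp add: field_simps flip: power_add)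
  also have "\<dots> \<le> 1 / \<Lambda> ^ 33" using \<Lambda> by (intro inverse_power_absorb) auto
  also have "\<dots> \<le> 1 / \<Lambda> ^ 19" by (intro inverse_power_mono \<Lambda>1) auto
  finally have 1: "exp (2 * (16 * ln \<Lambda> + 1)) / 2 ^ K \<le> 1 / \<Lambda> ^ 19" .
  have "pattern_error K * exp (16 * ln \<Lambda> + 1) \<le> 1 / \<Lambda> ^ 36 * (8 * \<Lambda> ^ 16)"
    using pattern_error_le[OF assms(1,2)] e1 \<Lambda>1 by (intro mult_mono) auto
  also have "\<dots> = 8 / \<Lambda> ^ (19 + 1)" using \<Lambda>1 by (simp add: field_simps flip: power_add)
  also have "\<dots> \<le> 1 / \<Lambda> ^ 19" using \<Lambda> by (intro inverse_power_absorb) auto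
  finally have "window_error K (16 * ln \<Lambda> + 1) \<le> 2 / \<Lambda> ^ (18 + 1)" using 1 by (simp add: window_error_def)
  also have "\<dots> \<le> 1 / \<Lambda> ^ 18" using \<Lambda> by (intro inverse_power_absorb) auto
  finally show ?thesis .
qed

end

section \<open>Short and long windows for a good modulus\<close>

lemma harm_le_one_plus_ln: "n > 0 \<Longrightarrow> harm n \<le> 1 + ln (real n)"
  using euler_mascheroni_sequence_decreasing[of 1 n] by (simp add: harm_def)

lemma half_le_floor_div:
  fixes a b :: nat
  assumes "a div b \<ge> 1" shows "real a / (2 * real b) \<le> real (a div b)"
proof -
  have b0: "b > 0" using assms by (cases b) auto
  have "a < (a div b + 1) * b" using dividend_less_div_times[OF b0, of a] by (simp add: algebra_simps)
  also have "\<dots> \<le> (2 * (a div b)) * b" using assms by (intro mult_right_mono) auto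
  finally have "real a \<le> real (2 * (a div b) * b)" by (simp only: of_nat_le_iff)
  then have "real a \<le> 2 * real (a div b) * real b" by simp
  then show ?thesis using b0 by (simp add: field_simps)
qed

context good_modulus
begin

text \<open>The number of periods after which a window holds about 16 ln \<Lambda> squares on
  average, so that it is empty with probability about \<Lambda>^-16.\<close>

definition g :: nat where "g = nat \<lceil>16 * ln \<Lambda> / (e * \<alpha>)\<rceil>"

text \<open>The dividing line: shorter windows are treated by the Bonferroni estimate, longer ones
  by the large sieve.\<close>

definition J :: nat where "J = q * g"

lemma g_bounds: "16 * ln \<Lambda> \<le> e * g * \<alpha>" "e * g * \<alpha> \<le> 16 * ln \<Lambda> + 1" "1 \<le> g"
proof -
  define x where "x = 16 * ln \<Lambda> / (e * \<alpha>)"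
  have x0: "x > 0" using ln_\<Lambda> e\<alpha> by (simp add: x_def)
  have gx: "x \<le> g" "g \<le> x + 1" using x0 unfolding g_def x_def[symmetric] by linarith+
  have xe: "x * (e * \<alpha>) = 16 * ln \<Lambda>"
    using e\<alpha>(1) nonzero_eq_divide_eq[of "e * \<alpha>" x "16 * ln \<Lambda>"] x_def by linarith
  have "x * (e * \<alpha>) \<le> g * (e * \<alpha>)" using gx e\<alpha> by (intro mult_right_mono) auto
  then show "16 * ln \<Lambda> \<le> e * g * \<alpha>" using xe by (simp add: mult.commute mult.left_commute)
  have "g * (e * \<alpha>) \<le> (x + 1) * (e * \<alpha>)" using gx e\<alpha> by (intro mult_right_mono) auto
  also have "\<dots> \<le> 16 * ln \<Lambda> + 1" using xe e\<alpha> by (simp add: ring_distribs)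
  finally show "e * g * \<alpha> \<le> 16 * ln \<Lambda> + 1" by (simp add: mult.commute mult.left_commute)
  show "1 \<le> g" using gx x0 by (cases g) auto
qed

lemma J_bounds: "1 \<le> J" "real J \<le> \<Lambda> ^ 5" "J \<le> y"
proof -
  show "1 \<le> J" using g_bounds(3) q0 by (simp add: J_def Suc_le_eq)
  have "real g \<le> 16 * ln \<Lambda> * \<Lambda> ^ 2 + 1 * \<Lambda> ^ 2"
  proof -
    have "1 * \<alpha> \<le> e * \<alpha>" using e_pos \<alpha>_bounds by (intro mult_right_mono) auto
    then have "real g * \<alpha> \<le> real g * (e * \<alpha>)" by (intro mult_left_mono) auto
    also have "\<dots> \<le> 16 * ln \<Lambda> + 1" using g_bounds(2) by (simp add: mult.commute mult.left_commute)
    finally have "real g * \<alpha> \<le> 16 * ln \<Lambda> + 1" .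
    moreover have "real g * (1 / \<Lambda> ^ 2) \<le> real g * \<alpha>" using \<alpha>_lower by (intro mult_left_mono) auto
    ultimately have "real g * (1 / \<Lambda> ^ 2) \<le> 16 * ln \<Lambda> + 1" by linarith
    then have "real g \<le> (16 * ln \<Lambda> + 1) * \<Lambda> ^ 2" using \<Lambda>1 by (simp add: field_simps)
    then show ?thesis by (simp add: ring_distribs)
  qed
  also have "\<dots> \<le> 17 * \<Lambda> * \<Lambda> ^ 2"
  proof -
    have "(16 * ln \<Lambda> + 1) * \<Lambda> ^ 2 \<le> (17 * \<Lambda>) * \<Lambda> ^ 2" using ln_\<Lambda> \<Lambda> by (intro mult_right_mono) auto
    then show ?thesis by (simp add: ring_distribs)
  qed
  also have "\<dots> \<le> \<Lambda> * \<Lambda> * \<Lambda> ^ 2" using \<Lambda> by (intro mult_right_mono) auto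
  finally have "real q * real g \<le> \<Lambda> * (\<Lambda> * \<Lambda> * \<Lambda> ^ 2)" using q_le \<Lambda>1 by (intro mult_mono) auto
  then show J5: "real J \<le> \<Lambda> ^ 5" by (simp add: J_def eval_nat_numeral mult.assoc)
  also have "\<Lambda> ^ 5 \<le> \<Lambda> ^ 220" using \<Lambda>1 by (intro power_increasing) auto
  also note y
  finally show "J \<le> y" by simp
qed

definition \<delta> :: real where "\<delta> = 1 / \<Lambda> ^ 15"

lemma empty_windows_J:
  assumes "coprime b (int M)"
  shows "real (card (empty_windows b J)) \<le> \<delta> * M"
proof -
  obtain K where K: "even K" "1 \<le> K" "real K \<le> 100 * ln \<Lambda> + 2" "\<Lambda> ^ 66 \<le> 2 ^ K" "2 ^ K \<le> exp 2 * \<Lambda> ^ 70"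
    using truncation_level[OF \<Lambda>] .
  have "(1 - \<alpha>) ^ (e * g) \<le> exp (- \<alpha>) ^ (e * g)"
    using exp_ge_add_one_self[of "- \<alpha>"] \<alpha>_bounds by (intro power_mono) auto
  also have "\<dots> = exp (- (e * g * \<alpha>))" by (simp add: exp_of_nat_mult[symmetric])
  also have "\<dots> \<le> exp (- (real 16 * ln \<Lambda>))" using g_bounds(1) by simp
  also have "\<dots> = 1 / \<Lambda> ^ 16" unfolding exp_minus exp_nat_mult_ln[OF \<Lambda>1(2)] by (simp add: divide_inverse)
  finally have 1: "(1 - \<alpha>) ^ (e * g) \<le> 1 / \<Lambda> ^ 16" .
  have "window_error K (16 * ln \<Lambda> + 1) \<le> 1 / \<Lambda> ^ 18" by (rule window_error_le[OF K(3,5,4)])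
  also have "\<dots> \<le> 1 / \<Lambda> ^ 16" by (intro inverse_power_mono \<Lambda>1) auto
  finally have "(1 - \<alpha>) ^ (e * g) + window_error K (16 * ln \<Lambda> + 1) \<le> 2 / \<Lambda> ^ (15 + 1)" using 1 by simp
  also have "\<dots> \<le> \<delta>" unfolding \<delta>_def using \<Lambda> by (intro inverse_power_absorb) auto
  finally have "M * ((1 - \<alpha>) ^ (e * g) + window_error K (16 * ln \<Lambda> + 1)) \<le> M * \<delta>" by (intro mult_left_mono) auto
  moreover have "real (card (empty_windows b (q * g))) \<le> M * ((1 - \<alpha>) ^ (e * g) + window_error K (16 * ln \<Lambda> + 1))"
    using J_bounds(3) g_bounds(2) by (intro card_empty_windows_full_periods assms K(1)) (auto simp: J_def)
  ultimately show ?thesis by (simp add: J_def mult.commute)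
qed

lemma head_sum:
  "(\<Sum>L<J. real (card (empty_windows 1 L))) \<le> M * (q / (e * \<alpha>) - 1 / (4 * q) + 1 / \<Lambda> ^ 2)"
proof -
  obtain K where K: "even K" "1 \<le> K" "real K \<le> 100 * ln \<Lambda> + 2" "\<Lambda> ^ 66 \<le> 2 ^ K" "2 ^ K \<le> exp 2 * \<Lambda> ^ 70"
    using truncation_level[OF \<Lambda>] .
  have "(\<Sum>L<J. real (card (empty_windows 1 L))) \<le> M * (q / (e * \<alpha>) - 1 / (4 * q) + q * g * window_error K (16 * ln \<Lambda> + 1))"
    unfolding J_def using J_bounds(3) g_bounds(2)
    by (intro sum_card_empty_windows_head q3 q3\<alpha> K(1)) (auto simp: J_def)
  also have "\<dots> \<le> M * (q / (e * \<alpha>) - 1 / (4 * q) + 1 / \<Lambda> ^ 2)"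
  proof (intro mult_left_mono add_left_mono)
    have "real J * window_error K (16 * ln \<Lambda> + 1) \<le> \<Lambda> ^ 5 * (1 / \<Lambda> ^ 18)"
      using J_bounds(2) window_error_le[OF K(3,5,4)] window_error_nonneg \<Lambda>1 by (intro mult_mono) auto
    also have "\<dots> = 1 / \<Lambda> ^ 13" using \<Lambda>1 by (simp add: field_simps flip: power_add)
    also have "\<dots> \<le> 1 / \<Lambda> ^ 2" by (intro inverse_power_mono \<Lambda>1) auto
    finally show "q * g * window_error K (16 * ln \<Lambda> + 1) \<le> 1 / \<Lambda> ^ 2" by (simp add: J_def)
  qed simp
  finally show ?thesis .
qed

lemma log2_M_le: "log 2 M \<le> 2 * \<Lambda>"
proof -
  have l: "ln (real M) \<ge> 0" using M_pos by simp
  have "log 2 M = ln M / ln 2" by (simp add: log_def)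
  also have "\<dots> \<le> ln M / (1 / 2)" using l ln2_ge_two_thirds by (intro divide_left_mono) auto
  also have "\<dots> \<le> 2 * \<Lambda>" using M_upper by simp
  finally show ?thesis .
qed

text \<open>At most log_2 M <= 2 \<Lambda> primes divide M. This is negligible against the B / (8
  \<Lambda>) primes up to B once B >= \<Lambda>^6.\<close>

lemma card_coprime_primes_ge:
  assumes "real B \<ge> \<Lambda> ^ 6" "B < M"
  shows "B / (16 * \<Lambda>) \<le> card {b. prime b \<and> b \<le> B \<and> coprime b M}"
proof -
  have B2: "B \<ge> 2"
  proof -
    have "20000 ^ 6 \<le> \<Lambda> ^ 6" using \<Lambda> by (intro power_mono) auto
    then have "real B \<ge> 2" using assms(1) by simp
    then show ?thesis by simp
  qed
  have fin: "finite {b. prime b \<and> b \<le> B \<and> coprime b M}" "finite {b. prime b \<and> b dvd M}"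
    using M_pos by (auto intro: finite_subset[of _ "{..B}"] finite_subset[of _ "{..M}"] dest: dvd_imp_le)
  have "{p. prime p \<and> p \<le> B} \<subseteq> {b. prime b \<and> b \<le> B \<and> coprime b M} \<union> {b. prime b \<and> b dvd M}"
    by (auto intro: prime_imp_coprime)
  then have "card {p. prime p \<and> p \<le> B} \<le> card ({b. prime b \<and> b \<le> B \<and> coprime b M} \<union> {b. prime b \<and> b dvd M})"
    using fin by (intro card_mono) auto
  also have "\<dots> \<le> card {b. prime b \<and> b \<le> B \<and> coprime b M} + card {b. prime b \<and> b dvd M}" by (rule card_Un_le)
  finally have 1: "real (card {p. prime p \<and> p \<le> B}) \<le> card {b. prime b \<and> b \<le> B \<and> coprime b M} + real (card {b. prime b \<and> b dvd M})"
    by linarith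
  have 2: "real (card {b. prime b \<and> b dvd M}) \<le> 2 * \<Lambda>"
    using card_prime_divisors_le_log_nat[OF M_pos] log2_M_le by linarith
  have "ln (real B) \<le> ln (real M)" using assms(2) B2 by simp
  then have lB: "ln (real B) \<le> \<Lambda>" using M_upper by linarith
  have "real B / 8 \<le> card {p. prime p \<and> p \<le> B} * ln B" by (rule prime_counting_lower_bound[OF B2])
  also have "\<dots> \<le> card {p. prime p \<and> p \<le> B} * \<Lambda>" using lB by (intro mult_left_mono) auto
  finally have 3: "real B / (8 * \<Lambda>) \<le> card {p. prime p \<and> p \<le> B}" using \<Lambda>1 by (simp add: field_simps)
  have "32 * \<Lambda> ^ 2 \<le> \<Lambda> ^ 4 * \<Lambda> ^ 2"
  proof (rule mult_right_mono)
    have "\<Lambda> ^ 1 \<le> \<Lambda> ^ 4" using \<Lambda>1 by (intro power_increasing) auto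
    then show "32 \<le> \<Lambda> ^ 4" using \<Lambda> by simp
  qed simp
  then have "32 * \<Lambda> ^ 2 \<le> real B" using assms(1) by (simp flip: power_add)
  then have "2 * \<Lambda> \<le> real B / (16 * \<Lambda>)" using \<Lambda>1 by (simp add: field_simps power2_eq_square)
  moreover have "real B / (8 * \<Lambda>) = 2 * (real B / (16 * \<Lambda>))" by simp
  ultimately show ?thesis using 1 2 3 by linarith
qed

text \<open>Half of the window serves for the shifts s < h, the other half for the multiples b i
  with b <= B and i <= J. If B is large, the large sieve bounds the count by \<delta> M times a
  power of \<Lambda> over L. If B is small, L is at most \<Lambda>^12, and the bound \<delta> M at
  length J already suffices.\<close>

lemma empty_windows_tail:
  assumes L: "J \<le> L" "L < M"
  shows "real (card (empty_windows 1 L)) \<le> M * (\<Lambda> ^ 12 * \<delta>) / L"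
proof -
  have L0: "L > 0" using L J_bounds(1) by simp
  define B where "B = L div (2 * J)"
  define h where "h = L div 2"
  have \<delta>0: "\<delta> > 0" using \<Lambda>1 by (simp add: \<delta>_def)
  show ?thesis
  proof (cases "real B \<ge> \<Lambda> ^ 6")
    case True
    define n0 where "n0 = card {b. prime b \<and> b \<le> B \<and> coprime b M}"
    have "1 \<le> \<Lambda> ^ 6" using \<Lambda>1 by simp
    then have B1: "B \<ge> 1" using True by linarith
    have BL: "B \<le> L div 2" unfolding B_def using J_bounds(1) by (intro div_le_mono2) auto
    then have BM: "B < M" using L by linarith
    have hB: "h + B * J \<le> L"
    proof -
      have "2 * (B * J) \<le> L" unfolding B_def by (metis div_times_less_eq_dividend mult.assoc mult.commute)
      then show ?thesis unfolding h_def by linarith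
    qed
    have \<delta>2: "\<delta> \<le> 1 / 2"
    proof -
      have "\<Lambda> ^ 1 \<le> \<Lambda> ^ 15" using \<Lambda>1 by (intro power_increasing) auto
      then have "2 \<le> \<Lambda> ^ 15" using \<Lambda> by simp
      then show ?thesis unfolding \<delta>_def using \<Lambda>1 by (intro divide_left_mono) auto
    qed
    have "real (card (empty_windows 1 L)) * n0 \<le> q * 2 ^ card T * (20 * log 2 ((real B + 1) * M) * \<delta> * M)"
      unfolding n0_def using B1 BL hB
      by (intro card_empty_windows_large_sieve[OF empty_windows_J \<delta>2, of _ h]) (auto simp: h_def)
    also have "\<dots> \<le> \<Lambda> * \<Lambda> ^ 2 * (20 * (4 * \<Lambda>) * \<delta> * M)"
    proof (rule mult_mono)
      have "real q * 2 ^ card T \<le> \<Lambda> * \<Lambda> ^ 2" using q_le r_upper \<Lambda>1 by (intro mult_mono) auto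
      then show "q * 2 ^ card T \<le> \<Lambda> * \<Lambda> ^ 2" by simp
      have "log 2 ((real B + 1) * M) \<le> log 2 (real M * M)"
        using BM M_pos by (intro log_mono mult_right_mono) auto
      also have "\<dots> = 2 * log 2 M" using M_pos by (simp add: log_mult)
      finally have "log 2 ((real B + 1) * M) \<le> 4 * \<Lambda>" using log2_M_le by simp
      then show "20 * log 2 ((real B + 1) * M) * \<delta> * M \<le> 20 * (4 * \<Lambda>) * \<delta> * M"
        using \<delta>0 by (intro mult_right_mono mult_left_mono) auto
      show "0 \<le> 20 * log 2 ((real B + 1) * real M) * \<delta> * real M"
        using one_le_Suc_mult_pos[of "int M" B] M_pos \<delta>0 by simp
    qed (use \<Lambda>1 in auto)
    finally have "real (card (empty_windows 1 L)) * n0 \<le> 80 * \<Lambda> ^ 4 * \<delta> * M"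
      using power_add[of \<Lambda> 2 2] by (simp add: power2_eq_square mult.assoc)
    moreover have "real (card (empty_windows 1 L)) * (B / (16 * \<Lambda>)) \<le> real (card (empty_windows 1 L)) * n0"
      unfolding n0_def using card_coprime_primes_ge[OF True BM] by (intro mult_left_mono) auto
    ultimately have "real (card (empty_windows 1 L)) * (B / (16 * \<Lambda>)) \<le> 80 * \<Lambda> ^ 4 * \<delta> * M" by linarith
    moreover have "real (card (empty_windows 1 L)) * (L / (4 * \<Lambda> ^ 5) / (16 * \<Lambda>)) \<le> real (card (empty_windows 1 L)) * (B / (16 * \<Lambda>))"
    proof (intro mult_left_mono divide_right_mono)
      have "L / (4 * \<Lambda> ^ 5) \<le> L / (4 * real J)"
        using J_bounds by (intro divide_left_mono mult_left_mono) (use \<Lambda>1 in auto)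
      also have "\<dots> = real L / (2 * real (2 * J))" by simp
      also have "\<dots> \<le> B" unfolding B_def using B1 by (intro half_le_floor_div) (simp add: B_def)
      finally show "L / (4 * \<Lambda> ^ 5) \<le> B" .
    qed (use \<Lambda>1 in auto)
    ultimately have "real (card (empty_windows 1 L)) * (L / (4 * \<Lambda> ^ 5) / (16 * \<Lambda>)) \<le> 80 * \<Lambda> ^ 4 * \<delta> * M" by linarith
    then have "real (card (empty_windows 1 L)) * L \<le> 80 * \<Lambda> ^ 4 * \<delta> * M * (4 * \<Lambda> ^ 5 * (16 * \<Lambda>))"
      using \<Lambda>1 by (simp add: field_simps)
    also have "\<dots> = 5120 * (\<Lambda> ^ 4 * \<Lambda> ^ 5 * \<Lambda> ^ 1) * (\<delta> * M)" by simp
    also have "\<dots> = 5120 * \<Lambda> ^ 10 * (\<delta> * M)" by (simp only: power_add[symmetric]) simp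
    also have "\<dots> \<le> \<Lambda> ^ 12 * (\<delta> * M)"
    proof (rule mult_right_mono)
      have "\<Lambda> ^ 1 \<le> \<Lambda> ^ 2" using \<Lambda>1 by (intro power_increasing) auto
      then have "5120 * \<Lambda> ^ 10 \<le> \<Lambda> ^ 2 * \<Lambda> ^ 10" using \<Lambda> by (intro mult_right_mono) auto
      then show "5120 * \<Lambda> ^ 10 \<le> \<Lambda> ^ 12" by (simp flip: power_add)
    qed (use \<delta>0 in simp)
    finally show ?thesis using L0 by (simp add: field_simps)
  next
    case False
    have "L < (B + 1) * (2 * J)"
      using dividend_less_div_times[of "2 * J" L] J_bounds(1) by (simp add: B_def algebra_simps)
    then have "L \<le> (B + 1) * (2 * J)" by simp
    then have "real L \<le> real ((B + 1) * (2 * J))" by (simp only: of_nat_le_iff)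
    then have "real L \<le> (real B + 1) * (2 * real J)" by (simp add: algebra_simps)
    also have "\<dots> \<le> (\<Lambda> ^ 6 + \<Lambda> ^ 6) * (2 * \<Lambda> ^ 5)"
      using False J_bounds(2) \<Lambda>1 by (intro mult_mono add_mono) auto
    also have "\<dots> = 4 * (\<Lambda> ^ 6 * \<Lambda> ^ 5)" by simp
    also have "\<dots> = 4 * \<Lambda> ^ 11" by (simp only: power_add[symmetric]) simp
    also have "\<dots> \<le> \<Lambda> * \<Lambda> ^ 11" using \<Lambda> by (intro mult_right_mono) auto
    finally have "real L \<le> \<Lambda> ^ 12" by (simp flip: power_Suc)
    then have "\<delta> * M * real L \<le> \<delta> * M * \<Lambda> ^ 12" using \<delta>0 by (intro mult_left_mono) auto
    moreover have "real (card (empty_windows 1 L)) \<le> \<delta> * M"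
      using empty_windows_J[of 1] empty_windows_antimono[OF L(1), of 1] by simp
    then have "real (card (empty_windows 1 L)) * real L \<le> \<delta> * M * real L" by (intro mult_right_mono) auto
    ultimately have "real (card (empty_windows 1 L)) * real L \<le> M * (\<Lambda> ^ 12 * \<delta>)" by (simp add: mult.commute mult.left_commute)
    then show ?thesis using L0 by (simp add: le_divide_eq)
  qed
qed

lemma total_sum:
  "(\<Sum>L<M. real (card (empty_windows 1 L))) \<le> M * (q / (e * \<alpha>) - 1 / (4 * q) + 3 / \<Lambda> ^ 2)"
proof -
  have \<delta>0: "\<delta> > 0" using \<Lambda>1 by (simp add: \<delta>_def)
  have "(\<Sum>L<M. real (card (empty_windows 1 L))) \<le> (\<Sum>L\<in>{..<J} \<union> {J..<M}. real (card (empty_windows 1 L)))"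
    by (intro sum_mono2) auto
  also have "\<dots> = (\<Sum>L<J. real (card (empty_windows 1 L))) + (\<Sum>L\<in>{J..<M}. real (card (empty_windows 1 L)))"
    by (intro sum.union_disjoint) auto
  also have "(\<Sum>L\<in>{J..<M}. real (card (empty_windows 1 L))) \<le> (\<Sum>L\<in>{J..<M}. M * (\<Lambda> ^ 12 * \<delta>) / L)"
    by (intro sum_mono empty_windows_tail) auto
  also have "\<dots> \<le> (\<Sum>L\<in>{1..M}. M * (\<Lambda> ^ 12 * \<delta>) / L)"
    using J_bounds(1) \<delta>0 \<Lambda>1 by (intro sum_mono2) auto
  also have "\<dots> = M * (\<Lambda> ^ 12 * \<delta>) * harm M" by (simp add: harm_def sum_distrib_left divide_inverse)
  \<comment> \<open>The decay 1 / L leaves a harmonic sum, of size at most 2 \<Lambda>; with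
    \<open>\<delta> = 1 / \<Lambda> ^ 15\<close> the tail is 2 / \<Lambda>^2 per residue.\<close>
  also have "\<dots> \<le> M * (\<Lambda> ^ 12 * \<delta>) * (2 * \<Lambda>)"
  proof (rule mult_left_mono)
    show "harm M \<le> 2 * \<Lambda>" using harm_le_one_plus_ln[OF M_pos] M_upper \<Lambda> by linarith
  qed (use \<delta>0 \<Lambda>1 in auto)
  also have "\<dots> = M * (2 / \<Lambda> ^ 2)" using \<Lambda>1 by (simp add: \<delta>_def field_simps flip: power_add power_Suc)
  also note head_sum
  finally show ?thesis by (simp add: algebra_simps)
qed

text \<open>Divided by M, the right side is at least \<open>q / E - 2 / \<Lambda> ^ 2\<close> and
  the left side at most \<open>q / E - 1 / (4 * q) + 3 / \<Lambda> ^ 2\<close>. Since q <=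
  \<Lambda>, the gain 1 / (4 q) exceeds 5 / \<Lambda>^2.\<close>

theorem sum_empty_windows_less:
  defines "k \<equiv> card {x\<in>{0..<int M}. QuadRes (int M) x}"
  shows "(\<Sum>L<M. real (card (empty_windows 1 L))) < real M * (real M + 1) / (real k + 1)"
proof -
  define t where "t = real (\<Prod>T)"
  define pe where "pe = pattern_error 1"
  define E where "E = real e * \<alpha>"
  have E: "0 < E" "E \<le> 1" "1 / \<Lambda> ^ 2 \<le> E"
  proof -
    show "0 < E" "E \<le> 1" using e\<alpha> by (simp_all add: E_def)
    have "1 * \<alpha> \<le> e * \<alpha>" using e_pos \<alpha>_bounds by (intro mult_right_mono) auto
    then show "1 / \<Lambda> ^ 2 \<le> E" using \<alpha>_lower by (simp add: E_def)
  qed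
  have pe: "0 \<le> pe" "pe \<le> 1 / \<Lambda> ^ 36" using pattern_error_nonneg pattern_error_1_le by (simp_all add: pe_def)
  have pe2: "pe \<le> 1 / 2"
  proof -
    have "\<Lambda> ^ 1 \<le> \<Lambda> ^ 36" using \<Lambda>1 by (intro power_increasing) auto
    then have "1 / \<Lambda> ^ 36 \<le> 1 / 2" using \<Lambda> by (intro divide_left_mono) auto
    then show ?thesis using pe by simp
  qed
  have Tne: "T \<noteq> {}" using r_lower \<Lambda> by auto
  have t: "\<Lambda> ^ 220 \<le> t"
  proof -
    obtain p where p: "p \<in> T" using Tne by blast
    have "p dvd \<Prod>T" using p finT by (intro dvd_prodI) auto
    then have "p \<le> \<Prod>T" using prodT_pos by (rule dvd_imp_le)
    then have "y \<le> \<Prod>T" using T[OF p] by simp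
    then show ?thesis using y unfolding t_def by (meson of_nat_le_iff order_trans)
  qed
  have t0: "t > 0" using t \<Lambda>1 by (meson less_le_trans zero_less_power)
  have k: "real k \<le> E * t * (1 + pe)" "E * t * (1 - pe) \<le> real k"
    using card_QuadRes_M unfolding k_def E_def t_def pe_def by (simp_all add: mult.commute mult.left_commute)
  have Mt: "real M = q * t" by (simp add: M_def t_def)
  have k2: "E * t / 2 \<le> real k"
  proof -
    have "E * t * (1 / 2) \<le> E * t * (1 - pe)" using pe2 E t0 by (intro mult_left_mono) auto
    then show ?thesis using k by simp
  qed
  then have k0: "real k > 0" using E t0 by (smt (verit) divide_pos_pos mult_pos_pos)
  have "(real M + 1) / (real k + 1) \<ge> real M / k - real M / (real k)\<^sup>2"
  proof -
    have "real M / k - real M / (real k)\<^sup>2 = real M * (real k - 1) / (real k)\<^sup>2"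
      using k0 by (simp add: field_simps power2_eq_square)
    also have "\<dots> \<le> real M / (real k + 1)"
    proof -
      have "real M * ((real k - 1) * (real k + 1)) \<le> real M * (real k)\<^sup>2"
        by (intro mult_left_mono) (auto simp: power2_eq_square algebra_simps)
      then show ?thesis using k0 by (simp add: field_simps)
    qed
    also have "\<dots> \<le> (real M + 1) / (real k + 1)" by (intro divide_right_mono) auto
    finally show ?thesis .
  qed
  moreover have "real M / k \<ge> q / E - 1 / \<Lambda> ^ 2"
  proof -
    have "q / E * (1 - pe) \<le> q / E / (1 + pe)"
    proof -
      have "(1 - pe) * (1 + pe) \<le> 1" using pe by (simp add: algebra_simps)
      then have "1 - pe \<le> 1 / (1 + pe)" using pe by (simp add: le_divide_eq)
      then have "q / E * (1 - pe) \<le> q / E * (1 / (1 + pe))" using E by (intro mult_left_mono) auto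
      then show ?thesis by simp
    qed
    also have "\<dots> = real M / (E * t * (1 + pe))" using t0 by (simp add: Mt)
    also have "\<dots> \<le> real M / k" using k k0 by (intro divide_left_mono) auto
    finally have "q / E - q / E * pe \<le> real M / k" by (simp add: right_diff_distrib)
    moreover have "q / E * pe \<le> 1 / \<Lambda> ^ 2"
    proof -
      have "1 / E \<le> \<Lambda> ^ 2" using E \<Lambda>1 by (simp add: field_simps)
      then have "q * (1 / E) * pe \<le> \<Lambda> * \<Lambda> ^ 2 * (1 / \<Lambda> ^ 36)"
        using q_le pe E \<Lambda>1 by (intro mult_mono) auto
      also have "\<dots> = 1 / \<Lambda> ^ 33" using \<Lambda>1 by (simp add: field_simps flip: power_add power_Suc)
      also have "\<dots> \<le> 1 / \<Lambda> ^ 2" by (intro inverse_power_mono \<Lambda>1) auto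
      finally show ?thesis by simp
    qed
    ultimately show ?thesis by linarith
  qed
  moreover have "real M / (real k)\<^sup>2 \<le> 1 / \<Lambda> ^ 2"
  proof -
    have "(1 / \<Lambda> ^ 2 * t / 2)\<^sup>2 \<le> (real k)\<^sup>2"
    proof (rule power_mono)
      have "1 / \<Lambda> ^ 2 * t / 2 \<le> E * t / 2" using E t0 by (intro divide_right_mono mult_right_mono) auto
      then show "1 / \<Lambda> ^ 2 * t / 2 \<le> real k" using k2 by linarith
    qed (use t0 in auto)
    then have "real M / (real k)\<^sup>2 \<le> (\<Lambda> * t) / (1 / \<Lambda> ^ 2 * t / 2)\<^sup>2"
      using t0 \<Lambda>1 q_le by (intro frac_le) (auto simp: Mt mult_right_mono)
    also have "\<dots> = 4 * \<Lambda> ^ 5 / t"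
    proof -
      have "\<Lambda> ^ 5 = \<Lambda> * \<Lambda> * \<Lambda> * \<Lambda> * \<Lambda>" by (simp add: eval_nat_numeral)
      then show ?thesis using t0 \<Lambda>1 by (simp add: power2_eq_square)
    qed
    also have "\<dots> \<le> 4 * \<Lambda> ^ 5 / \<Lambda> ^ 220" using t t0 \<Lambda>1 by (intro divide_left_mono) auto
    also have "\<dots> = 4 / \<Lambda> ^ (214 + 1)" using \<Lambda>1 by (simp add: field_simps flip: power_add)
    also have "\<dots> \<le> 1 / \<Lambda> ^ 214" using \<Lambda> by (intro inverse_power_absorb) auto
    also have "\<dots> \<le> 1 / \<Lambda> ^ 2" by (intro inverse_power_mono \<Lambda>1) auto
    finally show ?thesis .
  qed
  moreover have "5 / \<Lambda> ^ 2 < 1 / (4 * q)"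
  proof -
    have "5 / \<Lambda> ^ 2 < 1 / (4 * \<Lambda>)" using \<Lambda> by (simp add: field_simps power2_eq_square)
    also have "\<dots> \<le> 1 / (4 * q)" using q_le q0 \<Lambda>1 by (intro divide_left_mono) auto
    finally show ?thesis .
  qed
  ultimately have "q / E - 1 / (4 * q) + 3 / \<Lambda> ^ 2 < (real M + 1) / (real k + 1)" by simp
  then have "real M * (q / E - 1 / (4 * q) + 3 / \<Lambda> ^ 2) < real M * ((real M + 1) / (real k + 1))"
    using M_pos by (intro mult_strict_left_mono) auto
  moreover have "(\<Sum>L<M. real (card (empty_windows 1 L))) \<le> real M * (q / E - 1 / (4 * q) + 3 / \<Lambda> ^ 2)"
    using total_sum by (simp add: E_def)
  ultimately show ?thesis by simp
qed

end

lemma QuadRes_int_iff: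
  assumes "M > 0"
  shows "QuadRes (int M) (int x) \<longleftrightarrow> x mod M \<in> quad_residues M"
proof
  assume "QuadRes (int M) (int x)"
  then obtain w where w: "[w\<^sup>2 = int x] (mod int M)" by (auto simp: QuadRes_def)
  define a where "a = nat (w mod int M)"
  have a: "int a = w mod int M" "a < M" using assms by (auto simp: a_def nat_less_iff)
  have "[(int a)\<^sup>2 = w\<^sup>2] (mod int M)" unfolding a(1) by (intro cong_pow) (simp add: cong_def)
  then have "[(int a)\<^sup>2 = int x] (mod int M)" using w cong_trans by blast
  then have "[a\<^sup>2 = x] (mod M)" by (metis cong_int_iff of_nat_power)
  then show "x mod M \<in> quad_residues M"
    unfolding quad_residues_def using a(2) by (intro image_eqI[of _ _ a]) (auto simp: cong_def)
next
  assume "x mod M \<in> quad_residues M"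
  then obtain a where "x mod M = a\<^sup>2 mod M" by (auto simp: quad_residues_def)
  then have "[a\<^sup>2 = x] (mod M)" by (simp add: cong_def)
  then have "[(int a)\<^sup>2 = int x] (mod int M)" by (metis cong_int_iff of_nat_power)
  then show "QuadRes (int M) (int x)" by (auto simp: QuadRes_def)
qed

lemma quad_residues_subset: "M > 0 \<Longrightarrow> quad_residues M \<subseteq> {0..<M}"
  by (auto simp: quad_residues_def)

definition beats_average :: "nat \<Rightarrow> bool" where
  "beats_average M \<longleftrightarrow> real_of_int (gap_square_sum M (quad_residues M)) < avg_gap_square_sum M (card (quad_residues M))"

lemma (in good_modulus) beats_average: "beats_average M"
proof -
  note sub = quad_residues_subset[OF M_pos]
  have ne: "quad_residues M \<noteq> {}" using M_pos by (auto simp: quad_residues_def)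
  have bij: "bij_betw int {x\<in>{0..<M}. P (int x)} {x\<in>{0..<int M}. P x}" for P
    by (rule bij_betwI[where g = nat]) auto
  have "{x\<in>{0..<M}. QuadRes (int M) (int x)} = quad_residues M"
    using sub by (auto simp: QuadRes_int_iff[OF M_pos])
  then have card1: "card {x\<in>{0..<int M}. QuadRes (int M) x} = card (quad_residues M)"
    using bij_betw_same_card[OF bij[of "QuadRes (int M)"]] by simp
  have win: "free_windows M (quad_residues M) L = card (empty_windows 1 L)" for L
  proof -
    have "(\<forall>i\<in>{1..L}. (x + i) mod M \<notin> quad_residues M) \<longleftrightarrow> (\<forall>i\<in>{1..int L}. \<not> QuadRes (int M) (1 * (int x + i)))" for x
    proof -
      have "{1..int L} = int ` {1..L}" by (simp add: image_int_atLeastAtMost)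
      then show ?thesis by (simp add: QuadRes_int_iff[OF M_pos, symmetric])
    qed
    then have "free_windows M (quad_residues M) L = card {x\<in>{0..<M}. \<forall>i\<in>{1..int L}. \<not> QuadRes (int M) (1 * (int x + i))}"
      unfolding free_windows_def by simp
    also have "\<dots> = card (empty_windows 1 L)"
      unfolding empty_windows_def by (rule bij_betw_same_card[OF bij[of "\<lambda>x. \<forall>i\<in>{1..int L}. \<not> QuadRes (int M) (1 * (x + i))"]])
    finally show ?thesis .
  qed
  show ?thesis
    unfolding beats_average_def gap_square_sum_less_avg_iff[OF sub ne] win
    using sum_empty_windows_less unfolding card1 by simp
qed

lemma rough_const_pos: "rough_const > 0"
  by (simp add: rough_const_def)

text \<open>Sets with too few or too many primes are discarded by Rankin's trick with c = 1/2 and c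
  = 2. The losses, O(\<Lambda>^(3/4)) and O(1), are of lower order than \<Lambda> / ln \<Lambda>,
  and \<open>big\<close> says that half of the main term remains (1768 = 2 * 4 * 221). The exponent
  \<open>card T + 1\<close> reserves a place for the prime P.\<close>

lemma good_rough_sets_lower_bound:
  fixes \<Lambda> :: real and y z :: nat
  assumes \<Lambda>: "\<Lambda> \<ge> 20000" and y: "2 \<le> y" "real y \<le> \<Lambda> ^ 221" and z: "z \<ge> 2" "\<Lambda> / 4 \<le> ln z" "ln z \<le> \<Lambda>"
    and big: "rough_const * (\<Lambda> / 4) / (221 * ln \<Lambda>) - \<Lambda> powr (1/4) * (\<Lambda> powr (1/2) * exp (mertens_const / 2)) - 2 * exp (2 * mertens_const)
      \<ge> rough_const / 1768 * \<Lambda> / ln \<Lambda>"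
  shows "(\<Sum>T\<in>{T\<in>rough_prime_sets y z. \<Lambda> \<le> (2 ^ card T) ^ 4 \<and> 2 ^ (card T + 1) \<le> \<Lambda> ^ 2}. 1 / real (\<Prod>T))
    \<ge> rough_const / 1768 * \<Lambda> / ln \<Lambda>"
proof -
  define R where "R = rough_prime_sets y z"
  define G where "G = {T\<in>R. \<Lambda> \<le> (2 ^ card T) ^ 4 \<and> 2 ^ (card T + 1) \<le> \<Lambda> ^ 2}"
  define B1 where "B1 = {T\<in>R. (2 ^ card T) ^ 4 < \<Lambda>}"
  define B2 where "B2 = {T\<in>R. 2 ^ (card T + 1) > \<Lambda> ^ 2}"
  define f where "f T = 1 / real (\<Prod>T)" for T :: "nat set"
  have f0: "f T \<ge> 0" for T unfolding f_def by (intro divide_nonneg_nonneg of_nat_0_le_iff) auto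
  have finR: "finite R" unfolding R_def by (rule finite_rough_prime_sets)
  have "(\<Sum>T\<in>R. f T) \<le> (\<Sum>T\<in>G \<union> (B1 \<union> B2). f T)"
    using finR f0 by (intro sum_mono2) (auto simp: G_def B1_def B2_def)
  also have "\<dots> \<le> (\<Sum>T\<in>G. f T) + (\<Sum>T\<in>B1 \<union> B2. f T)"
    using finR f0 sum.union_inter[of G "B1 \<union> B2" f] sum_nonneg[of "G \<inter> (B1 \<union> B2)" f] by (auto simp: G_def B1_def B2_def)
  also have "(\<Sum>T\<in>B1 \<union> B2. f T) \<le> (\<Sum>T\<in>B1. f T) + (\<Sum>T\<in>B2. f T)"
    using finR f0 sum.union_inter[of B1 B2 f] sum_nonneg[of "B1 \<inter> B2" f] by (auto simp: B1_def B2_def)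
  finally have split: "(\<Sum>T\<in>R. f T) \<le> (\<Sum>T\<in>G. f T) + (\<Sum>T\<in>B1. f T) + (\<Sum>T\<in>B2. f T)" by simp
  have lnz: "exp (ln (ln (real z))) \<le> \<Lambda>" "ln (real z) > 0" using z \<Lambda> by auto
  have lnlnz: "ln (ln (real z)) \<le> ln \<Lambda>" using lnz z(3) by simp
  have "(\<Sum>T\<in>B1. f T) \<le> (\<Sum>T\<in>B1. \<Lambda> powr (1/4) * ((1/2) ^ card T / real (\<Prod>T)))"
  proof (intro sum_mono)
    fix T assume "T \<in> B1"
    then have "((2::real) ^ card T) ^ 4 \<le> \<Lambda>" by (simp add: B1_def)
    then have "(((2::real) ^ card T) ^ 4) powr (1/4) \<le> \<Lambda> powr (1/4)" by (intro powr_mono2) auto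
    moreover have "(((2::real) ^ card T) ^ 4) powr (1/4) = 2 ^ card T"
      by (simp add: powr_realpow[symmetric] powr_powr)
    ultimately have "1 \<le> \<Lambda> powr (1/4) * (1/2) ^ card T" by (simp add: power_divide field_simps)
    then have "1 * f T \<le> \<Lambda> powr (1/4) * (1/2) ^ card T * f T" using f0 by (intro mult_right_mono) auto
    then show "f T \<le> \<Lambda> powr (1/4) * ((1/2) ^ card T / real (\<Prod>T))" by (simp add: f_def)
  qed
  also have "\<dots> \<le> (\<Sum>T\<in>R. \<Lambda> powr (1/4) * ((1/2) ^ card T / real (\<Prod>T)))"
    using finR by (intro sum_mono2 mult_nonneg_nonneg divide_nonneg_nonneg of_nat_0_le_iff) (auto simp: B1_def)
  also have "\<dots> = \<Lambda> powr (1/4) * (\<Sum>T\<in>R. (1/2) ^ card T / real (\<Prod>T))" by (simp only: sum_distrib_left)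
  also have "\<dots> \<le> \<Lambda> powr (1/4) * exp (1/2 * (ln (ln z) + mertens_const))"
    unfolding R_def using z by (intro mult_left_mono rough_prime_sets_rankin) auto
  also have "\<dots> \<le> \<Lambda> powr (1/4) * (\<Lambda> powr (1/2) * exp (mertens_const / 2))"
  proof (rule mult_left_mono)
    have "exp (1/2 * (ln (ln z) + mertens_const)) \<le> exp (1/2 * ln \<Lambda> + mertens_const / 2)" using lnlnz by simp
    also have "\<dots> = \<Lambda> powr (1/2) * exp (mertens_const / 2)" using \<Lambda> by (simp add: exp_add powr_def)
    finally show "exp (1/2 * (ln (ln z) + mertens_const)) \<le> \<Lambda> powr (1/2) * exp (mertens_const / 2)" .
  qed simp
  finally have b1: "(\<Sum>T\<in>B1. f T) \<le> \<Lambda> powr (1/4) * (\<Lambda> powr (1/2) * exp (mertens_const / 2))" .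
  have "(\<Sum>T\<in>B2. f T) \<le> (\<Sum>T\<in>B2. 2 / \<Lambda> ^ 2 * (2 ^ card T / real (\<Prod>T)))"
  proof (intro sum_mono)
    fix T assume "T \<in> B2"
    then have "\<Lambda> ^ 2 \<le> 2 * 2 ^ card T" by (simp add: B2_def)
    then have "1 \<le> 2 / \<Lambda> ^ 2 * 2 ^ card T" using \<Lambda> by (simp add: field_simps)
    then have "1 * f T \<le> 2 / \<Lambda> ^ 2 * 2 ^ card T * f T" using f0 by (intro mult_right_mono) auto
    then show "f T \<le> 2 / \<Lambda> ^ 2 * (2 ^ card T / real (\<Prod>T))" by (simp add: f_def)
  qed
  also have "\<dots> \<le> (\<Sum>T\<in>R. 2 / \<Lambda> ^ 2 * (2 ^ card T / real (\<Prod>T)))"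
    using finR by (intro sum_mono2 mult_nonneg_nonneg divide_nonneg_nonneg of_nat_0_le_iff) (auto simp: B2_def)
  also have "\<dots> = 2 / \<Lambda> ^ 2 * (\<Sum>T\<in>R. 2 ^ card T / real (\<Prod>T))" by (simp only: sum_distrib_left)
  also have "\<dots> \<le> 2 / \<Lambda> ^ 2 * exp (2 * (ln (ln z) + mertens_const))"
    unfolding R_def using z \<Lambda> by (intro mult_left_mono rough_prime_sets_rankin) auto
  also have "\<dots> \<le> 2 / \<Lambda> ^ 2 * (\<Lambda> ^ 2 * exp (2 * mertens_const))"
  proof (rule mult_left_mono)
    have "exp (2 * (ln (ln z) + mertens_const)) \<le> exp (real 2 * ln \<Lambda> + 2 * mertens_const)" using lnlnz by simp
    also have "\<dots> = \<Lambda> ^ 2 * exp (2 * mertens_const)"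
      unfolding exp_add using exp_nat_mult_ln[of \<Lambda> 2] \<Lambda> by simp
    finally show "exp (2 * (ln (ln z) + mertens_const)) \<le> \<Lambda> ^ 2 * exp (2 * mertens_const)" .
  qed simp
  also have "\<dots> = 2 * exp (2 * mertens_const)" using \<Lambda> by simp
  finally have b2: "(\<Sum>T\<in>B2. f T) \<le> 2 * exp (2 * mertens_const)" .
  have "rough_const * (\<Lambda> / 4) / (221 * ln \<Lambda>) \<le> rough_const * ln z / ln y"
  proof (rule frac_le)
    have "ln (real y) \<le> ln (\<Lambda> ^ 221)" using y \<Lambda> by (subst ln_le_cancel_iff) auto
    then show "ln (real y) \<le> 221 * ln \<Lambda>" using \<Lambda> by (simp add: ln_realpow)
    show "0 < ln (real y)" using y by simp
    show "rough_const * (\<Lambda> / 4) \<le> rough_const * ln z" using z rough_const_pos by (intro mult_left_mono) auto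
    show "0 \<le> rough_const * ln (real z)" using rough_const_pos lnz by simp
  qed
  also have "\<dots> \<le> (\<Sum>T\<in>R. f T)" unfolding R_def f_def using y z by (intro rough_prime_sets_lower_bound) auto
  finally show ?thesis using split b1 b2 big unfolding G_def R_def f_def by linarith
qed

section \<open>Density of the family\<close>

lemma prime_dvd_prod_primes:
  assumes "finite S" "\<And>p. p \<in> S \<Longrightarrow> prime (p::nat)" "prime p" "p dvd \<Prod>S"
  shows "p \<in> S"
proof -
  obtain s where "s \<in> S" "p dvd s" using assms(1,3,4) by (auto simp: prime_dvd_prod_iff)
  then show ?thesis using assms(2)[of s] assms(3) primes_dvd_imp_eq by blast
qed

lemma rough_prime_setsD:
  assumes "S \<in> rough_prime_sets y z"
  shows "finite S" "\<And>p. p \<in> S \<Longrightarrow> prime p \<and> y < p \<and> p \<le> z" "\<Prod>S \<le> z" "\<Prod>S > 0"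
proof -
  have sub: "S \<subseteq> {p. prime p \<and> y < p \<and> p \<le> z}" and le: "\<Prod>S \<le> z" using assms by (auto simp: rough_prime_sets_def)
  show "finite S" by (rule finite_subset[OF sub]) (rule finite_subset[OF _ finite_primes_atMost[of z]], auto)
  show "prime p \<and> y < p \<and> p \<le> z" if "p \<in> S" for p using sub that by auto
  show "\<Prod>S \<le> z" by (rule le)
  show "\<Prod>S > 0" using sub by (intro prod_pos) (auto simp: prime_gt_0_nat)
qed

text \<open>The prime factors of q are at most y, those in S lie in (y, z], and P exceeds z; size
  alone separates the three factors.\<close>

lemma triple_product_unique:
  assumes S: "S \<in> rough_prime_sets y z" "S' \<in> rough_prime_sets y z"
    and q: "0 < q" "q \<le> y" "0 < q'" "q' \<le> y" and yz: "y \<le> z"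
    and P: "prime P" "z < P" "prime P'" "z < P'"
    and eq: "q * \<Prod>S * P = q' * \<Prod>S' * P'"
  shows "q = q' \<and> S = S' \<and> P = P'"
proof -
  have PP: "P = P'"
  proof -
    have "P dvd q' * \<Prod>S' * P'" by (metis eq dvd_triv_right)
    then have "P dvd q' \<or> P dvd \<Prod>S' \<or> P dvd P'" using P(1) by (simp add: prime_dvd_mult_iff)
    moreover have "\<not> P dvd q'" using q P(2) yz dvd_imp_le[of P q'] by auto
    moreover have "\<not> P dvd \<Prod>S'" using rough_prime_setsD(3,4)[OF S(2)] P(2) dvd_imp_le[of P "\<Prod>S'"] by auto
    ultimately show ?thesis using P(1,3) primes_dvd_imp_eq by blast
  qed
  then have eq2: "q * \<Prod>S = q' * \<Prod>S'" using eq P(1) by (simp add: prime_gt_0_nat)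
  have sub: "A \<subseteq> B" if AB: "A \<in> rough_prime_sets y z" "B \<in> rough_prime_sets y z" "a * \<Prod>A = b * \<Prod>B" "0 < b" "b \<le> y" for A B a b
  proof
    fix p assume p: "p \<in> A"
    have pp: "prime p" "y < p" using rough_prime_setsD(2)[OF AB(1) p] by auto
    have "p dvd \<Prod>A" using p rough_prime_setsD(1)[OF AB(1)] by (intro dvd_prodI) auto
    then have "p dvd b * \<Prod>B" using AB(3) by (metis dvd_mult)
    then have "p dvd b \<or> p dvd \<Prod>B" using pp by (simp add: prime_dvd_mult_iff)
    moreover have "\<not> p dvd b" using AB pp dvd_imp_le[of p b] by auto
    ultimately have "p dvd \<Prod>B" by blast
    then show "p \<in> B" using rough_prime_setsD[OF AB(2)] pp by (intro prime_dvd_prod_primes) auto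
  qed
  have "S = S'" using sub[OF S eq2 q(3,4)] sub[OF S(2,1) eq2[symmetric] q(1,2)] by blast
  moreover have "q = q'" using eq2 calculation rough_prime_setsD(4)[OF S(1)] by simp
  ultimately show ?thesis using PP by blast
qed

text \<open>For each pair (q, S) with m = q \<Prod>S, Chebyshev's bound supplies at least N / (16 m
  \<Lambda>) primes up to N / m, where 16 = 2 * 8 includes the loss from rounding N / m down. The
  products are distinct, so the counts add up.\<close>

lemma count_beats_average:
  fixes N y z Q :: nat and \<Lambda> :: real
  defines "\<Lambda> \<equiv> ln (real N)"
  assumes \<Lambda>: "\<Lambda> \<ge> 20000"
    and y: "\<Lambda> ^ 220 \<le> y" "2 \<le> y" and Q: "real Q ^ 20 \<le> \<Lambda>" "Q \<le> y" and yz: "y \<le> z"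
    and room: "32 * real z ^ 2 * Q * \<Lambda> \<le> N"
    and sq: "a \<le> (\<Sum>q\<in>{3..Q}. 1 / real q)" "0 \<le> a"
    and sT: "b \<le> (\<Sum>S\<in>{S\<in>rough_prime_sets y z. \<Lambda> \<le> (2 ^ card S) ^ 4 \<and> 2 ^ (card S + 1) \<le> \<Lambda> ^ 2}. 1 / real (\<Prod>S))" "0 \<le> b"
  shows "real N / (32 * \<Lambda>) * (a * b) \<le> card {M. beats_average M \<and> 1 \<le> M \<and> M \<le> N}"
proof -
  define G where "G = {S\<in>rough_prime_sets y z. \<Lambda> \<le> (2 ^ card S) ^ 4 \<and> 2 ^ (card S + 1) \<le> \<Lambda> ^ 2}"
  define I where "I = {3..Q} \<times> G"
  define Ps where "Ps v = {P. prime P \<and> z < P \<and> P \<le> N div (fst v * \<Prod>(snd v))}" for v :: "nat \<times> nat set"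
  define \<phi> where "\<phi> w = fst (fst w) * \<Prod>(snd (fst w)) * snd w" for w :: "(nat \<times> nat set) \<times> nat"
  have N0: "N > 0" using \<Lambda> unfolding \<Lambda>_def by (cases N) auto
  have finG: "finite G" unfolding G_def by (rule finite_subset[OF _ finite_rough_prime_sets[of y z]]) auto
  have finI: "finite I" using finG by (simp add: I_def)
  have finP: "finite (Ps v)" for v unfolding Ps_def by (rule finite_subset[OF _ finite_primes_atMost[of "N div (fst v * \<Prod>(snd v))"]]) auto
  have I_D: "3 \<le> q" "q \<le> Q" "S \<in> rough_prime_sets y z" "\<Lambda> \<le> (2 ^ card S) ^ 4" "2 ^ (card S + 1) \<le> \<Lambda> ^ 2" if "(q, S) \<in> I" for q S
    using that by (auto simp: I_def G_def)
  have inj: "inj_on \<phi> (Sigma I Ps)"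
  proof (rule inj_onI)
    fix w w' assume w: "w \<in> Sigma I Ps" "w' \<in> Sigma I Ps" "\<phi> w = \<phi> w'"
    obtain q S P where e: "w = ((q, S), P)" by (metis surj_pair)
    obtain q' S' P' where e': "w' = ((q', S'), P')" by (metis surj_pair)
    have i: "(q, S) \<in> I" "P \<in> Ps (q, S)" "(q', S') \<in> I" "P' \<in> Ps (q', S')" using w e e' by auto
    have "q = q' \<and> S = S' \<and> P = P'"
    proof (rule triple_product_unique)
      show "S \<in> rough_prime_sets y z" "S' \<in> rough_prime_sets y z" using I_D(3) i by blast+
      show "0 < q" "q \<le> y" "0 < q'" "q' \<le> y" using I_D(1,2)[OF i(1)] I_D(1,2)[OF i(3)] Q(2) by auto
      show "prime P" "z < P" "prime P'" "z < P'" using i by (auto simp: Ps_def)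
      show "q * \<Prod>S * P = q' * \<Prod>S' * P'" using w(3) by (simp add: \<phi>_def e e')
    qed (rule yz)
    then show "w = w'" by (simp add: e e')
  qed
  have sub: "\<phi> ` Sigma I Ps \<subseteq> {M. beats_average M \<and> 1 \<le> M \<and> M \<le> N}"
  proof (rule image_subsetI)
    fix w assume w: "w \<in> Sigma I Ps"
    obtain q S P where e: "w = ((q, S), P)" by (metis surj_pair)
    have i: "(q, S) \<in> I" "P \<in> Ps (q, S)" using w e by auto
    note S = rough_prime_setsD[OF I_D(3)[OF i(1)]]
    have q: "3 \<le> q" "q \<le> y" using I_D(1,2)[OF i(1)] Q(2) by auto
    have P: "prime P" "z < P" "P \<le> N div (q * \<Prod>S)" using i(2) by (auto simp: Ps_def)
    have nP: "P \<notin> S" using S(2)[of P] P(2) by auto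
    have cS: "card (insert P S) = card S + 1" using nP S(1) by simp
    have pr: "q * \<Prod>(insert P S) = q * \<Prod>S * P" using nP S(1) by (simp add: mult.commute)
    have le: "q * \<Prod>S * P \<le> N"
    proof -
      have "q * \<Prod>S * P \<le> q * \<Prod>S * (N div (q * \<Prod>S))" using P(3) by (rule mult_left_mono) simp
      also have "\<dots> \<le> N" by (rule times_div_less_eq_dividend)
      finally show ?thesis .
    qed
    have pos: "0 < q * \<Prod>S * P" using q S(4) P(1) by (simp add: prime_gt_0_nat)
    interpret residue_setting q y "insert P S"
    proof
      show "0 < q" "0 < y" using q y(2) by auto
      show "finite (insert P S)" using S(1) by simp
      fix p assume p: "p \<in> insert P S"
      then have pp: "prime p" "y < p" using S(2)[of p] P yz by auto
      have "\<not> p dvd q" using pp q dvd_imp_le[of p q] by auto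
      then have "coprime p q" using pp prime_imp_coprime by blast
      then show "prime p \<and> 2 < p \<and> coprime p q \<and> y < p" using pp y(2) by auto
    qed
    have M: "M = q * \<Prod>S * P" by (simp only: M_def pr)
    interpret good_modulus q y "insert P S" \<Lambda>
    proof
      show "20000 \<le> \<Lambda>" "3 \<le> q" using \<Lambda> q by auto
      have "real q ^ 20 \<le> real Q ^ 20" using I_D(2)[OF i(1)] by (intro power_mono) auto
      then show "real q ^ 20 \<le> \<Lambda>" using Q(1) by linarith
      have "((2::real) ^ card S) ^ 4 \<le> (2 ^ (card S + 1)) ^ 4" by (intro power_mono power_increasing) auto
      then show "\<Lambda> \<le> (2 ^ card (insert P S)) ^ 4" using I_D(4)[OF i(1)] unfolding cS by linarith
      show "2 ^ card (insert P S) \<le> \<Lambda> ^ 2" using I_D(5)[OF i(1)] unfolding cS .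
      show "\<Lambda> ^ 220 \<le> real y" by (rule y(1))
      have "real M \<le> real N" using le unfolding M by (simp only: of_nat_le_iff)
      then show "ln (real M) \<le> \<Lambda>" unfolding \<Lambda>_def using M_pos by (subst ln_le_cancel_iff) auto
    qed
    show "\<phi> w \<in> {M. beats_average M \<and> 1 \<le> M \<and> M \<le> N}"
      using beats_average pos le by (simp add: \<phi>_def e M Suc_le_eq)
  qed
  have cnt: "real N / (32 * \<Lambda>) * (1 / q * (1 / real (\<Prod>S))) \<le> card (Ps (q, S))" if i: "(q, S) \<in> I" for q S
  proof -
    define m where "m = q * \<Prod>S"
    define X where "X = N div m"
    note S = rough_prime_setsD[OF I_D(3)[OF i]]
    have q: "3 \<le> q" "q \<le> Q" using I_D(1,2)[OF i] by auto
    have m0: "m > 0" using q S(4) by (simp add: m_def)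
    have z1: "real z \<ge> 1" using yz y(2) by simp
    have mz: "real m \<le> Q * real z"
    proof -
      have "m \<le> Q * z" unfolding m_def using q S(3) by (intro mult_mono) auto
      then have "real m \<le> real (Q * z)" by (simp only: of_nat_le_iff)
      then show ?thesis by simp
    qed
    have room2: "32 * real z * m * \<Lambda> \<le> N"
    proof -
      have "32 * real z * m * \<Lambda> \<le> 32 * real z * (Q * real z) * \<Lambda>"
        using mz \<Lambda> by (intro mult_right_mono mult_left_mono) auto
      then show ?thesis using room by (simp add: power2_eq_square mult.commute mult.left_commute)
    qed
    have X1: "X \<ge> 2"
    proof -
      have "2 * real m \<le> 32 * real z * m * \<Lambda>"
      proof -
        have "1 * 1 \<le> real z * \<Lambda>" using z1 \<Lambda> by (intro mult_mono) auto
        then have "2 \<le> 32 * (real z * \<Lambda>)" by linarith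
        then have "2 \<le> 32 * real z * \<Lambda>" by (simp only: mult.assoc)
        then have "2 * real m \<le> 32 * real z * \<Lambda> * real m" by (intro mult_right_mono) auto
        then show ?thesis by (simp add: mult.commute mult.left_commute)
      qed
      then have "2 * real m \<le> real N" using room2 by (rule order_trans)
      then have "real (2 * m) \<le> real N" by simp
      then have "2 * m \<le> N" by (simp only: of_nat_le_iff)
      then show ?thesis unfolding X_def using m0 by (simp add: less_eq_div_iff_mult_less_eq)
    qed
    have XN: "X \<le> N" by (simp add: X_def)
    have "real N / (2 * real m) \<le> X" unfolding X_def using X1 by (intro half_le_floor_div) (simp add: X_def)
    then have "real N / (2 * real m) / 8 \<le> real X / 8" by simp
    also have "\<dots> \<le> card {p. prime p \<and> p \<le> X} * ln X" by (rule prime_counting_lower_bound[OF X1])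
    also have "\<dots> \<le> card {p. prime p \<and> p \<le> X} * \<Lambda>"
      unfolding \<Lambda>_def using X1 XN by (intro mult_left_mono) auto
    finally have 1: "real N / (16 * real m * \<Lambda>) \<le> card {p. prime p \<and> p \<le> X}"
      using \<Lambda> m0 by (simp add: field_simps)
    have "{p. prime p \<and> p \<le> X} \<subseteq> Ps (q, S) \<union> {1..z}"
      by (auto simp: Ps_def X_def m_def Suc_le_eq prime_gt_0_nat not_less)
    then have "card {p. prime p \<and> p \<le> X} \<le> card (Ps (q, S) \<union> {1..z})" using finP by (intro card_mono) auto
    also have "\<dots> \<le> card (Ps (q, S)) + z" using card_Un_le[of "Ps (q, S)" "{1..z}"] by simp
    finally have 2: "real (card {p. prime p \<and> p \<le> X}) \<le> card (Ps (q, S)) + real z" by linarith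
    have "real z \<le> real N / (32 * real m * \<Lambda>)" using room2 m0 \<Lambda> by (simp add: field_simps)
    moreover have "real N / (16 * real m * \<Lambda>) = 2 * (real N / (32 * real m * \<Lambda>))" by simp
    ultimately have "real N / (32 * real m * \<Lambda>) \<le> card (Ps (q, S))" using 1 2 by linarith
    moreover have "real N / (32 * \<Lambda>) * (1 / q * (1 / real (\<Prod>S))) = real N / (32 * real m * \<Lambda>)"
      by (simp add: m_def)
    ultimately show ?thesis by linarith
  qed
  have "real N / (32 * \<Lambda>) * (a * b) \<le> real N / (32 * \<Lambda>) * ((\<Sum>q\<in>{3..Q}. 1 / real q) * (\<Sum>S\<in>G. 1 / real (\<Prod>S)))"
    using sq sT \<Lambda> unfolding G_def[symmetric] by (intro mult_left_mono mult_mono sum_nonneg) auto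
  also have "\<dots> = (\<Sum>v\<in>I. real N / (32 * \<Lambda>) * (1 / fst v * (1 / real (\<Prod>(snd v)))))"
  proof -
    have "(\<Sum>q\<in>{3..Q}. 1 / real q) * (\<Sum>S\<in>G. 1 / real (\<Prod>S)) = (\<Sum>v\<in>I. 1 / fst v * (1 / real (\<Prod>(snd v))))"
      unfolding I_def by (simp only: sum_product sum.cartesian_product case_prod_unfold)
    then show ?thesis by (simp only: sum_distrib_left)
  qed
  also have "\<dots> \<le> (\<Sum>v\<in>I. real (card (Ps v)))"
    using cnt by (intro sum_mono) auto
  also have "\<dots> = card (Sigma I Ps)" using finI finP by simp
  also have "\<dots> = card (\<phi> ` Sigma I Ps)" using inj by (simp add: card_image)
  also have "\<dots> \<le> card {M. beats_average M \<and> 1 \<le> M \<and> M \<le> N}"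
    using sub by (intro of_nat_mono card_mono) (auto intro: finite_subset[of _ "{..N}"])
  finally show ?thesis .
qed

text \<open>1280 = 32 * 40, with 32 from \<open>count_beats_average\<close> and 40 from the sum of 1
  / q, which is at least ln \<Lambda> / 40.\<close>

definition density_const :: real where
  "density_const = rough_const / 1768 / 1280"

text \<open>Up to rounding, y = \<Lambda>^220, z = N^(1/3) and Q = \<Lambda>^(1/20). The prime
  density 1 / \<Lambda> meets \<Lambda> / ln \<Lambda> from the rough squarefree numbers and ln
  \<Lambda> from the sum over q, and everything cancels up to a constant.\<close>

lemma eventually_count_beats_average:
  "eventually (\<lambda>N. density_const * real N \<le> card {M. beats_average M \<and> 1 \<le> M \<and> M \<le> N}) sequentially"
proof -
  note pos = rough_const_pos
  have "eventually (\<lambda>x::real. x \<ge> 20000 \<and> x ^ 220 + 1 \<le> x ^ 221 \<and> exp (x/4) \<le> exp (x/3) - 1 \<and> x ^ 221 \<le> exp (x/4) \<and>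
      x powr (1/20) \<le> x \<and> ln x \<ge> 60 \<and> 32 * (exp (x/3))\<^sup>2 * x * x \<le> exp x \<and> 2 \<le> exp (x/4)) at_top"
    by (intro eventually_conj) real_asymp+
  moreover have "eventually (\<lambda>x::real. rough_const * (x / 4) / (221 * ln x) - x powr (1/4) * (x powr (1/2) * exp (mertens_const / 2)) - 2 * exp (2 * mertens_const)
      \<ge> rough_const / 1768 * x / ln x) at_top"
    using pos by real_asymp
  ultimately have ev: "eventually (\<lambda>x::real. (x \<ge> 20000 \<and> x ^ 220 + 1 \<le> x ^ 221 \<and> exp (x/4) \<le> exp (x/3) - 1 \<and> x ^ 221 \<le> exp (x/4) \<and>
      x powr (1/20) \<le> x \<and> ln x \<ge> 60 \<and> 32 * (exp (x/3))\<^sup>2 * x * x \<le> exp x \<and> 2 \<le> exp (x/4)) \<and>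
      rough_const * (x / 4) / (221 * ln x) - x powr (1/4) * (x powr (1/2) * exp (mertens_const / 2)) - 2 * exp (2 * mertens_const)
      \<ge> rough_const / 1768 * x / ln x) at_top"
    by eventually_elim blast
  have "filterlim (\<lambda>N::nat. ln (real N)) at_top sequentially" by real_asymp
  from eventually_compose_filterlim[OF ev this] show ?thesis
  proof eventually_elim
    case (elim N)
    define \<Lambda> where "\<Lambda> = ln (real N)"
    have h: "\<Lambda> \<ge> 20000" "\<Lambda> ^ 220 + 1 \<le> \<Lambda> ^ 221" "exp (\<Lambda>/4) \<le> exp (\<Lambda>/3) - 1" "\<Lambda> ^ 221 \<le> exp (\<Lambda>/4)"
      "\<Lambda> powr (1/20) \<le> \<Lambda>" "ln \<Lambda> \<ge> 60" "32 * (exp (\<Lambda>/3))\<^sup>2 * \<Lambda> * \<Lambda> \<le> exp \<Lambda>" "2 \<le> exp (\<Lambda>/4)"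
      "rough_const * (\<Lambda> / 4) / (221 * ln \<Lambda>) - \<Lambda> powr (1/4) * (\<Lambda> powr (1/2) * exp (mertens_const / 2)) - 2 * exp (2 * mertens_const)
      \<ge> rough_const / 1768 * \<Lambda> / ln \<Lambda>"
      using elim unfolding \<Lambda>_def by blast+
    have N0: "N > 0" using h(1) unfolding \<Lambda>_def by (cases N) auto
    have eN: "exp \<Lambda> = real N" using N0 by (simp add: \<Lambda>_def)
    define y where "y = nat \<lceil>\<Lambda> ^ 220\<rceil>"
    \<comment> \<open>Any exponent below 1/2 would leave room for z^2 Q \<Lambda> below N / 32,
      while ln z stays proportional to \<Lambda>.\<close>
    define z where "z = nat \<lfloor>exp (\<Lambda> / 3)\<rfloor>"
    define Q where "Q = nat \<lfloor>\<Lambda> powr (1/20)\<rfloor>"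
    have L1: "1 \<le> \<Lambda> ^ 220" using h(1) by simp
    have y: "\<Lambda> ^ 220 \<le> real y" "real y \<le> \<Lambda> ^ 221" using L1 h(2) unfolding y_def by linarith+
    have z: "real z \<le> exp (\<Lambda> / 3)" "exp (\<Lambda> / 4) \<le> real z"
      using h(3) exp_gt_zero[of "\<Lambda> / 3"] unfolding z_def by linarith+
    have Q: "real Q \<le> \<Lambda> powr (1/20)" "\<Lambda> powr (1/20) \<le> real Q + 1"
      using powr_ge_zero[of \<Lambda> "1/20"] unfolding Q_def by linarith+
    have Q20: "real Q ^ 20 \<le> \<Lambda>"
    proof -
      have "real Q ^ 20 \<le> (\<Lambda> powr (1/20)) ^ 20" using Q by (intro power_mono) auto
      also have "\<dots> = \<Lambda>" using h(1) by (simp add: powr_realpow[symmetric] powr_powr)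
      finally show ?thesis .
    qed
    have pw: "\<Lambda> ^ 1 \<le> \<Lambda> ^ 220" using h(1) by (intro power_increasing) auto
    have y2: "2 \<le> y"
    proof -
      have "2 \<le> real y" using y(1) pw h(1) by simp
      then show ?thesis by simp
    qed
    have Qy: "Q \<le> y"
    proof -
      have "real Q \<le> real y" using Q(1) h(5) pw y(1) by simp
      then show ?thesis by simp
    qed
    have yz: "y \<le> z"
    proof -
      have "real y \<le> real z" using y(2) h(4) z(2) by linarith
      then show ?thesis by simp
    qed
    have z2: "2 \<le> z" using y2 yz by simp
    have lz: "\<Lambda> / 4 \<le> ln z" "ln z \<le> \<Lambda>"
    proof -
      have "ln (exp (\<Lambda> / 4)) \<le> ln (real z)" using z(2) z2 by (subst ln_le_cancel_iff) auto
      then show "\<Lambda> / 4 \<le> ln z" by simp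
      have "ln (real z) \<le> ln (exp (\<Lambda> / 3))" using z(1) z2 by (subst ln_le_cancel_iff) auto
      then show "ln z \<le> \<Lambda>" using h(1) by simp
    qed
    have room: "32 * real z ^ 2 * Q * \<Lambda> \<le> N"
    proof -
      have "32 * real z ^ 2 * Q * \<Lambda> \<le> 32 * (exp (\<Lambda> / 3))\<^sup>2 * \<Lambda> * \<Lambda>"
        using z(1) Q(1) h(1,5) by (intro mult_right_mono mult_mono power_mono) auto
      then show ?thesis using h(7) eN by linarith
    qed
    \<comment> \<open>Leaving out q = 1 and q = 2 costs 3 / 2, at most half of ln \<Lambda> / 20
      because \<open>ln \<Lambda> \<ge> 60\<close>.\<close>
    have sq: "ln \<Lambda> / 40 \<le> (\<Sum>q\<in>{3..Q}. 1 / real q)"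
    proof -
      have "ln \<Lambda> / 20 = ln (\<Lambda> powr (1/20))" using h(1) by (simp add: ln_powr)
      also have "\<dots> \<le> ln (real Q + 1)" using Q(2) h(1) by (subst ln_le_cancel_iff) auto
      also have "\<dots> \<le> harm Q" by (rule ln_le_harm)
      also have "harm Q = (\<Sum>q\<in>{1..Q}. 1 / real q)" by (simp add: harm_def divide_inverse)
      also have "\<dots> \<le> (\<Sum>q\<in>{1, 2} \<union> {3..Q}. 1 / real q)" by (intro sum_mono2) auto
      also have "\<dots> = 3 / 2 + (\<Sum>q\<in>{3..Q}. 1 / real q)" by (subst sum.union_disjoint) auto
      finally show ?thesis using h(6) by simp
    qed
    have sT: "rough_const / 1768 * \<Lambda> / ln \<Lambda> \<le> (\<Sum>S\<in>{S\<in>rough_prime_sets y z. \<Lambda> \<le> (2 ^ card S) ^ 4 \<and> 2 ^ (card S + 1) \<le> \<Lambda> ^ 2}. 1 / real (\<Prod>S))"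
      by (rule good_rough_sets_lower_bound[OF h(1) y2 y(2) z2 lz h(9)])
    have "real N / (32 * \<Lambda>) * (ln \<Lambda> / 40 * (rough_const / 1768 * \<Lambda> / ln \<Lambda>)) \<le> card {M. beats_average M \<and> 1 \<le> M \<and> M \<le> N}"
      using h(1,6) pos Q20 Qy yz room sq sT y y2 unfolding \<Lambda>_def by (intro count_beats_average) auto
    moreover have "real N / (32 * \<Lambda>) * (ln \<Lambda> / 40 * (rough_const / 1768 * \<Lambda> / ln \<Lambda>)) = density_const * real N"
      using h(1,6) by (simp add: density_const_def field_simps)
    ultimately show ?case by simp
  qed
qed

theorem theorem1p2:
  shows "lower_density {M :: nat. 1 \<le> M \<and>
           real_of_int (gap_square_sum M (quad_residues M))
             < avg_gap_square_sum M (card (quad_residues M))} > 0"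
proof -
  define A where "A = {M :: nat. 1 \<le> M \<and> beats_average M}"
  have "eventually (\<lambda>N. ereal density_const \<le> ereal (real (card {M \<in> A. 1 \<le> M \<and> M \<le> N}) / real N)) sequentially"
    using eventually_count_beats_average eventually_gt_at_top[of 0]
  proof eventually_elim
    case (elim N)
    have "{M \<in> A. 1 \<le> M \<and> M \<le> N} = {M. beats_average M \<and> 1 \<le> M \<and> M \<le> N}" by (auto simp: A_def)
    then show ?case using elim by (simp add: le_divide_eq)
  qed
  then have "ereal density_const \<le> lower_density A" unfolding lower_density_def by (rule Liminf_bounded)
  moreover have "0 < ereal density_const" using rough_const_pos by (simp add: density_const_def)
  ultimately have "0 < lower_density A" by (rule less_le_trans[rotated])
  then show ?thesis by (simp add: A_def beats_average_def)
qed

end
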